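(* Let $p\in(0,1]$ and let $(F_n)_{n\ge1}$, $(\widetilde F_n)_{n\ge1}$ be the random Fibonacci sequences with $F_1=F_2=\widetilde F_1=\widetilde F_2=1$ and, for $n\ge1$, $F_{n+2}=F_{n+1}\pm F_n$ (linear case), respectively $\widetilde F_{n+2}=|\widetilde F_{n+1}\pm\widetilde F_n|$ (non-linear case), where the $\pm$ signs are independent, each being $+$ with probability $p$ and $-$ with probability $1-p$. For $\alpha\in[0,1]$ let $\nu_\alpha$ be the probability measure on $\mathbb{R}_+$ defined inductively on Stern-Brocot intervals as in the context. (Linear case) Almost surely $$\frac1n\log|F_n|\xrightarrow[n\to\infty]{}\gamma_p=\int_0^\infty\log x\,d\nu_\alpha(x),\qquad\text{where }\alpha:=\frac{3p-2+\sqrt{5p^2-8p+4}}{2p}.$$ (Non-linear case) If $p\le1/3$, then almost surely $$\frac1n\log\widetilde F_n\xrightarrow[n\to\infty]{}\widetilde\gamma_p=0.$$ If $p\ge1/3$, then almost surely $$\frac1n\log\widetilde F_n\xrightarrow[n\to\infty]{}\widetilde\gamma_p=\int_0^\infty\log x\,d\nu_\alpha(x),\qquad\text{where }\alpha:=\frac{2p}{p+\sqrt{p(4-3p)}}.$$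
   Context: Positive Stern-Brocot intervals are defined inductively, with the convention $\frac10=+\infty$. The only Stern-Brocot interval of rank $0$ is $[\frac01,\frac10]=[0,\infty]$. Each Stern-Brocot interval $[\frac ab,\frac cd]$ of rank $r$ is cut into two Stern-Brocot intervals of rank $r+1$: the left one $[\frac ab,\frac{a+c}{b+d}]$ and the right one $[\frac{a+c}{b+d},\frac cd]$. For $\alpha\in[0,1]$, $\nu_\alpha$ is the probability measure on $\mathbb{R}_+$ defined inductively on Stern-Brocot intervals: first assign mass $1-\alpha$ to $[0,1]$ and mass $\alpha$ to $[1,\infty]$ (rank $1$). Once $\nu_\alpha$ is defined on a Stern-Brocot interval of rank $r\ge1$, a proportion $\alpha$ of its mass is given to its left subinterval of rank $r+1$ if $r$ is odd, and to its right subinterval of rank $r+1$ if $r$ is even; the other subinterval receives the remaining proportion $1-\alpha$.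
   Formalization: For p ≤ 1/3 the non-linear sequence almost surely equals 0 infinitely often, so log F̃_n is then −∞ and the printed limit fails; here log 0 is read as 0, equivalently the limit is taken along the n with F̃_n ≠ 0. *)

theory Defs
  imports "HOL-Probability.Probability"
begin

(* stern_brocot r a b c d: the pair of fractions a/b, c/d bounds a positive
   Stern-Brocot interval of rank r. The root is (0/1, 1/0). *)
inductive stern_brocot :: "nat \<Rightarrow> nat \<Rightarrow> nat \<Rightarrow> nat \<Rightarrow> nat \<Rightarrow> bool" where
  root: "stern_brocot 0 0 1 1 0"
| left: "stern_brocot r a b c d \<Longrightarrow> stern_brocot (Suc r) a b (a + c) (b + d)"
| right: "stern_brocot r a b c d \<Longrightarrow> stern_brocot (Suc r) (a + c) (b + d) c d"

(* The real points of [a/b, c/d]. Division is taken in ereal because there 1/0 = \<infinity>,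
   whereas 1/0 = 0 in real. *)
definition sb_interval :: "nat \<Rightarrow> nat \<Rightarrow> nat \<Rightarrow> nat \<Rightarrow> real set" where
  "sb_interval a b c d =
     {x. ereal (real a) / ereal (real b) \<le> ereal x \<and>
         ereal x \<le> ereal (real c) / ereal (real d)}"

definition is_nu :: "real \<Rightarrow> real measure \<Rightarrow> bool" where
  "is_nu \<alpha> N \<longleftrightarrow>
     prob_space N \<and>
     sets N = sets (restrict_space borel {0..}) \<and>
     measure N (sb_interval 0 1 1 1) = 1 - \<alpha> \<and>
     measure N (sb_interval 1 1 1 0) = \<alpha> \<and>
     (\<forall>r a b c d. stern_brocot r a b c d \<and> 1 \<le> r \<longrightarrow>
        measure N (sb_interval a b (a + c) (b + d)) =
          (if odd r then \<alpha> else 1 - \<alpha>) * measure N (sb_interval a b c d) \<and>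
        measure N (sb_interval (a + c) (b + d) c d) =
          (if odd r then 1 - \<alpha> else \<alpha>) * measure N (sb_interval a b c d))"

(* For 0 \<le> \<alpha> \<le> 1 exactly one measure satisfies is_nu \<alpha>. The two subintervals share an
   endpoint, which is consistent because the conditions force rational points to be null
   (the two proportions alternate along the intervals shrinking to a fixed endpoint). *)
definition nu :: "real \<Rightarrow> real measure" where
  "nu \<alpha> = (THE N. is_nu \<alpha> N)"

end

theory Submission
  imports Defs
begin

text \<open>
  The measure \<open>\<nu>\<^sub>\<alpha>\<close> is the stationary law of the random map that sends \<open>x\<close> to \<open>1 + 1/x\<close> with
  probability \<open>\<alpha>\<close> and to \<open>1/(1 + x)\<close> with probability \<open>1 - \<alpha>\<close>; in the coordinate \<open>y = ln x\<close> this map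
  contracts in the mean.

  On pairs of absolute values \<open>v = (a, b)\<close> a step of either sequence is \<open>R v = (b, a + b)\<close> or
  \<open>L v = (b, \<bar>a - b\<bar>)\<close>, and \<open>L (L (R v)) = v\<close>. Let \<open>q\<close> be the probability that the walk ever
  undoes a step \<open>R\<close>. The walk that is conditioned never to go below \<open>v\<close> multiplies independent
  blocks \<open>R\<close> and \<open>L R\<close> with weights \<open>\<alpha> = 1/(1 + q)\<close> and \<open>1 - \<alpha>\<close>, and its growth is measured by
  \<open>H v = \<integral> ln (a + b x) d\<nu>\<^sub>\<alpha>\<close>. Averaging \<open>H\<close> over the number of levels that the walk descends
  below \<open>v\<close> gives a function that increases by exactly \<open>\<integral> ln x d\<nu>\<^sub>\<alpha>\<close> in the mean at every step
  and stays at bounded distance from the logarithm of the larger entry. In the linear case the relative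
  sign of the pair enters as well, since undoing a step \<open>R\<close> reverses it.

  The law of large numbers for martingales with bounded increments then gives the growth of the pair. A
  single entry cannot be much smaller than the other, because the number of steps \<open>L\<close> needed to reduce
  the pair to the root grows at most linearly in time. For \<open>p \<le> 1/3\<close> this number is dominated by a
  reflected walk with nonpositive drift.
\<close>

section \<open>The stationary law in logarithmic coordinates\<close>

text \<open>The conditioned walk is never constructed: \<open>q\<close> enters only as the root of
  an equation that the heuristic predicts. Undoing \<open>R\<close> takes three steps down, so the
  walk of absolute values should satisfy \<open>q = (1 - p) + p q^3\<close>; dividing out the root 1
  leaves \<open>p (1 + q + q^2) = 1\<close>, whose nonnegative root is below 1 exactly for
  \<open>p > 1/3\<close>. With signs, two probabilities are coupled,
  \<open>q = (1 - p) + p q^2 r\<close> and \<open>r = p + (1 - p) q^2 r\<close>; both equations hold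
  for \<open>r = 1 / (1 + q)\<close> as soon as \<open>(1 - p) (1 - q^2) = p q\<close>. Solving the
  two quadratics gives the two formulas for \<open>\<alpha>\<close>. The value
  \<open>\<alpha> = 1 / (1 + q)\<close> arises because, after a step up from \<open>v\<close>, the
  lowest level ever reached is \<open>R v\<close> or \<open>L (R v)\<close> with weights
  \<open>1 - q\<close> and \<open>q (1 - q)\<close>. The obstacle is a pair with a zero entry: it
  has no relative sign, and \<open>L\<close> only turns in a cycle of three pairs there. The descent
  is continued formally around the cycle, and in the linear case \<open>\<kappa>\<close> is tuned so
  that both signs give the same potential.\<close>

lemma AE_summable_abs:
  fixes f :: "nat \<Rightarrow> 'a \<Rightarrow> real"
  assumes [measurable]: "\<And>n. f n \<in> borel_measurable M"
    and fin: "(\<Sum>n. \<integral>\<^sup>+x. ennreal \<bar>f n x\<bar> \<partial>M) < \<infinity>"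
  shows "AE x in M. summable (\<lambda>n. \<bar>f n x\<bar>)"
proof -
  have "(\<integral>\<^sup>+x. (\<Sum>n. ennreal \<bar>f n x\<bar>) \<partial>M) = (\<Sum>n. \<integral>\<^sup>+x. ennreal \<bar>f n x\<bar> \<partial>M)"
    by (rule nn_integral_suminf) auto
  with fin have "(\<integral>\<^sup>+x. (\<Sum>n. ennreal \<bar>f n x\<bar>) \<partial>M) \<noteq> \<infinity>" by auto
  then have "AE x in M. (\<Sum>n. ennreal \<bar>f n x\<bar>) \<noteq> \<infinity>"
    by (rule nn_integral_PInf_AE[rotated]) auto
  then show ?thesis
    by eventually_elim (rule summable_suminf_not_top, auto)
qed

definition log_step :: "bool \<Rightarrow> real \<Rightarrow> real" where
  "log_step b y = (if b then ln (1 + exp (- y)) else - ln (1 + exp y))"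

lemma ln_one_plus_exp_minus: "ln (1 + exp (- y)) = ln (1 + exp y) - (y::real)"
proof -
  have "1 + exp (- y) = (1 + exp y) / exp y" by (simp add: field_simps exp_minus)
  moreover have "1 + exp y > 0" by (simp add: add_pos_pos)
  ultimately show ?thesis by (simp add: ln_div)
qed

text \<open>Both branches are decreasing in \<open>y\<close> and their sum is \<open>- y\<close>, so
  their absolute increments add up exactly. Choosing a branch at random thus contracts distances in
  the mean by the factor \<open>max \<alpha> (1 - \<alpha>)\<close>.\<close>

lemma log_step_dist_sum:
  "\<bar>log_step True x - log_step True y\<bar> + \<bar>log_step False x - log_step False y\<bar> = \<bar>x - y\<bar>"
proof -
  have *: "\<bar>log_step True x - log_step True y\<bar> + \<bar>log_step False x - log_step False y\<bar> = \<bar>x - y\<bar>"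
    if "x \<le> y" for x y
  proof -
    have "ln (1 + exp (- y)) \<le> ln (1 + exp (- x))" "ln (1 + exp x) \<le> ln (1 + exp y)"
      using that by (simp_all add: add_pos_pos)
    then show ?thesis using that by (simp add: log_step_def) (simp add: ln_one_plus_exp_minus)
  qed
  show ?thesis using *[of x y] *[of y x] by (cases "x \<le> y") (simp_all add: abs_minus_commute)
qed

lemma borel_measurable_log_step [measurable]: "log_step b \<in> borel_measurable borel"
  unfolding log_step_def by measurable

lemma continuous_log_step: "isCont (log_step b) y"
proof -
  have "1 + exp (- y) \<noteq> 0" "1 + exp y \<noteq> 0" by (smt (verit) exp_gt_zero)+
  then show ?thesis unfolding log_step_def by (cases b) (auto intro!: continuous_intros)
qed

text \<open>The first coin is applied last. Passing from \<open>n\<close> to \<open>Suc n\<close>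
  then changes only the innermost argument, so the iterates converge along each typical stream and
  not merely in law.\<close>

primrec coin_iter :: "nat \<Rightarrow> bool stream \<Rightarrow> real" where
  "coin_iter 0 \<omega> = 0"
| "coin_iter (Suc n) \<omega> = log_step (shd \<omega>) (coin_iter n (stl \<omega>))"

lemma borel_measurable_coin_iter [measurable]:
  "coin_iter n \<in> borel_measurable (stream_space (measure_pmf \<pi>))"
proof (induction n)
  case (Suc n)
  note [measurable] = Suc
  have "(\<lambda>\<omega>. if shd \<omega> then log_step True (coin_iter n (stl \<omega>)) else log_step False (coin_iter n (stl \<omega>)))
      \<in> borel_measurable (stream_space (measure_pmf \<pi>))"
    by measurable
  then show ?case by (rule measurable_cong[THEN iffD1, rotated]) auto
qed simp

text \<open>For \<open>0 < \<alpha> < 1\<close> the mean distance of successive iterates decays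
  geometrically, which gives an integrable almost sure limit. For \<open>\<alpha>\<close> equal to 0
  or 1 the contraction factor is 1, and a point mass at a fixed point is used instead.\<close>

lemma ex_stationary_log:
  fixes \<alpha> :: real
  assumes "0 \<le> \<alpha>" "\<alpha> \<le> 1"
  obtains \<mu> :: "real measure" where "prob_space \<mu>" "sets \<mu> = sets borel" "integrable \<mu> (\<lambda>y. y)"
    "\<And>f. f \<in> borel_measurable borel \<Longrightarrow>
      (\<integral>\<^sup>+y. f y \<partial>\<mu>) = ennreal \<alpha> * (\<integral>\<^sup>+y. f (log_step True y) \<partial>\<mu>) + ennreal (1 - \<alpha>) * (\<integral>\<^sup>+y. f (log_step False y) \<partial>\<mu>)"
proof (cases "0 < \<alpha> \<and> \<alpha> < 1")
  case True
  let ?B = "measure_pmf (bernoulli_pmf \<alpha>)" let ?S = "stream_space ?B"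
  interpret S: prob_space ?S by (rule prob_space.prob_space_stream_space[OF prob_space_measure_pmf])
  define \<theta> where "\<theta> = max \<alpha> (1 - \<alpha>)"
  have \<theta>: "0 \<le> \<theta>" "\<theta> < 1" using True by (auto simp: \<theta>_def)
  have split: "(\<integral>\<^sup>+\<omega>. f \<omega> \<partial>?S) = ennreal \<alpha> * (\<integral>\<^sup>+\<omega>. f (True ## \<omega>) \<partial>?S) + ennreal (1 - \<alpha>) * (\<integral>\<^sup>+\<omega>. f (False ## \<omega>) \<partial>?S)"
    if "f \<in> borel_measurable ?S" for f
    using True by (subst prob_space.nn_integral_stream_space[OF prob_space_measure_pmf that])
      (simp add: nn_integral_bernoulli_pmf mult.commute)
  \<comment> \<open>The constant \<open>ln 2\<close> is the distance from 0 to its image under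
    either branch; every further outer coin contributes a factor \<open>\<theta>\<close>.\<close>
  have dec: "(\<integral>\<^sup>+\<omega>. ennreal \<bar>coin_iter (Suc n) \<omega> - coin_iter n \<omega>\<bar> \<partial>?S) \<le> ennreal (ln 2 * \<theta> ^ n)" for n
  proof (induction n)
    case 0
    have "\<bar>coin_iter (Suc 0) \<omega> - coin_iter 0 \<omega>\<bar> = ln 2" for \<omega>
      by (simp add: log_step_def)
    then show ?case by (simp add: S.emeasure_space_1)
  next
    case (Suc n)
    let ?d = "\<lambda>b \<omega>. \<bar>log_step b (coin_iter (Suc n) \<omega>) - log_step b (coin_iter n \<omega>)\<bar>"
    have "(\<integral>\<^sup>+\<omega>. ennreal \<bar>coin_iter (Suc (Suc n)) \<omega> - coin_iter (Suc n) \<omega>\<bar> \<partial>?S)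
        = ennreal \<alpha> * (\<integral>\<^sup>+\<omega>. ennreal (?d True \<omega>) \<partial>?S) + ennreal (1 - \<alpha>) * (\<integral>\<^sup>+\<omega>. ennreal (?d False \<omega>) \<partial>?S)"
      by (subst split) (auto simp del: coin_iter.simps(2) simp: coin_iter.simps(2)[of "Suc n"] coin_iter.simps(2)[of n "_ ## _"])
    also have "\<dots> = (\<integral>\<^sup>+\<omega>. ennreal \<alpha> * ennreal (?d True \<omega>) + ennreal (1 - \<alpha>) * ennreal (?d False \<omega>) \<partial>?S)"
      by (subst nn_integral_add) (auto simp: nn_integral_cmult simp del: coin_iter.simps(2))
    also have "\<dots> \<le> (\<integral>\<^sup>+\<omega>. ennreal \<theta> * ennreal \<bar>coin_iter (Suc n) \<omega> - coin_iter n \<omega>\<bar> \<partial>?S)"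
    proof (rule nn_integral_mono)
      fix \<omega>
      have "\<alpha> * ?d True \<omega> + (1 - \<alpha>) * ?d False \<omega> \<le> \<theta> * ?d True \<omega> + \<theta> * ?d False \<omega>"
        by (intro add_mono mult_right_mono) (auto simp: \<theta>_def)
      also have "\<dots> = \<theta> * \<bar>coin_iter (Suc n) \<omega> - coin_iter n \<omega>\<bar>"
        by (metis log_step_dist_sum distrib_left)
      finally show "ennreal \<alpha> * ennreal (?d True \<omega>) + ennreal (1 - \<alpha>) * ennreal (?d False \<omega>)
          \<le> ennreal \<theta> * ennreal \<bar>coin_iter (Suc n) \<omega> - coin_iter n \<omega>\<bar>"
        using True \<theta> by (simp del: coin_iter.simps add: ennreal_mult[symmetric] ennreal_plus[symmetric] del: ennreal_plus)
    qed
    also have "\<dots> = ennreal \<theta> * (\<integral>\<^sup>+\<omega>. ennreal \<bar>coin_iter (Suc n) \<omega> - coin_iter n \<omega>\<bar> \<partial>?S)"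
      by (rule nn_integral_cmult) auto
    also have "\<dots> \<le> ennreal \<theta> * ennreal (ln 2 * \<theta> ^ n)"
      by (intro mult_left_mono Suc) auto
    also have "\<dots> = ennreal (ln 2 * \<theta> ^ Suc n)"
      using \<theta> by (simp add: ennreal_mult[symmetric] mult_ac)
    finally show ?case .
  qed
  have sum_le: "(\<Sum>n. \<integral>\<^sup>+\<omega>. ennreal \<bar>coin_iter (Suc n) \<omega> - coin_iter n \<omega>\<bar> \<partial>?S) < \<infinity>"
  proof -
    have "(\<Sum>n. \<integral>\<^sup>+\<omega>. ennreal \<bar>coin_iter (Suc n) \<omega> - coin_iter n \<omega>\<bar> \<partial>?S) \<le> (\<Sum>n. ennreal (ln 2 * \<theta> ^ n))"
      by (intro suminf_le dec) auto
    also have "\<dots> = ennreal (\<Sum>n. ln 2 * \<theta> ^ n)"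
      using \<theta> by (intro suminf_ennreal2) (auto intro!: summable_mult summable_geometric)
    finally show ?thesis by (simp add: order_le_less_trans)
  qed
  have AEsum: "AE \<omega> in ?S. summable (\<lambda>n. \<bar>coin_iter (Suc n) \<omega> - coin_iter n \<omega>\<bar>)"
    by (rule AE_summable_abs[OF _ sum_le]) (auto simp del: coin_iter.simps)
  define Z where "Z \<omega> = lim (\<lambda>n. coin_iter n \<omega>)" for \<omega>
  have [measurable]: "Z \<in> borel_measurable ?S" unfolding Z_def by measurable
  have tele: "(\<Sum>k<n. coin_iter (Suc k) \<omega> - coin_iter k \<omega>) = coin_iter n \<omega>" for n \<omega>
    by (subst sum_lessThan_telescope) simp
  have conv: "(\<lambda>n. coin_iter n \<omega>) \<longlonglongrightarrow> Z \<omega> \<and> ennreal \<bar>Z \<omega>\<bar> \<le> (\<Sum>n. ennreal \<bar>coin_iter (Suc n) \<omega> - coin_iter n \<omega>\<bar>)"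
    if s: "summable (\<lambda>n. \<bar>coin_iter (Suc n) \<omega> - coin_iter n \<omega>\<bar>)" for \<omega>
  proof -
    have s': "summable (\<lambda>n. coin_iter (Suc n) \<omega> - coin_iter n \<omega>)"
      by (rule summable_rabs_cancel[OF s])
    then have l: "(\<lambda>n. coin_iter n \<omega>) \<longlonglongrightarrow> (\<Sum>n. coin_iter (Suc n) \<omega> - coin_iter n \<omega>)"
      using summable_LIMSEQ[OF s'] by (simp only: tele)
    then have Z: "Z \<omega> = (\<Sum>n. coin_iter (Suc n) \<omega> - coin_iter n \<omega>)" unfolding Z_def by (rule limI)
    have "\<bar>Z \<omega>\<bar> \<le> (\<Sum>n. \<bar>coin_iter (Suc n) \<omega> - coin_iter n \<omega>\<bar>)"
      unfolding Z by (rule summable_rabs[OF s])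
    then show ?thesis using l Z
      by (simp add: suminf_ennreal2[OF _ s] del: coin_iter.simps)
  qed
  have AEconv: "AE \<omega> in ?S. (\<lambda>n. coin_iter n \<omega>) \<longlonglongrightarrow> Z \<omega>"
    using AEsum by eventually_elim (use conv in blast)
  \<comment> \<open>Prepending a coin applies one more random branch to the limit. As the tail of a
    coin stream has the law of the whole stream, the law of \<open>Z\<close> is stationary.\<close>
  have AEstep: "AE \<omega> in ?S. Z (b ## \<omega>) = log_step b (Z \<omega>)" for b
    using AEconv
  proof eventually_elim
    case (elim \<omega>)
    have "(\<lambda>n. log_step b (coin_iter n \<omega>)) \<longlonglongrightarrow> log_step b (Z \<omega>)"
      by (rule isCont_tendsto_compose[OF continuous_log_step elim])
    then have "(\<lambda>n. coin_iter (Suc n) (b ## \<omega>)) \<longlonglongrightarrow> log_step b (Z \<omega>)" by simp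
    then have "(\<lambda>n. coin_iter n (b ## \<omega>)) \<longlonglongrightarrow> log_step b (Z \<omega>)" by (subst (asm) filterlim_sequentially_Suc)
    then show ?case unfolding Z_def[of "b ## \<omega>"] by (rule limI)
  qed
  have "(\<integral>\<^sup>+\<omega>. ennreal \<bar>Z \<omega>\<bar> \<partial>?S) \<le> (\<integral>\<^sup>+\<omega>. (\<Sum>n. ennreal \<bar>coin_iter (Suc n) \<omega> - coin_iter n \<omega>\<bar>) \<partial>?S)"
    by (rule nn_integral_mono_AE) (use AEsum in eventually_elim, use conv in blast)
  also have "\<dots> = (\<Sum>n. \<integral>\<^sup>+\<omega>. ennreal \<bar>coin_iter (Suc n) \<omega> - coin_iter n \<omega>\<bar> \<partial>?S)"
    by (rule nn_integral_suminf) (auto simp del: coin_iter.simps)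
  also note sum_le
  finally have intZ: "integrable ?S Z" by (intro integrableI_bounded) auto
  define \<mu> where "\<mu> = distr ?S borel Z"
  show thesis
  proof (rule that[of \<mu>])
    show "prob_space \<mu>" unfolding \<mu>_def by (rule S.prob_space_distr) auto
    show "sets \<mu> = sets borel" by (simp add: \<mu>_def)
    show "integrable \<mu> (\<lambda>y. y)" unfolding \<mu>_def using intZ by (subst integrable_distr_eq) auto
    fix f :: "real \<Rightarrow> ennreal" assume [measurable]: "f \<in> borel_measurable borel"
    have "(\<integral>\<^sup>+\<omega>. f (Z (b ## \<omega>)) \<partial>?S) = (\<integral>\<^sup>+\<omega>. f (log_step b (Z \<omega>)) \<partial>?S)" for b
      by (rule nn_integral_cong_AE) (use AEstep[of b] in eventually_elim, simp)
    then show "(\<integral>\<^sup>+y. f y \<partial>\<mu>) = ennreal \<alpha> * (\<integral>\<^sup>+y. f (log_step True y) \<partial>\<mu>) + ennreal (1 - \<alpha>) * (\<integral>\<^sup>+y. f (log_step False y) \<partial>\<mu>)"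
      unfolding \<mu>_def by (subst (1 2 3) nn_integral_distr) (simp_all add: split[of "\<lambda>\<omega>. f (Z \<omega>)"])
  qed
next
  case False
  \<comment> \<open>The golden ratio is fixed by \<open>x \<mapsto> 1 + 1/x\<close> and its inverse
    by \<open>x \<mapsto> 1/(1 + x)\<close>; the branch of weight 0 does not matter.\<close>
  define \<phi> :: real where "\<phi> = (1 + sqrt 5) / 2"
  have \<phi>: "\<phi> > 0" "1 + 1 / \<phi> = \<phi>" "1 / (1 + 1 / \<phi>) = 1 / \<phi>"
  proof -
    show p: "\<phi> > 0" by (simp add: \<phi>_def add_pos_nonneg)
    have "\<phi> * \<phi> = \<phi> + 1" by (simp add: \<phi>_def field_simps)
    then show q: "1 + 1 / \<phi> = \<phi>" using p by (simp add: field_simps)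
    show "1 / (1 + 1 / \<phi>) = 1 / \<phi>" by (simp add: q)
  qed
  define b where "b = (0 < \<alpha>)"
  define y0 where "y0 = (if b then ln \<phi> else - ln \<phi>)"
  have st: "log_step b y0 = y0"
    using \<phi> by (auto simp: log_step_def y0_def exp_minus inverse_eq_divide)
  show thesis
  proof (rule that[of "return borel y0"])
    show "prob_space (return borel y0)" by (rule prob_space_return) simp
    show "sets (return borel y0) = sets borel" by simp
    show "integrable (return borel y0) (\<lambda>y. y)"
      by (intro integrableI_bounded) (auto simp: nn_integral_return)
    fix f :: "real \<Rightarrow> ennreal" assume [measurable]: "f \<in> borel_measurable borel"
    show "(\<integral>\<^sup>+y. f y \<partial>return borel y0) = ennreal \<alpha> * (\<integral>\<^sup>+y. f (log_step True y) \<partial>return borel y0) + ennreal (1 - \<alpha>) * (\<integral>\<^sup>+y. f (log_step False y) \<partial>return borel y0)"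
      using False assms st by (cases b) (auto simp: nn_integral_return b_def)
  qed
qed

section \<open>Uniqueness of the Stern-Brocot measure\<close>

lemma stern_brocot_det: "stern_brocot r a b c d \<Longrightarrow> b * c = a * d + 1"
  by (induction rule: stern_brocot.induct) (auto simp: algebra_simps)

lemma stern_brocot_pos: "stern_brocot r a b c d \<Longrightarrow> 0 < b \<and> 0 < c"
  by (induction rule: stern_brocot.induct) auto

text \<open>A mediant adds at least 1 to the sum because \<open>b\<close> and \<open>c\<close> stay
  positive. Against the determinant relation this rules out that intervals of arbitrarily high rank
  contain a fixed segment.\<close>

lemma stern_brocot_sum_ge: "stern_brocot r a b c d \<Longrightarrow> r + 2 \<le> a + b + c + d"
proof (induction rule: stern_brocot.induct)
  case (left r a b c d)
  then show ?case using stern_brocot_pos[OF left.hyps] by auto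
next
  case (right r a b c d)
  then show ?case using stern_brocot_pos[OF right.hyps] by auto
qed simp

text \<open>With cleared denominators the endpoint 1/0 becomes the vacuous condition
  \<open>0 * x \<le> c\<close>, so bounded and unbounded intervals are treated alike.\<close>

lemma sb_interval_eq:
  assumes "0 < b" "0 < c"
  shows "sb_interval a b c d = {x. real a \<le> real b * x \<and> real d * x \<le> real c}"
proof -
  have "ereal (real a) / ereal (real b) \<le> ereal x \<longleftrightarrow> real a \<le> real b * x" for x
    using assms by (simp add: field_simps)
  moreover have "ereal x \<le> ereal (real c) / ereal (real d) \<longleftrightarrow> real d * x \<le> real c" for x
    using assms by (cases "d = 0") (auto simp: field_simps)
  ultimately show ?thesis unfolding sb_interval_def by simp
qed

lemma sb_interval_root: "sb_interval 0 1 1 0 = {0..}"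
  by (subst sb_interval_eq) auto

lemma stern_brocot_0: "stern_brocot 0 a b c d \<Longrightarrow> a = 0 \<and> b = 1 \<and> c = 1 \<and> d = 0"
  by (erule stern_brocot.cases) auto

text \<open>Every interval of positive rank is the image of an interval of one rank less under
  \<open>x \<mapsto> 1 + 1/x\<close> or \<open>x \<mapsto> 1/(1 + x)\<close>; both maps reverse orientation, which is why
  the two proportions of \<open>is_nu\<close> swap with the parity of the rank.\<close>

lemma stern_brocot_Suc_iff: "stern_brocot (Suc r) A B C D \<longleftrightarrow>
  (\<exists>c d. stern_brocot r A B c d \<and> C = A + c \<and> D = B + d) \<or>
  (\<exists>a b. stern_brocot r a b C D \<and> A = a + C \<and> B = b + D)"
  by (subst stern_brocot.simps) blast

lemma stern_brocot_image:
  "stern_brocot (Suc r) A B C D \<Longrightarrow>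
   \<exists>a b c d. stern_brocot r a b c d \<and>
     (A = c + d \<and> B = c \<and> C = a + b \<and> D = a \<or> A = d \<and> B = c + d \<and> C = b \<and> D = a + b)"
proof (induction r arbitrary: A B C D)
  case 0
  then have "A = 0 \<and> B = 1 \<and> C = 1 \<and> D = 1 \<or> A = 1 \<and> B = 1 \<and> C = 1 \<and> D = 0"
    unfolding stern_brocot_Suc_iff by (auto dest: stern_brocot_0)
  then show ?case
    by (intro exI[of _ 0] exI[of _ 1] conjI stern_brocot.root) auto
next
  case (Suc r)
  from Suc.prems consider c' d' where "stern_brocot (Suc r) A B c' d'" "C = A + c'" "D = B + d'"
    | a' b' where "stern_brocot (Suc r) a' b' C D" "A = a' + C" "B = b' + D"
    by (subst (asm) stern_brocot_Suc_iff) blast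
  then show ?case
  proof cases
    case 1
    \<comment> \<open>The maps reverse orientation, so a left child is the image of a right child of
      the preimage, and conversely in the second case.\<close>
    from Suc.IH[OF 1(1)] obtain a b c d where r: "stern_brocot r a b c d"
      and e: "A = c + d \<and> B = c \<and> c' = a + b \<and> d' = a \<or> A = d \<and> B = c + d \<and> c' = b \<and> d' = a + b" by blast
    from e show ?thesis
    proof
      assume "A = c + d \<and> B = c \<and> c' = a + b \<and> d' = a"
      then show ?thesis using 1 stern_brocot.right[OF r]
        by (intro exI[of _ "a + c"] exI[of _ "b + d"] exI[of _ c] exI[of _ d]) auto
    next
      assume "A = d \<and> B = c + d \<and> c' = b \<and> d' = a + b"
      then show ?thesis using 1 stern_brocot.right[OF r]
        by (intro exI[of _ "a + c"] exI[of _ "b + d"] exI[of _ c] exI[of _ d]) auto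
    qed
  next
    case 2
    from Suc.IH[OF 2(1)] obtain a b c d where r: "stern_brocot r a b c d"
      and e: "a' = c + d \<and> b' = c \<and> C = a + b \<and> D = a \<or> a' = d \<and> b' = c + d \<and> C = b \<and> D = a + b" by blast
    from e show ?thesis
    proof
      assume "a' = c + d \<and> b' = c \<and> C = a + b \<and> D = a"
      then show ?thesis using 2 stern_brocot.left[OF r]
        by (intro exI[of _ a] exI[of _ b] exI[of _ "a + c"] exI[of _ "b + d"]) auto
    next
      assume "a' = d \<and> b' = c + d \<and> C = b \<and> D = a + b"
      then show ?thesis using 2 stern_brocot.left[OF r]
        by (intro exI[of _ a] exI[of _ b] exI[of _ "a + c"] exI[of _ "b + d"]) auto
    qed
  qed
qed

text \<open>As the total mass is 1, the two masses prescribed at rank 1 are the splitting rule for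
  the even rank 0. Inductions can therefore start at the root.\<close>

lemma is_nu_split:
  assumes N: "is_nu \<alpha> N" and sb: "stern_brocot r a b c d"
  shows "measure N (sb_interval a b (a + c) (b + d)) =
           (if odd r then \<alpha> else 1 - \<alpha>) * measure N (sb_interval a b c d)"
    and "measure N (sb_interval (a + c) (b + d) c d) =
           (if odd r then 1 - \<alpha> else \<alpha>) * measure N (sb_interval a b c d)"
proof -
  have "prob_space N" "space N = {0..}"
    using N sets_eq_imp_space_eq[of N "restrict_space borel {0..}"] by (auto simp: is_nu_def space_restrict_space)
  then have root: "measure N (sb_interval 0 1 1 0) = 1"
    by (metis sb_interval_root prob_space.prob_space)
  have "measure N (sb_interval a b (a + c) (b + d)) =
           (if odd r then \<alpha> else 1 - \<alpha>) * measure N (sb_interval a b c d) \<and>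
        measure N (sb_interval (a + c) (b + d) c d) =
           (if odd r then 1 - \<alpha> else \<alpha>) * measure N (sb_interval a b c d)"
  proof (cases r)
    case 0
    with sb stern_brocot_0 have "a = 0" "b = 1" "c = 1" "d = 0" by blast+
    then show ?thesis using N root 0 by (auto simp: is_nu_def)
  next
    case (Suc k)
    then have "1 \<le> r" by simp
    then show ?thesis using N sb unfolding is_nu_def by blast
  qed
  then show "measure N (sb_interval a b (a + c) (b + d)) =
           (if odd r then \<alpha> else 1 - \<alpha>) * measure N (sb_interval a b c d)"
    and "measure N (sb_interval (a + c) (b + d) c d) =
           (if odd r then 1 - \<alpha> else \<alpha>) * measure N (sb_interval a b c d)" by auto
qed

lemma is_nu_sets:
  assumes N: "is_nu \<alpha> N" and A: "A \<in> sets borel"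
  shows "{x \<in> {0..}. x \<in> A} \<in> sets N"
proof -
  have "{x \<in> {0..}. x \<in> A} = A \<inter> {0..}" by auto
  then show ?thesis using N A by (auto simp: is_nu_def sets_restrict_space)
qed

lemma sb_interval_nonneg: "stern_brocot r a b c d \<Longrightarrow> x \<in> sb_interval a b c d \<Longrightarrow> 0 \<le> x"
proof -
  assume "stern_brocot r a b c d" "x \<in> sb_interval a b c d"
  then have "0 < real b" "0 \<le> real b * x"
    using stern_brocot_pos[of r a b c d] by (auto simp: sb_interval_eq)
  then show "0 \<le> x" by (simp add: zero_le_mult_iff)
qed

lemma sb_interval_sets:
  assumes N: "is_nu \<alpha> N" and sb: "stern_brocot r a b c d"
  shows "sb_interval a b c d \<in> sets N"
proof -
  have "sb_interval a b c d = {x \<in> {0..}. x \<in> {x. real a \<le> real b * x \<and> real d * x \<le> real c}}"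
    using sb_interval_nonneg[OF sb] stern_brocot_pos[OF sb] by (auto simp: sb_interval_eq)
  also have "\<dots> \<in> sets N"
    by (rule is_nu_sets[OF N]) measurable
  finally show ?thesis .
qed

lemma sb_interval_children:
  assumes sb: "stern_brocot r a b c d"
  shows "sb_interval a b (a + c) (b + d) \<union> sb_interval (a + c) (b + d) c d = sb_interval a b c d"
    and "sb_interval a b (a + c) (b + d) \<inter> sb_interval (a + c) (b + d) c d =
      {x \<in> {0..}. real (b + d) * x = real (a + c)}"
proof -
  have p: "0 < b" "0 < c" "b * c = a * d + 1" using stern_brocot_pos[OF sb] stern_brocot_det[OF sb] by auto
  have det: "real b * real c = real a * real d + 1" using p(3) by (metis of_nat_1 of_nat_add of_nat_mult)
  have b: "0 < real b" and bd: "0 < real (b + d)" using p by auto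
  have mid_l: "real a \<le> real b * x" if "real (a + c) \<le> real (b + d) * x" for x
  proof -
    have "real a * real (b + d) \<le> real b * real (a + c)" using det by (simp add: algebra_simps)
    also have "\<dots> \<le> real b * (real (b + d) * x)" using that by (intro mult_left_mono) auto
    finally have "real a * real (b + d) \<le> (real b * x) * real (b + d)" by (simp add: mult_ac)
    then show ?thesis using bd by (rule mult_right_le_imp_le)
  qed
  have mid_r: "real d * x \<le> real c" if "real (b + d) * x \<le> real (a + c)" for x
  proof -
    have "real d * (real (b + d) * x) \<le> real d * real (a + c)" using that by (intro mult_left_mono) auto
    also have "\<dots> \<le> real c * real (b + d)" using det by (simp add: algebra_simps)
    finally have "(real d * x) * real (b + d) \<le> real c * real (b + d)" by (simp add: mult_ac)
    then show ?thesis using bd by (rule mult_right_le_imp_le)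
  qed
  have e: "sb_interval a b (a + c) (b + d) = {x. real a \<le> real b * x \<and> real (b + d) * x \<le> real (a + c)}"
    "sb_interval (a + c) (b + d) c d = {x. real (a + c) \<le> real (b + d) * x \<and> real d * x \<le> real c}"
    "sb_interval a b c d = {x. real a \<le> real b * x \<and> real d * x \<le> real c}"
    by (intro sb_interval_eq; use p in simp)+
  show "sb_interval a b (a + c) (b + d) \<union> sb_interval (a + c) (b + d) c d = sb_interval a b c d"
    unfolding e using mid_l mid_r by (auto simp: not_le)
  have "0 \<le> x" if "real (b + d) * x = real (a + c)" for x
    using that bd by (metis of_nat_0_le_iff zero_le_mult_iff not_le)
  then show "sb_interval a b (a + c) (b + d) \<inter> sb_interval (a + c) (b + d) c d =
      {x \<in> {0..}. real (b + d) * x = real (a + c)}"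
    unfolding e using mid_l mid_r by auto
qed

text \<open>The proportions of the two children add up to 1 although the children share the mediant;
  inclusion-exclusion leaves no mass for it.\<close>

lemma is_nu_endpoint_null:
  assumes N: "is_nu \<alpha> N" and sb: "stern_brocot r a b c d"
  shows "measure N {x \<in> {0..}. real (b + d) * x = real (a + c)} = 0"
proof -
  interpret prob_space N using N by (simp add: is_nu_def)
  have l: "stern_brocot (Suc r) a b (a + c) (b + d)" and r: "stern_brocot (Suc r) (a + c) (b + d) c d"
    using sb by (auto intro: stern_brocot.intros)
  have "measure N (sb_interval a b c d) = measure N (sb_interval a b (a + c) (b + d))
      + measure N (sb_interval (a + c) (b + d) c d) - measure N {x \<in> {0..}. real (b + d) * x = real (a + c)}"
    unfolding sb_interval_children(1)[OF sb, symmetric] sb_interval_children(2)[OF sb, symmetric]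
    using sb_interval_sets[OF N l] sb_interval_sets[OF N r]
    by (subst measure_Un3) (auto simp: fmeasurable_eq_sets)
  then show ?thesis using is_nu_split[OF N sb] by (auto split: if_splits simp: algebra_simps)
qed

text \<open>A right endpoint is an earlier mediant or infinity; in the latter case the set is empty,
  since \<open>0 * x = 1\<close> has no solution.\<close>

lemma is_nu_right_endpoint_null:
  assumes N: "is_nu \<alpha> N"
  shows "stern_brocot r a b c d \<Longrightarrow> measure N {x \<in> {0..}. real d * x = real c} = 0"
proof (induction rule: stern_brocot.induct)
  case (left r a b c d)
  then show ?case using is_nu_endpoint_null[OF N left.hyps] by simp
qed auto

lemma is_nu_interval_cong:
  assumes N: "is_nu \<alpha> N" and N': "is_nu \<alpha> N'"
  shows "stern_brocot r a b c d \<Longrightarrow> measure N (sb_interval a b c d) = measure N' (sb_interval a b c d)"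
proof (induction rule: stern_brocot.induct)
  case root
  have "measure K {0..} = 1" if "is_nu \<alpha> K" for K
    using that sets_eq_imp_space_eq[of K "restrict_space borel {0..}"] prob_space.prob_space[of K]
    by (auto simp: is_nu_def space_restrict_space)
  then show ?case using N N' by (simp add: sb_interval_root[simplified])
next
  case (left r a b c d)
  then show ?case using is_nu_split[OF N left.hyps] is_nu_split[OF N' left.hyps] by metis
next
  case (right r a b c d)
  then show ?case using is_nu_split[OF N right.hyps] is_nu_split[OF N' right.hyps] by metis
qed

text \<open>Interval masses are converted into tails because tails are the values of a distribution
  function. The overlap is one endpoint, which is null.\<close>

lemma is_nu_tail_eq:
  assumes N: "is_nu \<alpha> N" and sb: "stern_brocot r a b c d"
  shows "measure N {x \<in> {0..}. real a \<le> real b * x} =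
    measure N (sb_interval a b c d) + measure N {x \<in> {0..}. real c \<le> real d * x}"
proof -
  interpret prob_space N using N by (simp add: is_nu_def)
  have p: "0 < b" "0 < c" "b * c = a * d + 1" using stern_brocot_pos[OF sb] stern_brocot_det[OF sb] by auto
  have det: "real b * real c = real a * real d + 1" using p(3) by (metis of_nat_1 of_nat_add of_nat_mult)
  let ?T = "\<lambda>a b. {x \<in> {0..}. real a \<le> real b * x}"
  have s: "?T a b \<in> sets N" for a b
    using is_nu_sets[OF N, of "{x. real a \<le> real b * x}"] by auto
  have *: "real a \<le> real b * x" if x: "0 \<le> x" and "real c \<le> real d * x" for x
  proof (cases "d = 0")
    case True with that p show ?thesis by simp
  next
    case False
    have "real d * real a \<le> real b * real c" using det by (simp add: mult_ac)
    also have "\<dots> \<le> real b * (real d * x)" using that by (intro mult_left_mono) auto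
    finally have "real d * real a \<le> real d * (real b * x)" by (simp add: mult_ac)
    then show ?thesis using False by (simp)
  qed
  have un: "?T a b = sb_interval a b c d \<union> ?T c d"
    using sb_interval_nonneg[OF sb] * p by (auto simp: sb_interval_eq)
  have int: "sb_interval a b c d \<inter> ?T c d = {x \<in> {0..}. real d * x = real c}"
    using sb_interval_nonneg[OF sb] * p by (auto simp: sb_interval_eq)
  have "measure N (?T a b) = measure N (sb_interval a b c d) + measure N (?T c d)
      - measure N {x \<in> {0..}. real d * x = real c}"
    unfolding un int[symmetric] using sb_interval_sets[OF N sb] s
    by (subst measure_Un3) (auto simp: fmeasurable_eq_sets)
  then show ?thesis using is_nu_right_endpoint_null[OF N sb] by simp
qed

lemma is_nu_tail_cong:
  assumes N: "is_nu \<alpha> N" and N': "is_nu \<alpha> N'"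
  shows "stern_brocot r a b c d \<Longrightarrow>
     measure N {x \<in> {0..}. real a \<le> real b * x} = measure N' {x \<in> {0..}. real a \<le> real b * x} \<and>
     measure N {x \<in> {0..}. real c \<le> real d * x} = measure N' {x \<in> {0..}. real c \<le> real d * x}"
proof (induction rule: stern_brocot.induct)
  case root
  have "{x::real. 0 \<le> x} = {0..}" by auto
  moreover have "measure K {0..} = 1" if "is_nu \<alpha> K" for K
    using that sets_eq_imp_space_eq[of K "restrict_space borel {0..}"] prob_space.prob_space[of K]
    by (auto simp: is_nu_def space_restrict_space)
  ultimately show ?case using N N' by (simp add: atLeast_def)
next
  case (left r a b c d)
  \<comment> \<open>Only the tail at the new mediant is unknown; the right child connects it with
    the known tail at \<open>c/d\<close>, whichever child is being treated.\<close>
  have r: "stern_brocot (Suc r) (a + c) (b + d) c d" by (rule stern_brocot.right[OF left.hyps])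
  show ?case using left.IH is_nu_tail_eq[OF N r] is_nu_tail_eq[OF N' r] is_nu_interval_cong[OF N N' r]
    by simp
next
  case (right r a b c d)
  have r: "stern_brocot (Suc r) (a + c) (b + d) c d" by (rule stern_brocot.right[OF right.hyps])
  show ?case using right.IH is_nu_tail_eq[OF N r] is_nu_tail_eq[OF N' r] is_nu_interval_cong[OF N N' r]
    by simp
qed

text \<open>Otherwise every rank has an interval containing both \<open>x\<close> and
  \<open>y\<close>. The determinant relation bounds \<open>b * d\<close> by
  \<open>1 / (y - x)\<close>, hence all four integers, while their sum grows with the rank.\<close>

lemma stern_brocot_dense:
  assumes "0 \<le> x" "x < (y::real)"
  shows "\<exists>r a b c d. stern_brocot r a b c d \<and> real b * x < real a \<and> real a < real b * y"
proof (rule ccontr)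
  assume "\<not> ?thesis"
  then have none: "\<not> (real b * x < real a \<and> real a < real b * y)" if "stern_brocot r a b c d" for r a b c d
    using that by blast
  \<comment> \<open>The mediant is the left endpoint of the right child, so by assumption it does
    not separate \<open>x\<close> from \<open>y\<close> and one of the children still contains
    both.\<close>
  have ex: "\<exists>a b c d. stern_brocot r a b c d \<and> real a \<le> real b * x \<and> real d * y \<le> real c" for r
  proof (induction r)
    case 0
    show ?case using assms stern_brocot.root
      by (intro exI[of _ 0] exI[of _ 1] exI[of _ 1] exI[of _ 0]) simp
  next
    case (Suc r)
    then obtain a b c d where *: "stern_brocot r a b c d" "real a \<le> real b * x" "real d * y \<le> real c" by blast
    show ?case
    proof (cases "real (a + c) \<le> real (b + d) * x")
      case True then show ?thesis using * stern_brocot.right[OF *(1)] by blast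
    next
      case False
      then have "real (b + d) * y \<le> real (a + c)" using none[OF stern_brocot.right[OF *(1)]] by auto
      then show ?thesis using * stern_brocot.left[OF *(1)] by blast
    qed
  qed
  \<comment> \<open>The rank is taken beyond the bounds on the sum of the four integers that both
    cases below yield.\<close>
  obtain r :: nat where r: "real r > (x + 3) * (1 / (y - x) + 2)" using reals_Archimedean2 by blast
  obtain a b c d where sb: "stern_brocot r a b c d" and ab: "real a \<le> real b * x" and cd: "real d * y \<le> real c"
    using ex by blast
  have p: "0 < b" "0 < c" "b * c = a * d + 1" "r + 2 \<le> a + b + c + d"
    using stern_brocot_pos[OF sb] stern_brocot_det[OF sb] stern_brocot_sum_ge[OF sb] by auto
  have yx: "1 / (y - x) > 0" using assms by simp
  show False
  proof (cases "d = 0")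
    case True
    then have "b = 1" "c = 1" using p by (auto simp: )
    then have "real r \<le> x" using True p(4) ab by simp
    also have "x \<le> (x + 3) * 1" by simp
    also have "\<dots> \<le> (x + 3) * (1 / (y - x) + 2)" using yx assms by (intro mult_left_mono) auto
    finally show False using r by simp
  next
    case False
    then have d: "1 \<le> real d" and b: "1 \<le> real b" using p by auto
    have det: "real b * real c = real a * real d + 1" using p(3) by (metis of_nat_1 of_nat_add of_nat_mult)
    have "real b * (real d * y) \<le> real b * real c" using cd by (intro mult_left_mono) auto
    moreover have "real d * real a \<le> real d * (real b * x)" using ab by (intro mult_left_mono) auto
    ultimately have bd: "real b * real d * (y - x) \<le> 1" using det by (simp add: algebra_simps)
    have "0 \<le> (real b - 1) * (real d - 1)" using b d by simp
    then have "real b + real d - 1 \<le> real b * real d" by (simp add: algebra_simps)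
    also have "\<dots> \<le> 1 / (y - x)" using bd assms by (simp add: field_simps)
    finally have s: "real b + real d \<le> 1 / (y - x) + 1" by simp
    have "real b * real c \<le> real b * (real d * x + 1)"
    proof -
      have "real a * real d \<le> real b * x * real d" using ab by (intro mult_right_mono) auto
      then show ?thesis using det b by (simp add: algebra_simps)
    qed
    then have c: "real c \<le> real d * x + 1" using b by (subst (asm) mult_le_cancel_left_pos) auto
    have "real r \<le> real a + real b + real c + real d" using p(4) by linarith
    also have "\<dots> \<le> (x + 1) * (real b + real d) + 1" using ab c by (simp add: algebra_simps)
    also have "\<dots> \<le> (x + 1) * (1 / (y - x) + 1) + 1"
      using s assms by (intro add_right_mono mult_left_mono) simp_all
    also have "\<dots> \<le> (x + 3) * (1 / (y - x) + 2)"
    proof -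
      have "(x + 1) * (t + 1) + 1 \<le> (x + 3) * (t + 2)" if "0 < t" for t
        using that assms by (simp add: algebra_simps)
      then show ?thesis using yx by blast
    qed
    finally show False using r by simp
  qed
qed

text \<open>The known tails are closed half-lines \<open>{x..}\<close>. Reflection
  \<open>x \<mapsto> - x\<close> turns them into values of a distribution function; two of these
  that agree on a dense set agree everywhere by right continuity.\<close>

lemma is_nu_unique:
  assumes N: "is_nu \<alpha> N" and N': "is_nu \<alpha> N'"
  shows "N = N'"
proof -
  define K where "K P = distr P borel (\<lambda>x::real. - x)" for P
  have props: "prob_space P" "sets P = sets (restrict_space borel {0..})" "space P = {0..}"
    "(\<lambda>x. - x) \<in> P \<rightarrow>\<^sub>M borel" "real_distribution (K P)" if "is_nu \<alpha> P" for P
  proof -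
    show 1: "prob_space P" and 2: "sets P = sets (restrict_space borel {0..})" using that by (auto simp: is_nu_def)
    show "space P = {0..}" using sets_eq_imp_space_eq[OF 2] by (simp add: space_restrict_space)
    have "(\<lambda>x::real. - x) \<in> restrict_space borel {0..} \<rightarrow>\<^sub>M borel" by (intro measurable_restrict_space1) simp
    then show 3: "(\<lambda>x. - x) \<in> P \<rightarrow>\<^sub>M borel" using 2 measurable_cong_sets by blast
    show "real_distribution (K P)" unfolding real_distribution_def real_distribution_axioms_def K_def
      using prob_space.prob_space_distr[OF 1 3] by simp
  qed
  note p = props[OF N] and p' = props[OF N']
  interpret R: real_distribution "K N" by (rule p(5))
  interpret R': real_distribution "K N'" by (rule p'(5))
  have cdfK: "cdf (K P) (- x) = measure P {z \<in> {0..}. x \<le> z}" if "is_nu \<alpha> P" for P x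
    unfolding cdf_def K_def using props[OF that]
    by (subst measure_distr) (auto intro!: arg_cong[where f="measure P"])
  have "cdf (K N) t = cdf (K N') t" for t
  proof (cases "t \<ge> 0")
    case True
    then have "{z \<in> {0..}. - t \<le> z} = {0..}" by auto
    then show ?thesis using cdfK[OF N, of "- t"] cdfK[OF N', of "- t"]
      prob_space.prob_space[OF p(1)] prob_space.prob_space[OF p'(1)] p(3) p'(3) by simp
  next
    case False
    show ?thesis
    proof (rule ccontr)
      let ?D = "\<lambda>t. cdf (K N) t - cdf (K N') t"
      assume "cdf (K N) t \<noteq> cdf (K N') t"
      then have "?D t \<noteq> 0" by simp
      moreover have "(?D \<longlongrightarrow> ?D t) (at_right t)"
        using R.cdf_is_right_cont[of t] R'.cdf_is_right_cont[of t]
        by (auto simp: continuous_within intro!: tendsto_diff)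
      ultimately have "\<forall>\<^sub>F s in at_right t. ?D s \<noteq> 0" by (rule tendsto_imp_eventually_ne[rotated])
      then obtain u where u: "t < u" "\<And>s. t < s \<Longrightarrow> s < u \<Longrightarrow> ?D s \<noteq> 0"
        by (auto simp: eventually_at_right_field)
      \<comment> \<open>Density is available on the nonnegative half-line only, hence the truncation
        at 0.\<close>
      have "0 \<le> max 0 (- u)" "max 0 (- u) < - t" using u False by auto
      then obtain r a b c d where sb: "stern_brocot r a b c d"
        and ab: "real b * max 0 (- u) < real a" "real a < real b * (- t)" using stern_brocot_dense by blast
      have b: "real b > 0" using stern_brocot_pos[OF sb] by simp
      let ?s = "- (real a / real b)"
      have "t < ?s" using ab(2) b by (simp add: field_simps)
      moreover have "?s < u"
      proof -
        have "real b * (- u) \<le> real b * max 0 (- u)" using b by (intro mult_left_mono) auto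
        then have "real b * (- u) < real a" using ab(1) by linarith
        then show ?thesis using b by (simp add: field_simps)
      qed
      ultimately have "?D ?s \<noteq> 0" by (rule u(2))
      moreover have "{z \<in> {0..}. real a / real b \<le> z} = {z \<in> {0..}. real a \<le> real b * z}"
        using b by (auto simp: field_simps)
      ultimately show False using cdfK[OF N, of "real a / real b"] cdfK[OF N', of "real a / real b"]
        is_nu_tail_cong[OF N N' sb] by simp
    qed
  qed
  then have eq: "K N = K N'" by (intro cdf_unique p(5) p'(5)) auto
  show ?thesis
  proof (rule measure_eqI)
    show "sets N = sets N'" using p(2) p'(2) by simp
    fix A assume A: "A \<in> sets N"
    then have Ab: "A \<in> sets borel" "A \<subseteq> {0..}" using p(2) by (auto simp: sets_restrict_space_iff)
    let ?B = "(\<lambda>x. - x) -` A"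
    have B: "?B \<in> sets borel" using measurable_sets[OF _ Ab(1), of uminus borel] by simp
    have "emeasure (K P) ?B = emeasure P A" if "is_nu \<alpha> P" for P
      unfolding K_def using props[OF that] B Ab
      by (subst emeasure_distr) (auto intro!: arg_cong[where f="emeasure P"])
    then show "emeasure N A = emeasure N' A" using N N' eq by metis
  qed
qed

section \<open>Identification of the Stern-Brocot measure\<close>

locale stationary_log = prob_space \<mu> for \<mu> :: "real measure" +
  fixes \<alpha> :: real
  assumes \<alpha>: "0 \<le> \<alpha>" "\<alpha> \<le> 1"
    and sets_eq [measurable_cong, simp]: "sets \<mu> = sets borel"
    and integrable_id: "integrable \<mu> (\<lambda>y. y)"
    and nn_stationary: "\<And>f. f \<in> borel_measurable borel \<Longrightarrow>
      (\<integral>\<^sup>+y. f y \<partial>\<mu>) = ennreal \<alpha> * (\<integral>\<^sup>+y. f (log_step True y) \<partial>\<mu>) + ennreal (1 - \<alpha>) * (\<integral>\<^sup>+y. f (log_step False y) \<partial>\<mu>)"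
begin

lemma space_eq [simp]: "space \<mu> = UNIV"
  using sets_eq_imp_space_eq[OF sets_eq] by simp

lemma measure_stationary:
  assumes [measurable]: "A \<in> sets borel"
  shows "measure \<mu> A = \<alpha> * measure \<mu> {y. log_step True y \<in> A} + (1 - \<alpha>) * measure \<mu> {y. log_step False y \<in> A}"
proof -
  have "(\<integral>\<^sup>+y. indicator A (log_step b y) \<partial>\<mu>) = emeasure \<mu> {y. log_step b y \<in> A}" for b
  proof -
    have "(\<lambda>y. indicator A (log_step b y) :: ennreal) = indicator {y. log_step b y \<in> A}"
      by (auto simp: fun_eq_iff split: split_indicator)
    then show ?thesis by simp
  qed
  then have "emeasure \<mu> A = ennreal \<alpha> * emeasure \<mu> {y. log_step True y \<in> A} + ennreal (1 - \<alpha>) * emeasure \<mu> {y. log_step False y \<in> A}"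
    using nn_stationary[of "indicator A"] by simp
  then show ?thesis
    using \<alpha> by (simp add: emeasure_eq_measure ennreal_mult[symmetric] ennreal_plus[symmetric] measure_nonneg del: ennreal_plus)
qed

lemma integral_stationary:
  fixes f :: "real \<Rightarrow> real"
  assumes [measurable]: "f \<in> borel_measurable borel"
    and f: "integrable \<mu> f" "\<And>b. integrable \<mu> (\<lambda>y. f (log_step b y))"
  shows "(\<integral>y. f y \<partial>\<mu>) = \<alpha> * (\<integral>y. f (log_step True y) \<partial>\<mu>) + (1 - \<alpha>) * (\<integral>y. f (log_step False y) \<partial>\<mu>)"
proof -
  let ?n = "\<lambda>g. enn2real (\<integral>\<^sup>+y. ennreal (g y) \<partial>\<mu>)"
  have split: "?n g = \<alpha> * ?n (\<lambda>y. g (log_step True y)) + (1 - \<alpha>) * ?n (\<lambda>y. g (log_step False y))"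
    if [measurable]: "g \<in> borel_measurable borel" and g: "\<And>b. integrable \<mu> (\<lambda>y. g (log_step b y))" for g :: "real \<Rightarrow> real"
  proof -
    have "(\<integral>\<^sup>+y. ennreal (g (log_step b y)) \<partial>\<mu>) < top" for b
      using g[of b] by (auto simp: real_integrable_def less_top)
    then show ?thesis using \<alpha>
      by (subst nn_stationary) (auto simp: enn2real_plus ennreal_mult_less_top enn2real_mult)
  qed
  have "(\<integral>y. f y \<partial>\<mu>) = ?n f - ?n (\<lambda>y. - f y)"
    by (rule real_lebesgue_integral_def) (rule f)
  also have "\<dots> = \<alpha> * (?n (\<lambda>y. f (log_step True y)) - ?n (\<lambda>y. - f (log_step True y)))
      + (1 - \<alpha>) * (?n (\<lambda>y. f (log_step False y)) - ?n (\<lambda>y. - f (log_step False y)))"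
    using f by (subst split, simp, simp, subst split) (simp_all add: algebra_simps)
  also have "\<dots> = \<alpha> * (\<integral>y. f (log_step True y) \<partial>\<mu>) + (1 - \<alpha>) * (\<integral>y. f (log_step False y) \<partial>\<mu>)"
    using f(2) by (simp add: real_lebesgue_integral_def)
  finally show ?thesis .
qed

lemma exp_log_step: "exp (log_step True y) = 1 + exp (- y)" "exp (log_step False y) = 1 / (1 + exp y)"
  by (simp_all add: log_step_def exp_minus add_pos_pos inverse_eq_divide)

definition mass :: "nat \<Rightarrow> nat \<Rightarrow> nat \<Rightarrow> nat \<Rightarrow> real" where
  "mass a b c d = measure \<mu> {y. real a \<le> real b * exp y \<and> real d * exp y \<le> real c}"

text \<open>The branch \<open>1 + 1/x\<close> takes values above 1 and \<open>1/(1 + x)\<close>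
  values below 1, so in the stationarity equation only one branch can hit the image
  interval.\<close>

lemma mass_image:
  assumes "0 < b" "0 < c"
  shows "mass (c + d) c (a + b) a = \<alpha> * mass a b c d" "mass d (c + d) b (a + b) = (1 - \<alpha>) * mass a b c d"
proof -
  have T: "real (c + d) \<le> real c * (1 + exp (- y)) \<longleftrightarrow> real d * exp y \<le> real c"
    "real a * (1 + exp (- y)) \<le> real (a + b) \<longleftrightarrow> real a \<le> real b * exp y"
    "\<not> real (a + b) * (1 + exp (- y)) \<le> real b"  for y
  proof -
    have e: "exp (- y) = 1 / exp y" "0 < exp y" by (simp_all add: exp_minus inverse_eq_divide)
    show "real (c + d) \<le> real c * (1 + exp (- y)) \<longleftrightarrow> real d * exp y \<le> real c"
      "real a * (1 + exp (- y)) \<le> real (a + b) \<longleftrightarrow> real a \<le> real b * exp y"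
      unfolding e(1) using e(2) by (auto simp: field_simps)
    have "real b * 1 < real (a + b) * (1 + exp (- y))"
      using assms by (intro mult_le_less_imp_less) auto
    then show "\<not> real (a + b) * (1 + exp (- y)) \<le> real b" by simp
  qed
  have F: "real d \<le> real (c + d) * (1 / (1 + exp y)) \<longleftrightarrow> real d * exp y \<le> real c"
    "real (a + b) * (1 / (1 + exp y)) \<le> real b \<longleftrightarrow> real a \<le> real b * exp y"
    "\<not> real (c + d) \<le> real c * (1 / (1 + exp y))" for y
  proof -
    have e: "0 < 1 + exp y" by (simp add: add_pos_pos)
    then show "real d \<le> real (c + d) * (1 / (1 + exp y)) \<longleftrightarrow> real d * exp y \<le> real c"
      "real (a + b) * (1 / (1 + exp y)) \<le> real b \<longleftrightarrow> real a \<le> real b * exp y"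
      by (auto simp: field_simps)
    have "real c * (1 / (1 + exp y)) < real c * 1" using assms
      by (intro mult_strict_left_mono) (auto simp: add_pos_pos)
    then show "\<not> real (c + d) \<le> real c * (1 / (1 + exp y))" by simp
  qed
  show "mass (c + d) c (a + b) a = \<alpha> * mass a b c d"
    unfolding mass_def by (subst measure_stationary) (simp_all only: mem_Collect_eq exp_log_step T F, auto simp: conj_commute)
  show "mass d (c + d) b (a + b) = (1 - \<alpha>) * mass a b c d"
    unfolding mass_def by (subst measure_stationary) (simp_all only: mem_Collect_eq exp_log_step T F, auto simp: conj_commute)
qed

lemma mass_root: "mass 0 1 1 0 = 1"
  using prob_space by (simp add: mass_def)

text \<open>Raising the rank by one flips its parity, and taking images exchanges left and right
  children. The two flips cancel, so the rule for an interval passes to its images.\<close>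

lemma mass_split:
  "stern_brocot r a b c d \<Longrightarrow>
    mass a b (a + c) (b + d) = (if odd r then \<alpha> else 1 - \<alpha>) * mass a b c d \<and>
    mass (a + c) (b + d) c d = (if odd r then 1 - \<alpha> else \<alpha>) * mass a b c d"
proof (induction r arbitrary: a b c d)
  case 0
  then have "a = 0 \<and> b = 1 \<and> c = 1 \<and> d = 0" by (rule stern_brocot_0)
  then show ?case using mass_image[of 1 1 0 0] mass_root by simp
next
  case (Suc r)
  obtain a' b' c' d' where sb: "stern_brocot r a' b' c' d'" and
    e: "a = c' + d' \<and> b = c' \<and> c = a' + b' \<and> d = a' \<or> a = d' \<and> b = c' + d' \<and> c = b' \<and> d = a' + b'"
    using stern_brocot_image[OF Suc.prems] by blast
  have p: "0 < b'" "0 < c'" using stern_brocot_pos[OF sb] by auto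
  \<comment> \<open>The instances belong to the preimage interval, its right child and its left
    child, in this order.\<close>
  note im = mass_image[of b' c' d' a'] mass_image[of "b' + d'" c' d' "a' + c'"] mass_image[of b' "a' + c'" "b' + d'" a']
  from e Suc.IH[OF sb] p im show ?case by (auto simp: ac_simps)
qed

lemma is_nu_distr: "is_nu \<alpha> (distr \<mu> (restrict_space borel {0..}) exp)"
proof -
  let ?N = "distr \<mu> (restrict_space borel {0..}) (exp :: real \<Rightarrow> real)"
  have m: "(exp :: real \<Rightarrow> real) \<in> \<mu> \<rightarrow>\<^sub>M restrict_space borel {0..}"
    by (intro measurable_restrict_space2) auto
  have mass: "measure ?N (sb_interval a b c d) = mass a b c d" if sb: "stern_brocot r a b c d" for r a b c d
  proof -
    have i: "sb_interval a b c d = {x. real a \<le> real b * x \<and> real d * x \<le> real c}"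
      using stern_brocot_pos[OF sb] by (simp add: sb_interval_eq)
    have "sb_interval a b c d \<subseteq> {0..}" using sb_interval_nonneg[OF sb] by auto
    moreover have "sb_interval a b c d \<in> sets borel" unfolding i by measurable
    ultimately have "sb_interval a b c d \<in> sets (restrict_space borel {0..})"
      by (simp add: sets_restrict_space_iff)
    then show ?thesis unfolding mass_def
      by (subst measure_distr[OF m]) (auto simp: i intro!: arg_cong[where f="measure \<mu>"])
  qed
  show ?thesis unfolding is_nu_def
  proof (intro conjI allI impI)
    show "prob_space ?N" by (rule prob_space_distr[OF m])
    show "sets ?N = sets (restrict_space borel {0..})" by simp
    have "stern_brocot 1 0 1 1 1" "stern_brocot 1 1 1 1 0"
      using stern_brocot.left[OF stern_brocot.root] stern_brocot.right[OF stern_brocot.root] by simp_all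
    then show "measure ?N (sb_interval 0 1 1 1) = 1 - \<alpha>" "measure ?N (sb_interval 1 1 1 0) = \<alpha>"
      using mass mass_split[OF stern_brocot.root] mass_root by auto
  next
    fix r a b c d assume "stern_brocot r a b c d \<and> 1 \<le> r"
    then have sb: "stern_brocot r a b c d" by simp
    show "measure ?N (sb_interval a b (a + c) (b + d)) =
          (if odd r then \<alpha> else 1 - \<alpha>) * measure ?N (sb_interval a b c d)"
      "measure ?N (sb_interval (a + c) (b + d) c d) =
          (if odd r then 1 - \<alpha> else \<alpha>) * measure ?N (sb_interval a b c d)"
      using mass_split[OF sb] mass[OF sb] mass[OF stern_brocot.left[OF sb]] mass[OF stern_brocot.right[OF sb]] by auto
  qed
qed

lemma nu_eq_distr: "nu \<alpha> = distr \<mu> (restrict_space borel {0..}) exp"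
  unfolding nu_def using is_nu_distr is_nu_unique by blast

definition mean :: real where "mean = (\<integral>y. y \<partial>\<mu>)"

lemma nu_ln: "integrable (nu \<alpha>) ln" "(\<integral>x. ln x \<partial>nu \<alpha>) = mean"
proof -
  have m: "(exp :: real \<Rightarrow> real) \<in> \<mu> \<rightarrow>\<^sub>M restrict_space borel {0..}"
    by (intro measurable_restrict_space2) auto
  have l: "(ln :: real \<Rightarrow> real) \<in> borel_measurable (restrict_space borel {0..})"
    by (intro measurable_restrict_space1) simp
  show "integrable (nu \<alpha>) ln" "(\<integral>x. ln x \<partial>nu \<alpha>) = mean"
    unfolding nu_eq_distr mean_def using integrable_id
    by (simp_all add: integrable_distr_eq[OF m l] integral_distr[OF m l])
qed

section \<open>Mean logarithms of linear forms: the function \<open>H\<close> of the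
  overview\<close>

definition log_form :: "real \<Rightarrow> real \<Rightarrow> real" where
  "log_form a b = (\<integral>y. ln (a + b * exp y) \<partial>\<mu>)"

lemma affine_exp_pos:
  fixes a b y :: real
  assumes "0 \<le> a" "0 \<le> b" "0 < max a b"
  shows "0 < a + b * exp y"
proof (cases "0 < a")
  case True
  then show ?thesis using assms by (simp add: add_pos_nonneg)
next
  case False
  then have "0 < b" using assms by auto
  then show ?thesis using assms by (simp add: add_nonneg_pos)
qed

text \<open>The form lies between \<open>max a b * exp (- \<bar>y\<bar>)\<close> and
  \<open>2 * max a b * exp \<bar>y\<bar>\<close>.\<close>

lemma log_affine_bound:
  fixes a b y :: real
  assumes "0 \<le> a" "0 \<le> b" "0 < max a b"
  shows "\<bar>ln (a + b * exp y) - ln (max a b)\<bar> \<le> ln 2 + \<bar>y\<bar>"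
proof -
  define m where "m = max a b"
  have m: "0 < m" "a \<le> m" "b \<le> m" using assms by (auto simp: m_def)
  have "a + b * exp y \<le> m * exp \<bar>y\<bar> + m * exp \<bar>y\<bar>"
  proof (rule add_mono)
    have "m * 1 \<le> m * exp \<bar>y\<bar>" using m by (intro mult_left_mono) auto
    then show "a \<le> m * exp \<bar>y\<bar>" using m by linarith
    show "b * exp y \<le> m * exp \<bar>y\<bar>" using m assms by (intro mult_mono) auto
  qed
  then have up: "a + b * exp y \<le> m * (2 * exp \<bar>y\<bar>)" by simp
  have lo: "m * exp (- \<bar>y\<bar>) \<le> a + b * exp y"
  proof (cases "a \<le> b")
    case True
    then have "m * exp (- \<bar>y\<bar>) \<le> b * exp y" using assms unfolding m_def by (intro mult_mono) auto
    then show ?thesis using assms by linarith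
  next
    case False
    then have "m * exp (- \<bar>y\<bar>) \<le> a * 1" using assms unfolding m_def by (intro mult_mono) auto
    moreover have "0 \<le> b * exp y" using assms by simp
    ultimately show ?thesis by linarith
  qed
  have pos: "0 < m * exp (- \<bar>y\<bar>)" using m by simp
  have "ln (a + b * exp y) \<le> ln (m * (2 * exp \<bar>y\<bar>))" using up lo pos by (subst ln_le_cancel_iff) auto
  also have "\<dots> = ln m + ln 2 + \<bar>y\<bar>" using m by (simp add: ln_mult)
  finally have 1: "ln (a + b * exp y) \<le> ln m + ln 2 + \<bar>y\<bar>" .
  have "ln m - \<bar>y\<bar> = ln (m * exp (- \<bar>y\<bar>))" using m by (simp add: ln_mult)
  also have "\<dots> \<le> ln (a + b * exp y)" using lo pos by (subst ln_le_cancel_iff) auto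
  finally have 2: "ln m - \<bar>y\<bar> \<le> ln (a + b * exp y)" .
  have "0 < ln (2 :: real)" by simp
  with 1 2 show ?thesis unfolding m_def[symmetric] by linarith
qed

lemma integrable_log_affine:
  assumes "0 \<le> a" "0 \<le> b" "0 < max a b"
  shows "integrable \<mu> (\<lambda>y. ln (a + b * exp y))"
proof (rule Bochner_Integration.integrable_bound)
  show "integrable \<mu> (\<lambda>y. \<bar>ln (max a b)\<bar> + (ln 2 + \<bar>y\<bar>))" using integrable_id by auto
  show "AE y in \<mu>. norm (ln (a + b * exp y)) \<le> norm (\<bar>ln (max a b)\<bar> + (ln 2 + \<bar>y\<bar>))"
    using log_affine_bound[OF assms] by (intro AE_I2) (smt (verit) real_norm_def)
qed simp

lemma log_form_bound:
  assumes "0 \<le> a" "0 \<le> b" "0 < max a b"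
  shows "\<bar>log_form a b - ln (max a b)\<bar> \<le> ln 2 + (\<integral>y. \<bar>y\<bar> \<partial>\<mu>)"
proof -
  have i: "integrable \<mu> (\<lambda>y. ln (a + b * exp y) - ln (max a b))"
    using integrable_log_affine[OF assms] by auto
  have "log_form a b - ln (max a b) = (\<integral>y. ln (a + b * exp y) - ln (max a b) \<partial>\<mu>)"
    unfolding log_form_def using integrable_log_affine[OF assms] prob_space by simp
  also have "\<bar>\<dots>\<bar> \<le> (\<integral>y. \<bar>ln (a + b * exp y) - ln (max a b)\<bar> \<partial>\<mu>)" by (rule integral_abs_bound)
  also have "\<dots> \<le> (\<integral>y. ln 2 + \<bar>y\<bar> \<partial>\<mu>)"
    using i integrable_id log_affine_bound[OF assms] by (intro integral_mono) auto
  also have "\<dots> = ln 2 + (\<integral>y. \<bar>y\<bar> \<partial>\<mu>)" using integrable_id prob_space by simp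
  finally show ?thesis .
qed

lemma log_form_1_0: "log_form 1 0 = 0" and log_form_0_1: "log_form 0 1 = mean"
  by (simp_all add: log_form_def mean_def)

lemma log_form_scale:
  assumes "0 \<le> a" "0 \<le> b" "0 < max a b" "0 < k"
  shows "log_form (k * a) (k * b) = ln k + log_form a b"
proof -
  have "ln (k * a + k * b * exp y) = ln k + ln (a + b * exp y)" for y
  proof -
    have "0 < a + b * exp y" using assms by (intro affine_exp_pos)
    then have "ln (k * (a + b * exp y)) = ln k + ln (a + b * exp y)" using assms by (simp add: ln_mult)
    then show ?thesis by (simp add: algebra_simps)
  qed
  then show ?thesis unfolding log_form_def using integrable_log_affine[OF assms(1-3)] prob_space by simp
qed

text \<open>Stationarity is applied to \<open>ln (a + b x)\<close>. Here
  \<open>a + b (1 + 1/x) = (b + (a + b) x) / x\<close> and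
  \<open>a + b / (1 + x) = ((a + b) + a x) / (1 + x)\<close>: the numerators are the forms of
  \<open>R v\<close> and \<open>L (R v)\<close>, and the denominators produce \<open>mean\<close>
  and \<open>log_form 1 1\<close>.\<close>

lemma log_form_split:
  assumes "0 \<le> a" "0 \<le> b" "0 < max a b"
  shows "log_form a b = \<alpha> * (log_form b (a + b) - mean) + (1 - \<alpha>) * (log_form (a + b) a - log_form 1 1)"
proof -
  have T: "ln (a + b * exp (log_step True y)) = ln (b + (a + b) * exp y) - y" for y
  proof -
    have "0 < b + (a + b) * exp y" using assms by (intro affine_exp_pos) auto
    moreover have "a + b * exp (log_step True y) = (b + (a + b) * exp y) / exp y"
      unfolding exp_log_step by (simp add: exp_minus field_simps)
    ultimately show ?thesis by (simp add: ln_div)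
  qed
  have F: "ln (a + b * exp (log_step False y)) = ln ((a + b) + a * exp y) - ln (1 + 1 * exp y)" for y
  proof -
    have p: "0 < 1 + exp y" by (simp add: add_pos_pos)
    have "0 < (a + b) + a * exp y" using assms by (intro affine_exp_pos) auto
    moreover have "a + b * exp (log_step False y) = ((a + b) + a * exp y) / (1 + exp y)"
      unfolding exp_log_step using p by (simp add: field_simps)
    ultimately show ?thesis using p by (simp add: ln_div)
  qed
  have ab: "0 < max b (a + b)" "0 < max (a + b) a" using assms by (auto simp: max_def split: if_splits)
  have i: "integrable \<mu> (\<lambda>y. ln (b + (a + b) * exp y))" "integrable \<mu> (\<lambda>y. ln ((a + b) + a * exp y))"
    "integrable \<mu> (\<lambda>y. ln (1 + 1 * exp y))"
    using assms ab by (intro integrable_log_affine; simp)+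
  have int: "integrable \<mu> (\<lambda>y. ln (a + b * exp (log_step b' y)))" for b'
    using i integrable_id by (cases b') (simp_all only: T F Bochner_Integration.integrable_diff)
  have "log_form a b = \<alpha> * (\<integral>y. ln (a + b * exp (log_step True y)) \<partial>\<mu>) + (1 - \<alpha>) * (\<integral>y. ln (a + b * exp (log_step False y)) \<partial>\<mu>)"
    unfolding log_form_def by (rule integral_stationary) (use integrable_log_affine[OF assms] int in auto)
  also have "\<dots> = \<alpha> * (log_form b (a + b) - mean) + (1 - \<alpha>) * (log_form (a + b) a - log_form 1 1)"
    unfolding T F log_form_def mean_def using i integrable_id by (simp only: Bochner_Integration.integral_diff)
  finally show ?thesis .
qed

text \<open>At \<open>v = (0, 1)\<close> the split involves only the pairs \<open>(1, 1)\<close> and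
  \<open>(1, 0)\<close>, hence closes up. The sign of \<open>mean\<close> is that of
  \<open>2 * \<alpha> - 1\<close>.\<close>

lemma mean_eq: "(1 + \<alpha>) * mean = (2 * \<alpha> - 1) * log_form 1 1"
  using log_form_split[of 0 1] by (simp add: log_form_1_0 log_form_0_1 algebra_simps)

lemma log_form_1_1_pos: "0 < log_form 1 1"
proof -
  have "integrable \<mu> (\<lambda>y. ln (1 + 1 * exp y))" by (rule integrable_log_affine) auto
  then show ?thesis unfolding log_form_def
    by (intro expectation_greater) (auto intro!: AE_I2 ln_gt_zero)
qed

end

lemma ex_stationary_log_locale:
  assumes "0 \<le> \<alpha>" "\<alpha> \<le> 1"
  obtains \<mu> where "stationary_log \<mu> \<alpha>"
proof -
  from ex_stationary_log[OF assms] obtain \<mu> :: "real measure" where "prob_space \<mu>" "sets \<mu> = sets borel" "integrable \<mu> (\<lambda>y. y)"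
    "\<And>f. f \<in> borel_measurable borel \<Longrightarrow>
      (\<integral>\<^sup>+y. f y \<partial>\<mu>) = ennreal \<alpha> * (\<integral>\<^sup>+y. f (log_step True y) \<partial>\<mu>) + ennreal (1 - \<alpha>) * (\<integral>\<^sup>+y. f (log_step False y) \<partial>\<mu>)"
    by blast
  then show thesis using assms
    by (intro that[of \<mu>] stationary_log.intro stationary_log_axioms.intro)
qed

section \<open>A potential with constant drift\<close>

text \<open>\<open>q\<close> and \<open>r\<close> are the probabilities that the walk ever descends one level when the pair has
  positive, respectively negative, relative sign; \<open>\<kappa>\<close> is the correction for starting with a
  negative sign. The sign after a step down is negative exactly if \<open>b < a\<close>.\<close>

locale log_potential = stationary_log \<mu> \<alpha> for \<mu> :: "real measure" and \<alpha> :: real +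
  fixes q r \<kappa> :: real
  assumes q: "0 \<le> q" "q < 1" and r: "0 \<le> r" "r < 1" and \<alpha>_eq: "\<alpha> = 1 / (1 + q)"
begin

text \<open>The change of \<open>H\<close> under one step \<open>L\<close>, with
  \<open>\<kappa>\<close> added when the pair reached has negative sign.\<close>

definition gain :: "real \<Rightarrow> real \<Rightarrow> real" where
  "gain a b = log_form b \<bar>a - b\<bar> - log_form a b + (if b < a then \<kappa> else 0)"

text \<open>The gain of a level further down, discounted by the chance of getting there: each pair
  passed contributes \<open>r\<close> or \<open>q\<close> according to its sign.\<close>

primrec gain_iter :: "nat \<Rightarrow> real \<Rightarrow> real \<Rightarrow> real" where
  "gain_iter 0 a b = gain a b"
| "gain_iter (Suc k) a b = (if b < a then r else q) * gain_iter k b \<bar>a - b\<bar>"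

definition descent :: "real \<Rightarrow> real \<Rightarrow> real" where
  "descent a b = (\<Sum>k. gain_iter k a b)"

definition form_const :: real where "form_const = ln 2 + (\<integral>y. \<bar>y\<bar> \<partial>\<mu>)"

definition gain_const :: real where "gain_const = 2 * form_const + ln 2 + \<bar>\<kappa>\<bar>"

lemma ln_max_step:
  fixes a b :: real
  assumes "0 \<le> a" "0 \<le> b" "0 < max a b"
  shows "\<bar>ln (max b \<bar>a - b\<bar>) - ln (max a b)\<bar> \<le> ln 2" "0 < max b \<bar>a - b\<bar>"
proof -
  show p: "0 < max b \<bar>a - b\<bar>" using assms by (auto simp: max_def)
  have "ln (max b \<bar>a - b\<bar>) \<le> ln (max a b)" "ln (max a b) \<le> ln (2 * max b \<bar>a - b\<bar>)"
    using p assms by (subst ln_le_cancel_iff; auto simp: max_def)+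
  moreover have "ln (2 * max b \<bar>a - b\<bar>) = ln 2 + ln (max b \<bar>a - b\<bar>)" using p by (simp add: ln_mult)
  ultimately show "\<bar>ln (max b \<bar>a - b\<bar>) - ln (max a b)\<bar> \<le> ln 2" by auto
qed

lemma gain_bound:
  assumes "0 \<le> a" "0 \<le> b" "0 < max a b"
  shows "\<bar>gain a b\<bar> \<le> gain_const"
proof -
  have "\<bar>log_form a b - ln (max a b)\<bar> \<le> form_const"
    "\<bar>log_form b \<bar>a - b\<bar> - ln (max b \<bar>a - b\<bar>)\<bar> \<le> form_const"
    unfolding form_const_def
    by (rule log_form_bound[OF assms]) (rule log_form_bound[OF assms(2) abs_ge_zero ln_max_step(2)[OF assms]])
  moreover have "\<bar>if b < a then \<kappa> else 0\<bar> \<le> \<bar>\<kappa>\<bar>" by auto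
  moreover have "\<bar>x - y + k\<bar> \<le> 2 * c + l + K"
    if "\<bar>y - m\<bar> \<le> c" "\<bar>x - n\<bar> \<le> c" "\<bar>k\<bar> \<le> K" "\<bar>n - m\<bar> \<le> l" for x y k c l K m n :: real
    using that by linarith
  ultimately show ?thesis unfolding gain_def gain_const_def using ln_max_step(1)[OF assms] by blast
qed

lemma gain_iter_bound:
  "0 \<le> a \<Longrightarrow> 0 \<le> b \<Longrightarrow> 0 < max a b \<Longrightarrow> \<bar>gain_iter k a b\<bar> \<le> gain_const * max q r ^ k"
proof (induction k arbitrary: a b)
  case 0
  then show ?case using gain_bound by simp
next
  case (Suc k)
  have IH: "\<bar>gain_iter k b \<bar>a - b\<bar>\<bar> \<le> gain_const * max q r ^ k"
    using Suc.prems ln_max_step(2)[OF Suc.prems] by (intro Suc.IH) auto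
  have "\<bar>gain_iter (Suc k) a b\<bar> = (if b < a then r else q) * \<bar>gain_iter k b \<bar>a - b\<bar>\<bar>"
    using q r by (simp add: abs_mult)
  also have "\<dots> \<le> max q r * (gain_const * max q r ^ k)" using q r IH by (intro mult_mono) auto
  finally show ?case by (simp add: mult_ac)
qed

lemma summable_gain_iter:
  assumes "0 \<le> a" "0 \<le> b" "0 < max a b"
  shows "summable (\<lambda>k. gain_iter k a b)"
proof (rule summable_comparison_test')
  show "summable (\<lambda>k. gain_const * max q r ^ k)" using q r by (intro summable_mult summable_geometric) auto
  show "norm (gain_iter k a b) \<le> gain_const * max q r ^ k" if "0 \<le> k" for k using gain_iter_bound[OF assms] by simp
qed

lemma descent_bound:
  assumes "0 \<le> a" "0 \<le> b" "0 < max a b"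
  shows "\<bar>descent a b\<bar> \<le> gain_const / (1 - max q r)"
proof -
  have s: "(\<lambda>k. gain_const * max q r ^ k) sums (gain_const * (1 / (1 - max q r)))"
    using q r by (intro sums_mult geometric_sums) auto
  have "norm (\<Sum>k. gain_iter k a b) \<le> (\<Sum>k. gain_const * max q r ^ k)"
    using gain_iter_bound[OF assms] sums_summable[OF s] by (intro norm_suminf_le) auto
  then show ?thesis using sums_unique[OF s] by (simp add: descent_def)
qed

lemma descent_rec:
  assumes "0 \<le> a" "0 \<le> b" "0 < max a b"
  shows "descent a b = log_form b \<bar>a - b\<bar> - log_form a b +
    (if b < a then r * descent b \<bar>a - b\<bar> + \<kappa> else q * descent b \<bar>a - b\<bar>)"
proof -
  have s: "summable (\<lambda>k. gain_iter k b \<bar>a - b\<bar>)"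
    using assms ln_max_step(2)[OF assms] by (intro summable_gain_iter) auto
  have "descent a b = gain a b + (\<Sum>k. gain_iter (Suc k) a b)"
    unfolding descent_def using suminf_split_head[OF summable_gain_iter[OF assms]] by simp
  also have "(\<Sum>k. gain_iter (Suc k) a b) = (if b < a then r else q) * descent b \<bar>a - b\<bar>"
    unfolding descent_def gain_iter.simps by (rule suminf_mult[OF s])
  finally show ?thesis by (simp add: gain_def)
qed

text \<open>The average of \<open>H\<close> at the lowest level still to be visited, with the sign
  corrections; \<open>s\<close> is true for a positive relative sign.\<close>

definition potential :: "bool \<Rightarrow> real \<Rightarrow> real \<Rightarrow> real" where
  "potential s a b = log_form a b + (if s then q * descent a b else r * descent a b + \<kappa>)"

definition pot_const :: real where
  "pot_const = form_const + gain_const / (1 - max q r) + \<bar>\<kappa>\<bar>"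

lemma potential_bound:
  assumes "0 \<le> a" "0 \<le> b" "0 < max a b"
  shows "\<bar>potential s a b - ln (max a b)\<bar> \<le> pot_const"
proof -
  have "\<bar>if s then q * descent a b else r * descent a b + \<kappa>\<bar> \<le> \<bar>descent a b\<bar> + \<bar>\<kappa>\<bar>"
  proof -
    have "\<bar>x * descent a b\<bar> \<le> \<bar>descent a b\<bar>" if "0 \<le> x" "x < 1" for x
      using that by (simp add: abs_mult mult_left_le_one_le)
    from this[of q] this[of r] q r show ?thesis by (auto simp del: abs_mult)
  qed
  moreover have "\<bar>x + k - m\<bar> \<le> c + e + K" if "\<bar>k\<bar> \<le> \<bar>d\<bar> + K" "\<bar>d\<bar> \<le> e" "\<bar>x - m\<bar> \<le> c" for x k m c d e K :: real
    using that by linarith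
  ultimately show ?thesis using descent_bound[OF assms] log_form_bound[OF assms]
    unfolding potential_def pot_const_def form_const_def by blast
qed

lemma potential_down:
  assumes "0 \<le> a" "0 \<le> b" "0 < max a b"
  shows "potential (\<not> b < a) b \<bar>a - b\<bar> = log_form a b + descent a b"
  unfolding potential_def using descent_rec[OF assms] by simp

definition up_gain :: real where
  "up_gain = (1 - q\<^sup>2) * (\<alpha> * mean + (1 - \<alpha>) * log_form 1 1) + q\<^sup>2 * \<kappa>"

text \<open>After a step up, \<open>R v\<close> and \<open>L (R v)\<close> have positive sign, and
  \<open>v\<close> is met again with negative sign: the descent factors are \<open>q\<close>,
  \<open>q\<close>, \<open>r\<close>. Collecting terms, \<open>R v\<close> and
  \<open>L (R v)\<close> get weights \<open>1 - q\<close> and \<open>q * (1 - q)\<close>, which are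
  \<open>1 - q\<^sup>2\<close> times \<open>\<alpha>\<close> and \<open>1 - \<alpha>\<close>, so
  \<open>log_form_split\<close> returns \<open>H v\<close> plus a constant. For \<open>b = 0\<close>
  the comparison \<open>a < a + b\<close> fails and the recursion takes the \<open>q\<close> branch;
  \<open>tie\<close> makes both branches agree.\<close>

lemma potential_up:
  assumes "0 \<le> a" "0 \<le> b" "0 < max a b"
    and tie: "b = 0 \<Longrightarrow> q * descent a b = r * descent a b + \<kappa>"
  shows "potential True b (a + b) = log_form a b + q\<^sup>2 * r * descent a b + up_gain"
proof -
  have "0 < max b (a + b)" "0 < max (a + b) a" using assms by auto
  then have 1: "descent b (a + b) = log_form (a + b) a - log_form b (a + b) + q * descent (a + b) a"
    and 2: "descent (a + b) a = log_form a b - log_form (a + b) a + (r * descent a b + \<kappa>)"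
    using descent_rec[of b "a + b"] descent_rec[of "a + b" a] assms by (auto simp: abs_if)
  have \<alpha>q: "(1 - q\<^sup>2) * \<alpha> = 1 - q" "(1 - q\<^sup>2) * (1 - \<alpha>) = q * (1 - q)"
    using q by (auto simp: \<alpha>_eq field_simps power2_eq_square)
  have split: "\<alpha> * log_form b (a + b) + (1 - \<alpha>) * log_form (a + b) a
      = log_form a b + (\<alpha> * mean + (1 - \<alpha>) * log_form 1 1)"
    using log_form_split[OF assms(1-3)] by (simp add: algebra_simps)
  have "potential True b (a + b) = (1 - q) * log_form b (a + b) + (q * (1 - q)) * log_form (a + b) a
      + q\<^sup>2 * (log_form a b + r * descent a b + \<kappa>)"
    unfolding potential_def 1 2 by (simp add: algebra_simps power2_eq_square)
  also have "\<dots> = (1 - q\<^sup>2) * (\<alpha> * log_form b (a + b) + (1 - \<alpha>) * log_form (a + b) a)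
      + q\<^sup>2 * (log_form a b + r * descent a b + \<kappa>)"
  proof -
    have "(1 - q\<^sup>2) * (\<alpha> * x + (1 - \<alpha>) * y) = ((1 - q\<^sup>2) * \<alpha>) * x + ((1 - q\<^sup>2) * (1 - \<alpha>)) * y" for x y
      by (simp add: algebra_simps)
    then show ?thesis by (simp only: \<alpha>q)
  qed
  finally show ?thesis unfolding split up_gain_def by (simp add: algebra_simps)
qed

lemma log_form_1_1_eq: "(1 - q) * log_form 1 1 = (2 + q) * mean"
proof -
  have "(1 + q) * ((1 + \<alpha>) * mean) = (1 + q) * ((2 * \<alpha> - 1) * log_form 1 1)" using mean_eq by simp
  moreover have "(1 + q) * (1 + \<alpha>) = 2 + q" "(1 + q) * (2 * \<alpha> - 1) = 1 - q"
    using q by (auto simp: \<alpha>_eq field_simps)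
  ultimately show ?thesis by (metis mult.assoc)
qed

lemma mean_pos: "0 < mean"
proof -
  have "0 < (1 - q) * log_form 1 1" using q log_form_1_1_pos by simp
  then show ?thesis unfolding log_form_1_1_eq using q by (simp add: zero_less_mult_iff)
qed

lemma up_gain_eq: "up_gain = (1 + q + q\<^sup>2) * mean + q\<^sup>2 * \<kappa>"
proof -
  have "(1 - q\<^sup>2) * \<alpha> = 1 - q" "(1 - q\<^sup>2) * (1 - \<alpha>) = q * (1 - q)"
    using q by (auto simp: \<alpha>_eq field_simps power2_eq_square)
  then have "(1 - q\<^sup>2) * (\<alpha> * mean + (1 - \<alpha>) * log_form 1 1) = (1 - q) * mean + q * ((1 - q) * log_form 1 1)"
    by (metis distrib_left mult.assoc)
  then show ?thesis unfolding up_gain_def log_form_1_1_eq by (simp add: algebra_simps power2_eq_square)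
qed

end

text \<open>No sign is recorded, hence \<open>r = q\<close> and \<open>\<kappa> = 0\<close>. The
  relation between \<open>p\<close> and \<open>q\<close> plays two parts: it makes the drift equal
  to \<open>mean\<close>, and it reproduces the coefficient \<open>q\<close> of the descent.\<close>

lemma ex_potential_nonlinear:
  fixes p q :: real
  assumes q: "0 \<le> q" "q < 1" and p: "p * (1 + q + q\<^sup>2) = 1"
  obtains h :: "real \<Rightarrow> real \<Rightarrow> real" and m C where
    "0 < m" "integrable (nu (1 / (1 + q))) ln" "(\<integral>x. ln x \<partial>nu (1 / (1 + q))) = m"
    "\<And>a b. 0 \<le> a \<Longrightarrow> 0 \<le> b \<Longrightarrow> 0 < max a b \<Longrightarrow> \<bar>h a b - ln (max a b)\<bar> \<le> C"
    "\<And>a b. 0 \<le> a \<Longrightarrow> 0 \<le> b \<Longrightarrow> 0 < max a b \<Longrightarrow> p * h b (a + b) + (1 - p) * h b \<bar>a - b\<bar> = h a b + m"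
proof -
  define \<alpha> where "\<alpha> = 1 / (1 + q)"
  have \<alpha>: "0 \<le> \<alpha>" "\<alpha> \<le> 1" using q by (auto simp: \<alpha>_def)
  obtain \<mu> where "stationary_log \<mu> \<alpha>" using ex_stationary_log_locale[OF \<alpha>] .
  then interpret S: stationary_log \<mu> \<alpha> .
  interpret P: log_potential \<mu> \<alpha> q q 0 by standard (use q in \<open>auto simp: \<alpha>_def\<close>)
  show thesis
  proof (rule that[of S.mean "P.potential True" P.pot_const])
    show "0 < S.mean" by (rule P.mean_pos)
    show "integrable (nu (1 / (1 + q))) ln" "(\<integral>x. ln x \<partial>nu (1 / (1 + q))) = S.mean"
      using S.nu_ln by (auto simp: \<alpha>_def)
  next
    fix a b :: real assume ab: "0 \<le> a" "0 \<le> b" "0 < max a b"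
    show "\<bar>P.potential True a b - ln (max a b)\<bar> \<le> P.pot_const" by (rule P.potential_bound[OF ab])
    let ?E = "P.descent a b" and ?H = "S.log_form a b"
    have s: "P.potential s = P.potential True" for s by (auto simp: P.potential_def fun_eq_iff)
    have up: "P.potential True b (a + b) = ?H + q\<^sup>2 * q * ?E + (1 + q + q\<^sup>2) * S.mean"
      using P.potential_up[OF ab] P.up_gain_eq by simp
    have down: "P.potential True b \<bar>a - b\<bar> = ?H + ?E" using P.potential_down[OF ab] s by metis
    \<comment> \<open>The equation of a first descent: step down at once, or step up and then
      descend three levels.\<close>
    have pq: "p * (q\<^sup>2 * q) + (1 - p) = q"
    proof -
      have "p * (1 + q + q\<^sup>2) * (1 - q) = 1 - q" using p by simp
      then show ?thesis by (simp add: algebra_simps power2_eq_square)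
    qed
    have "p * P.potential True b (a + b) + (1 - p) * P.potential True b \<bar>a - b\<bar>
        = ?H + (p * (q\<^sup>2 * q) + (1 - p)) * ?E + (p * (1 + q + q\<^sup>2)) * S.mean"
      unfolding up down by (simp add: algebra_simps)
    also have "\<dots> = P.potential True a b + S.mean" unfolding pq p by (simp add: P.potential_def)
    finally show "p * P.potential True b (a + b) + (1 - p) * P.potential True b \<bar>a - b\<bar> = P.potential True a b + S.mean" .
  qed
qed

text \<open>From a positive sign \<open>y - x\<close> is the step down and \<open>y + x\<close> the
  step up; from a negative sign the roles are exchanged. The drift must come out the same for both,
  which requires a suitable \<open>\<kappa>\<close>.\<close>

lemma ex_potential_linear:
  fixes p q :: real
  assumes q: "0 < q" "q < 1" and p: "(1 - p) * (1 - q\<^sup>2) = p * q"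
  obtains h :: "real \<Rightarrow> real \<Rightarrow> real" and m C where
    "0 < m" "integrable (nu (1 / (1 + q))) ln" "(\<integral>x. ln x \<partial>nu (1 / (1 + q))) = m"
    "\<And>x y. x \<noteq> 0 \<or> y \<noteq> 0 \<Longrightarrow> \<bar>h x y - ln (max \<bar>x\<bar> \<bar>y\<bar>)\<bar> \<le> C"
    "\<And>x y. x \<noteq> 0 \<or> y \<noteq> 0 \<Longrightarrow> p * h y (y + x) + (1 - p) * h y (y - x) = h x y + m"
proof -
  define \<alpha> where "\<alpha> = 1 / (1 + q)"
  have \<alpha>: "0 \<le> \<alpha>" "\<alpha> \<le> 1" "\<alpha> < 1" "(1 + q) * \<alpha> = 1" using q by (auto simp: \<alpha>_def)
  obtain \<mu> where "stationary_log \<mu> \<alpha>" using ex_stationary_log_locale[OF \<alpha>(1,2)] .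
  then interpret S: stationary_log \<mu> \<alpha> .
  \<comment> \<open>\<open>e\<close> will be the descent of \<open>(a, 0)\<close> and of
    \<open>(0, a)\<close>. A zero entry carries no sign, so both forms of the potential must agree
    there: \<open>q * e = \<alpha> * e + \<kappa>\<close>, which determines
    \<open>\<kappa>\<close>.\<close>
  define e where "e = S.mean / (1 - q)"
  have e: "(1 - q) * e = S.mean" using q by (simp add: e_def)
  define \<kappa> where "\<kappa> = (q - \<alpha>) * e"
  interpret P: log_potential \<mu> \<alpha> q \<alpha> \<kappa> by standard (use q \<alpha> in \<open>auto simp: \<alpha>_def\<close>)
  define E where "E = P.descent"
  define H where "H = S.log_form"
  \<comment> \<open>\<open>L\<close> permutes \<open>(a, 0)\<close>, \<open>(0, a)\<close>,
    \<open>(a, a)\<close> cyclically, so \<open>descent_rec\<close> becomes a linear system for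
    three values.\<close>
  have root: "E a 0 = e" "E 0 a = e" if a: "0 < a" for a
  proof -
    have H: "H a 0 = ln a" "H 0 a = ln a + S.mean" "H a a = ln a + H 1 1"
      using S.log_form_scale[of 1 0 a] S.log_form_scale[of 0 1 a] S.log_form_scale[of 1 1 a] a
      by (auto simp: H_def S.log_form_1_0 S.log_form_0_1)
    have X: "E a 0 = S.mean + \<alpha> * E 0 a + \<kappa>" and Y: "E 0 a = H 1 1 - S.mean + q * E a a"
      and Z: "E a a = - H 1 1 + q * E a 0"
      using P.descent_rec[of a 0] P.descent_rec[of 0 a] P.descent_rec[of a a] a H
      unfolding E_def H_def by auto
    have Y': "E 0 a = (1 + q) * S.mean + q\<^sup>2 * E a 0"
      using P.log_form_1_1_eq unfolding Y Z H_def by (simp add: algebra_simps power2_eq_square)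
    have "E a 0 = S.mean + ((1 + q) * \<alpha>) * S.mean + \<alpha> * q\<^sup>2 * E a 0 + \<kappa>"
      using X Y' by (simp add: algebra_simps)
    then have "(1 - \<alpha> * q\<^sup>2) * E a 0 = 2 * S.mean + \<kappa>" unfolding \<alpha>(4) by (simp add: algebra_simps)
    also have "\<dots> = (2 * (1 - q) + (q - \<alpha>)) * e" unfolding \<kappa>_def e[symmetric] by (simp add: algebra_simps)
    also have "2 * (1 - q) + (q - \<alpha>) = 1 - \<alpha> * q\<^sup>2"
      using q by (simp add: \<alpha>_def field_simps power2_eq_square)
    finally have *: "(1 - \<alpha> * q\<^sup>2) * E a 0 = (1 - \<alpha> * q\<^sup>2) * e" .
    have "\<alpha> * q\<^sup>2 \<le> 1 * q\<^sup>2" using \<alpha> by (intro mult_right_mono) auto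
    moreover have "q * q < 1 * 1" using q by (intro mult_strict_mono) auto
    ultimately have "\<alpha> * q\<^sup>2 < 1" by (simp add: power2_eq_square)
    then have "1 - \<alpha> * q\<^sup>2 \<noteq> 0" by linarith
    then show X': "E a 0 = e" using * by simp
    show "E 0 a = e" unfolding Y' X' e[symmetric] by (simp add: algebra_simps power2_eq_square)
  qed
  define h where "h x y = P.potential (\<not> x * y < 0) \<bar>x\<bar> \<bar>y\<bar>" for x y :: real
  have hroot: "P.potential s a 0 = H a 0 + q * e" "P.potential s 0 a = H 0 a + q * e" if "0 < a" for s a
  proof -
    have "\<alpha> * e + \<kappa> = q * e" by (simp add: \<kappa>_def algebra_simps)
    then show "P.potential s a 0 = H a 0 + q * e" "P.potential s 0 a = H 0 a + q * e"
      using root[OF that] by (simp_all add: P.potential_def E_def H_def)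
  qed
  have U: "P.up_gain = (1 + q + q\<^sup>2) * S.mean + q\<^sup>2 * \<kappa>" by (rule P.up_gain_eq)
  have p': "p * (1 + q - q\<^sup>2) = 1 - q\<^sup>2" using p by (simp add: algebra_simps)
  have "q * q \<le> q * 1" using q by (intro mult_left_mono) auto
  then have D: "1 + q - q\<^sup>2 \<noteq> 0" by (simp add: power2_eq_square)
  have p'': "(1 - p) * (1 + q - q\<^sup>2) = q" using p' by (simp add: algebra_simps)
  have \<alpha>q: "1 - \<alpha> = q * \<alpha>" "(1 - q\<^sup>2) * \<alpha> = 1 - q"
    using q by (auto simp: \<alpha>_def field_simps power2_eq_square)
  have "(1 + q) * P.up_gain = (1 + q - q\<^sup>2) * e"
  proof -
    have "(1 + q) * P.up_gain = (1 + q + q\<^sup>2) * (1 + q) * S.mean + q\<^sup>2 * (((1 + q) * q - (1 + q) * \<alpha>) * e)"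
      unfolding U unfolding \<kappa>_def by (simp add: algebra_simps)
    also have "\<dots> = (1 + q - q\<^sup>2) * e"
      unfolding \<alpha>(4) e[symmetric] by (simp add: algebra_simps power2_eq_square)
    finally show ?thesis .
  qed
  then have "((1 + q) * \<alpha>) * P.up_gain = (1 + q - q\<^sup>2) * (\<alpha> * e)"
    by (simp only: mult_ac)
  then have U': "P.up_gain = (1 + q - q\<^sup>2) * (\<alpha> * e)" unfolding \<alpha>(4) by simp
  \<comment> \<open>These are the drift equations after comparing coefficients: the first and third
    for a positive, the second and fourth for a negative sign.\<close>
  have gains: "p * P.up_gain = S.mean" "(1 - p) * P.up_gain = S.mean + \<kappa>"
    "p * (q\<^sup>2 * \<alpha>) + (1 - p) = q" "(1 - p) * (q\<^sup>2 * \<alpha>) + p = \<alpha>"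
  proof -
    have "p * P.up_gain = (p * (1 + q - q\<^sup>2)) * (\<alpha> * e)" unfolding U' by simp
    also have "\<dots> = ((1 - q\<^sup>2) * \<alpha>) * e" unfolding p' by simp
    finally show "p * P.up_gain = S.mean" unfolding \<alpha>q e .
    have "(1 - p) * P.up_gain = ((1 - p) * (1 + q - q\<^sup>2)) * (\<alpha> * e)" unfolding U' by simp
    also have "\<dots> = (1 - \<alpha>) * e" unfolding p'' \<alpha>q by simp
    also have "\<dots> = S.mean + \<kappa>" unfolding \<kappa>_def e[symmetric] by (simp add: algebra_simps)
    finally show "(1 - p) * P.up_gain = S.mean + \<kappa>" .
    have "(1 + q - q\<^sup>2) * (p * (q\<^sup>2 * \<alpha>) + (1 - p)) = (p * (1 + q - q\<^sup>2)) * \<alpha> * q\<^sup>2 + (1 - p) * (1 + q - q\<^sup>2)"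
      by (simp add: algebra_simps)
    also have "\<dots> = (1 + q - q\<^sup>2) * q" unfolding p' p'' \<alpha>q by (simp add: algebra_simps power2_eq_square)
    finally show "p * (q\<^sup>2 * \<alpha>) + (1 - p) = q" using D by simp
    have "(1 + q - q\<^sup>2) * ((1 - p) * (q\<^sup>2 * \<alpha>) + p) = ((1 - p) * (1 + q - q\<^sup>2)) * (q * (q * \<alpha>)) + p * (1 + q - q\<^sup>2)"
      by (simp add: algebra_simps power2_eq_square)
    also have "\<dots> = q\<^sup>2 * (q * \<alpha>) + (1 - q\<^sup>2)" unfolding p' p'' by (simp add: power2_eq_square)
    also have "\<dots> = 1 - q\<^sup>2 * \<alpha>" unfolding \<alpha>q(1)[symmetric] by (simp add: algebra_simps)
    also have "\<dots> = (1 + q) * \<alpha> - q\<^sup>2 * \<alpha>" unfolding \<alpha>(4) ..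
    also have "\<dots> = (1 + q - q\<^sup>2) * \<alpha>" by (simp add: algebra_simps)
    finally show "(1 - p) * (q\<^sup>2 * \<alpha>) + p = \<alpha>" using D by simp
  qed
  show thesis
  proof (rule that[of S.mean h P.pot_const])
    show "0 < S.mean" by (rule P.mean_pos)
    show "integrable (nu (1 / (1 + q))) ln" "(\<integral>x. ln x \<partial>nu (1 / (1 + q))) = S.mean"
      using S.nu_ln by (auto simp: \<alpha>_def)
  next
    fix x y :: real assume xy: "x \<noteq> 0 \<or> y \<noteq> 0"
    define a b where "a = \<bar>x\<bar>" and "b = \<bar>y\<bar>"
    have ab: "0 \<le> a" "0 \<le> b" "0 < max a b" using xy by (auto simp: a_def b_def)
    show "\<bar>h x y - ln (max \<bar>x\<bar> \<bar>y\<bar>)\<bar> \<le> P.pot_const"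
      unfolding h_def using P.potential_bound[OF ab] by (simp add: a_def b_def)
    have up: "P.potential True b (a + b) = H a b + q\<^sup>2 * \<alpha> * E a b + P.up_gain"
      unfolding E_def H_def
    proof (rule P.potential_up[OF ab])
      assume "b = 0"
      then show "q * P.descent a b = \<alpha> * P.descent a b + \<kappa>"
        using root(1)[of a] ab unfolding E_def \<kappa>_def by (simp add: algebra_simps)
    qed
    \<comment> \<open>The sign matters only if the pair reached has no zero entry. For
      \<open>b = 0\<close> or \<open>a = b\<close> it has one, and \<open>hroot\<close> lets
      \<open>s\<close> be arbitrary.\<close>
    have down: "P.potential s b \<bar>a - b\<bar> = H a b + E a b" if "b \<noteq> 0 \<Longrightarrow> a \<noteq> b \<Longrightarrow> s \<longleftrightarrow> \<not> b < a" for s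
    proof -
      have *: "P.potential (\<not> b < a) b \<bar>a - b\<bar> = H a b + E a b"
        unfolding E_def H_def by (rule P.potential_down[OF ab])
      show ?thesis
      proof (cases "b = 0 \<or> a = b")
        case True
        then have "P.potential s b \<bar>a - b\<bar> = P.potential (\<not> b < a) b \<bar>a - b\<bar>"
          using hroot[of b] hroot[of a] ab by (auto simp: max_def split: if_splits)
        then show ?thesis using * by simp
      next
        case False
        then have "s = (\<not> b < a)" using that by blast
        then show ?thesis using * by simp
      qed
    qed
    show "p * h y (y + x) + (1 - p) * h y (y - x) = h x y + S.mean"
    proof (cases "x * y < 0")
      case True
      have 1: "h y (y + x) = H a b + E a b"
      proof -
        have "\<bar>y + x\<bar> = \<bar>a - b\<bar>" using True by (auto simp: a_def b_def mult_less_0_iff)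
        moreover have "(\<not> y * (y + x) < 0) \<longleftrightarrow> \<not> b < a"
          using True by (auto simp: a_def b_def mult_less_0_iff)
        ultimately show ?thesis unfolding h_def using down[of "\<not> b < a"] by (simp add: b_def)
      qed
      have 2: "h y (y - x) = P.potential True b (a + b)"
      proof -
        have "\<bar>y - x\<bar> = a + b" "\<not> y * (y - x) < 0" using True by (auto simp: a_def b_def mult_less_0_iff)
        then show ?thesis unfolding h_def by (simp add: b_def)
      qed
      have "p * h y (y + x) + (1 - p) * h y (y - x) = H a b + ((1 - p) * (q\<^sup>2 * \<alpha>) + p) * E a b + (1 - p) * P.up_gain"
        unfolding 1 2 up by (simp add: algebra_simps)
      also have "\<dots> = h x y + S.mean" unfolding gains
        using True by (simp add: h_def P.potential_def E_def H_def a_def b_def)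
      finally show ?thesis .
    next
      case False
      have 1: "h y (y - x) = H a b + E a b"
      proof -
        have "\<bar>y - x\<bar> = \<bar>a - b\<bar>" using False by (auto simp: a_def b_def not_less zero_le_mult_iff)
        moreover have "y \<noteq> 0 \<Longrightarrow> a \<noteq> b \<Longrightarrow> (\<not> y * (y - x) < 0) \<longleftrightarrow> \<not> b < a"
          using False by (auto simp: a_def b_def mult_less_0_iff)
        ultimately show ?thesis unfolding h_def using down[of "\<not> y * (y - x) < 0"] by (simp add: b_def)
      qed
      have 2: "h y (y + x) = P.potential True b (a + b)"
      proof -
        have "\<bar>y + x\<bar> = a + b" "\<not> y * (y + x) < 0" using False by (auto simp: a_def b_def mult_less_0_iff)
        then show ?thesis unfolding h_def by (simp add: b_def)
      qed
      have "p * h y (y + x) + (1 - p) * h y (y - x) = H a b + (p * (q\<^sup>2 * \<alpha>) + (1 - p)) * E a b + p * P.up_gain"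
        unfolding 1 2 up by (simp add: algebra_simps)
      also have "\<dots> = h x y + S.mean" unfolding gains
        using False by (simp add: h_def P.potential_def E_def H_def a_def b_def)
      finally show ?thesis .
    qed
  qed
qed

section \<open>Averages of martingale noise\<close>

text \<open>The distance from \<open>n\<close> to the largest square below it is at most twice the
  root of that square, so bounded increments contribute only \<open>O(1 / sqrt n)\<close> to the
  average.\<close>

lemma LIMSEQ_div_of_square_subseq:
  fixes s :: "nat \<Rightarrow> real"
  assumes inc: "\<And>n. \<bar>s (Suc n) - s n\<bar> \<le> K"
    and sq: "(\<lambda>j. s ((Suc j)\<^sup>2) / real ((Suc j)\<^sup>2)) \<longlonglongrightarrow> 0"
  shows "(\<lambda>n. s n / real n) \<longlonglongrightarrow> 0"
proof -
  have K: "0 \<le> K" using inc[of 0] by linarith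
  have diff: "\<bar>s (m + d) - s m\<bar> \<le> K * real d" for m d
  proof (induction d)
    case (Suc d)
    then show ?case using inc[of "m + d"] by (simp add: algebra_simps)
  qed simp
  define r where "r n = nat \<lfloor>sqrt (real n)\<rfloor>" for n
  have r: "(r n)\<^sup>2 \<le> n" "n < (Suc (r n))\<^sup>2" for n
  proof -
    have "real (r n) \<le> sqrt (real n)" "sqrt (real n) < real (Suc (r n))" unfolding r_def by (auto simp: of_nat_nat) linarith+
    then have "(real (r n))\<^sup>2 \<le> (sqrt (real n))\<^sup>2" "(sqrt (real n))\<^sup>2 < (real (Suc (r n)))\<^sup>2"
      by (simp_all only: power_mono power_strict_mono of_nat_0_le_iff real_sqrt_ge_zero zero_less_numeral)
    then have "(real (r n))\<^sup>2 \<le> real n" "real n < (real (Suc (r n)))\<^sup>2" by (simp_all only: real_sqrt_pow2 of_nat_0_le_iff)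
    then show "(r n)\<^sup>2 \<le> n" "n < (Suc (r n))\<^sup>2"
      by (simp_all only: of_nat_power[symmetric] of_nat_le_iff of_nat_less_iff)
  qed
  have rtop: "filterlim r at_top sequentially"
  proof (rule filterlim_at_top[THEN iffD2], rule allI)
    fix Z :: nat
    show "\<forall>\<^sub>F n in sequentially. Z \<le> r n"
    proof (rule eventually_sequentiallyI)
      fix n assume "Z\<^sup>2 \<le> n"
      then have "Z\<^sup>2 < (Suc (r n))\<^sup>2" using r(2)[of n] by linarith
      then show "Z \<le> r n" by (simp add: power2_less_imp_less less_Suc_eq_le[symmetric])
    qed
  qed
  have "(\<lambda>j. s (j\<^sup>2) / real (j\<^sup>2)) \<longlonglongrightarrow> 0" using sq by (subst (asm) filterlim_sequentially_Suc)
  then have "(\<lambda>j. \<bar>s (j\<^sup>2) / real (j\<^sup>2)\<bar> + 2 * K / real j) \<longlonglongrightarrow> 0 + 0"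
    by (intro tendsto_add tendsto_rabs_zero lim_const_over_n)
  then have "(\<lambda>j. \<bar>s (j\<^sup>2) / real (j\<^sup>2)\<bar> + 2 * K / real j) \<longlonglongrightarrow> 0" by simp
  then have lim: "(\<lambda>n. \<bar>s ((r n)\<^sup>2) / real ((r n)\<^sup>2)\<bar> + 2 * K / real (r n)) \<longlonglongrightarrow> 0"
    by (rule filterlim_compose[OF _ rtop])
  show ?thesis
  proof (rule Lim_null_comparison[OF _ lim], rule eventually_sequentiallyI)
    fix n :: nat assume n: "1 \<le> n"
    let ?m = "(r n)\<^sup>2"
    have "r n \<noteq> 0" using r(2)[of n] n by (auto intro: ccontr)
    then have m: "0 < real ?m" by simp
    have d: "n - ?m \<le> 2 * r n" using r(2)[of n] by (simp add: power2_eq_square)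
    have "\<bar>s n - s ?m\<bar> \<le> K * real (n - ?m)" using diff[of ?m "n - ?m"] r(1)[of n] by simp
    also have "\<dots> \<le> K * (2 * real (r n))" using d K by (intro mult_left_mono) auto
    finally have "\<bar>s n\<bar> \<le> \<bar>s ?m\<bar> + K * (2 * real (r n))" by linarith
    then have "\<bar>s n\<bar> / real n \<le> (\<bar>s ?m\<bar> + K * (2 * real (r n))) / real n" by (intro divide_right_mono) auto
    also have "\<dots> \<le> (\<bar>s ?m\<bar> + K * (2 * real (r n))) / real ?m"
      using m r(1)[of n] K n by (intro divide_left_mono mult_pos_pos) auto
    also have "\<dots> = \<bar>s ?m / real ?m\<bar> + 2 * K / real (r n)"
      using m by (simp add: add_divide_distrib power2_eq_square)
    finally show "norm (s n / real n) \<le> \<bar>s ?m / real ?m\<bar> + 2 * K / real (r n)" by simp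
  qed
qed

context prob_space
begin

text \<open>The earlier coins have finitely many outcomes, so every function \<open>g\<close> of
  them is measurable and bounded; it is independent of the centred coin \<open>n\<close>.\<close>

lemma expectation_past_noise:
  fixes b :: "nat \<Rightarrow> 'a \<Rightarrow> bool" and g :: "(nat \<Rightarrow> bool) \<Rightarrow> real"
  assumes ind: "indep_vars (\<lambda>_. count_space UNIV) b {1..}"
    and p: "\<forall>n\<ge>1. prob {\<omega> \<in> space M. b n \<omega>} = p"
    and n: "1 \<le> n"
  shows "(\<lambda>\<omega>. g (restrict (\<lambda>i. b i \<omega>) {1..<n})) \<in> borel_measurable M" (is "?g \<in> _")
    and "\<exists>B. \<forall>\<omega>. \<bar>g (restrict (\<lambda>i. b i \<omega>) {1..<n})\<bar> \<le> B"
    and "expectation (\<lambda>\<omega>. g (restrict (\<lambda>i. b i \<omega>) {1..<n}) * (of_bool (b n \<omega>) - p)) = 0"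
proof -
  have rv: "b i \<in> M \<rightarrow>\<^sub>M count_space UNIV" if "1 \<le> i" for i
    using ind that by (auto simp: indep_vars_def)
  have "indep_var (PiM {1..<n} (\<lambda>_. count_space UNIV)) (\<lambda>\<omega>. restrict (\<lambda>i. b i \<omega>) {1..<n})
     (PiM {n} (\<lambda>_. count_space UNIV)) (\<lambda>\<omega>. restrict (\<lambda>i. b i \<omega>) {n})"
    using n by (intro indep_var_restrict[OF ind]) auto
  moreover have g: "g \<in> borel_measurable (PiM {1..<n} (\<lambda>_. count_space UNIV))"
    by (subst count_space_PiM_finite) auto
  moreover have "(\<lambda>f. of_bool (f n) - p) \<in> borel_measurable (PiM {n} (\<lambda>_. count_space UNIV))"
    by (subst count_space_PiM_finite) auto
  ultimately have "indep_var borel (g \<circ> (\<lambda>\<omega>. restrict (\<lambda>i. b i \<omega>) {1..<n}))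
      borel ((\<lambda>f. of_bool (f n) - p) \<circ> (\<lambda>\<omega>. restrict (\<lambda>i. b i \<omega>) {n}))"
    by (rule indep_var_compose)
  then have iv: "indep_var borel ?g borel (\<lambda>\<omega>. of_bool (b n \<omega>) - p)" by (simp add: comp_def)
  show gm: "?g \<in> borel_measurable M" using iv by (auto dest: indep_var_rv1)
  have fin: "finite (g ` (PiE {1..<n} (\<lambda>_. UNIV)))" by (intro finite_imageI finite_PiE) auto
  have "\<bar>?g \<omega>\<bar> \<le> Max (abs ` g ` (PiE {1..<n} (\<lambda>_. UNIV)))" for \<omega>
    by (rule Max_ge) (use fin in \<open>auto\<close>)
  then show ex: "\<exists>B. \<forall>\<omega>. \<bar>?g \<omega>\<bar> \<le> B" by blast
  then obtain B where B: "\<And>\<omega>. \<bar>?g \<omega>\<bar> \<le> B" by blast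
  have gi: "integrable M ?g"
    by (rule integrable_const_bound[of _ B]) (use B gm in auto)
  have bm: "{\<omega> \<in> space M. b n \<omega>} \<in> events" using rv[OF n] by measurable
  have bi: "integrable M (\<lambda>\<omega>. of_bool (b n \<omega>) :: real)"
    using rv[OF n] by (intro integrable_const_bound[of _ 1]) auto
  have "expectation (\<lambda>\<omega>. of_bool (b n \<omega>)) = expectation (indicator {\<omega> \<in> space M. b n \<omega>})"
    by (intro Bochner_Integration.integral_cong) (auto simp: indicator_def)
  also have "\<dots> = p" using p[rule_format, OF n] bm by simp
  finally have e: "expectation (\<lambda>\<omega>. of_bool (b n \<omega>) - p) = 0" using bi prob_space by simp
  show "expectation (\<lambda>\<omega>. ?g \<omega> * (of_bool (b n \<omega>) - p)) = 0"
    using indep_var_lebesgue_integral[OF iv gi] bi e by simp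
qed

text \<open>The weight \<open>\<Phi>\<close> sees only earlier coins, so cross terms vanish and the
  second moment of the sum up to \<open>n\<close> is at most \<open>K\<^sup>2 * n\<close>. Along
  squares the second moments of the averages are then summable.\<close>

lemma AE_noise_average_tendsto_0:
  fixes b :: "nat \<Rightarrow> 'a \<Rightarrow> bool" and \<Phi> :: "bool list \<Rightarrow> real"
  assumes ind: "indep_vars (\<lambda>_. count_space UNIV) b {1..}"
    and p: "\<forall>n\<ge>1. prob {\<omega> \<in> space M. b n \<omega>} = p"
    and K: "\<And>xs. \<bar>\<Phi> xs\<bar> \<le> K"
  shows "AE \<omega> in M. (\<lambda>n. (\<Sum>k\<in>{1..<n}. \<Phi> (map (\<lambda>i. b i \<omega>) [1..<k]) * (of_bool (b k \<omega>) - p)) / real n) \<longlonglongrightarrow> 0"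
proof -
  define S where "S n \<omega> = (\<Sum>k\<in>{1..<n}. \<Phi> (map (\<lambda>i. b i \<omega>) [1..<k]) * (of_bool (b k \<omega>) - p))" for n \<omega>
  define \<phi> where "\<phi> n \<omega> = \<Phi> (map (\<lambda>i. b i \<omega>) [1..<n])" for n \<omega>
  define Sg where "Sg n y = (\<Sum>k\<in>{1..<n}. \<Phi> (map y [1..<k]) * (of_bool (y k) - p))" for n and y :: "nat \<Rightarrow> bool"
  have K0: "0 \<le> K" using K[of "[]"] by linarith
  have p01: "0 \<le> p" "p \<le> 1" using p[rule_format, of 1] by auto
  have Sg: "S n \<omega> = Sg n (restrict (\<lambda>i. b i \<omega>) {1..<n})" for n \<omega>
    unfolding S_def Sg_def by (intro sum.cong refl arg_cong2[where f="(*)"] arg_cong[where f=\<Phi>] map_cong) auto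
  have \<phi>g: "\<phi> n \<omega> = \<Phi> (map (restrict (\<lambda>i. b i \<omega>) {1..<n}) [1..<n])" for n \<omega>
    unfolding \<phi>_def by (intro arg_cong[where f=\<Phi>] map_cong) auto
  note noise = expectation_past_noise[OF ind p]
  have rv [measurable]: "Measurable.pred M (b i)" if "1 \<le> i" for i
    using ind that by (auto simp: indep_vars_def)
  have Sm: "S n \<in> borel_measurable M" for n
  proof (cases "1 \<le> n")
    case True
    then show ?thesis unfolding Sg using noise(1)[OF True] by simp
  next
    case False
    then have "S n = (\<lambda>_. 0)" by (auto simp: S_def)
    then show ?thesis by simp
  qed
  have \<phi>m: "\<phi> n \<in> borel_measurable M" if "1 \<le> n" for n
    unfolding \<phi>g using noise(1)[OF that, of "\<lambda>y. \<Phi> (map y [1..<n])"] by simp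
  have S_Suc: "S (Suc n) \<omega> = S n \<omega> + \<phi> n \<omega> * (of_bool (b n \<omega>) - p)" if "1 \<le> n" for n \<omega>
    using that unfolding S_def \<phi>_def by (simp add: atLeastLessThanSuc)
  have xi: "\<bar>of_bool (b n \<omega>) - p\<bar> \<le> 1" for n \<omega> using p01 by (cases "b n \<omega>") auto
  have inc: "\<bar>\<phi> n \<omega> * (of_bool (b n \<omega>) - p)\<bar> \<le> K" for n \<omega>
  proof -
    have "\<bar>\<phi> n \<omega>\<bar> * \<bar>of_bool (b n \<omega>) - p\<bar> \<le> K * 1"
      using K K0 xi unfolding \<phi>_def by (intro mult_mono) auto
    then show ?thesis by (simp add: abs_mult)
  qed
  have second: "integrable M (\<lambda>\<omega>. (S n \<omega>)\<^sup>2) \<and> expectation (\<lambda>\<omega>. (S n \<omega>)\<^sup>2) \<le> K\<^sup>2 * real n" for n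
  proof (induction n)
    case 0
    then show ?case by (simp add: S_def)
  next
    case (Suc n)
    show ?case
    proof (cases "1 \<le> n")
      case False
      then show ?thesis by (simp add: S_def)
    next
      case True
      define g where "g y = Sg n y * \<Phi> (map y [1..<n])" for y
      have gS: "g (restrict (\<lambda>i. b i \<omega>) {1..<n}) = S n \<omega> * \<phi> n \<omega>" for \<omega>
        by (simp add: g_def Sg \<phi>g)
      obtain B where B: "\<And>\<omega>. \<bar>S n \<omega> * \<phi> n \<omega>\<bar> \<le> B"
        using noise(2)[OF True, of g] unfolding gS by blast
      have zero: "expectation (\<lambda>\<omega>. S n \<omega> * \<phi> n \<omega> * (of_bool (b n \<omega>) - p)) = 0"
        using noise(3)[OF True, of g] unfolding gS by simp
      let ?x = "\<lambda>\<omega>. of_bool (b n \<omega>) - p"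
      have xm: "?x \<in> borel_measurable M" using rv[OF True] by measurable
      have i1: "integrable M (\<lambda>\<omega>. S n \<omega> * \<phi> n \<omega> * ?x \<omega>)"
      proof (rule integrable_const_bound[of _ B])
        have "\<bar>S n \<omega> * \<phi> n \<omega>\<bar> * \<bar>?x \<omega>\<bar> \<le> B * 1" for \<omega>
          using B[of \<omega>] xi[of n \<omega>] by (intro mult_mono) auto
        then show "AE \<omega> in M. norm (S n \<omega> * \<phi> n \<omega> * ?x \<omega>) \<le> B" by (simp add: abs_mult)
        show "(\<lambda>\<omega>. S n \<omega> * \<phi> n \<omega> * ?x \<omega>) \<in> borel_measurable M" using Sm \<phi>m[OF True] xm by simp
      qed
      have sq: "(\<phi> n \<omega> * ?x \<omega>)\<^sup>2 \<le> K\<^sup>2" for \<omega>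
        using inc[of n \<omega>] K0 by (metis abs_le_square_iff abs_of_nonneg)
      have i2: "integrable M (\<lambda>\<omega>. (\<phi> n \<omega> * ?x \<omega>)\<^sup>2)"
        using sq \<phi>m[OF True] xm by (intro integrable_const_bound[of _ "K\<^sup>2"]) auto
      have exp: "(S (Suc n) \<omega>)\<^sup>2 = (S n \<omega>)\<^sup>2 + 2 * (S n \<omega> * \<phi> n \<omega> * ?x \<omega>) + (\<phi> n \<omega> * ?x \<omega>)\<^sup>2" for \<omega>
        unfolding S_Suc[OF True] by (simp add: power2_eq_square algebra_simps)
      have int: "integrable M (\<lambda>\<omega>. (S (Suc n) \<omega>)\<^sup>2)" unfolding exp using Suc i1 i2 by auto
      have "expectation (\<lambda>\<omega>. (\<phi> n \<omega> * ?x \<omega>)\<^sup>2) \<le> expectation (\<lambda>_. K\<^sup>2)"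
        using i2 sq by (intro integral_mono) auto
      then have le: "expectation (\<lambda>\<omega>. (\<phi> n \<omega> * ?x \<omega>)\<^sup>2) \<le> K\<^sup>2" using prob_space by simp
      have "expectation (\<lambda>\<omega>. (S (Suc n) \<omega>)\<^sup>2) = expectation (\<lambda>\<omega>. (S n \<omega>)\<^sup>2) + expectation (\<lambda>\<omega>. (\<phi> n \<omega> * ?x \<omega>)\<^sup>2)"
        unfolding exp using Suc i1 i2 zero by simp
      then show ?thesis using le Suc int by (simp add: algebra_simps)
    qed
  qed
  define f where "f j \<omega> = (S ((Suc j)\<^sup>2) \<omega> / real ((Suc j)\<^sup>2))\<^sup>2" for j \<omega>
  have fm: "f j \<in> borel_measurable M" for j unfolding f_def using Sm by simp
  have "(\<integral>\<^sup>+\<omega>. ennreal \<bar>f j \<omega>\<bar> \<partial>M) \<le> ennreal (K\<^sup>2 * inverse (real (Suc j) ^ 2))" for j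
  proof -
    let ?m = "real ((Suc j)\<^sup>2)"
    have m: "0 < ?m" by simp
    have f_eq: "f j \<omega> = (1 / ?m\<^sup>2) * (S ((Suc j)\<^sup>2) \<omega>)\<^sup>2" for \<omega> by (simp add: f_def power_divide)
    have fi: "integrable M (f j)" unfolding f_eq using second by auto
    have "(\<integral>\<^sup>+\<omega>. ennreal \<bar>f j \<omega>\<bar> \<partial>M) = ennreal (expectation (f j))"
      using fi by (subst nn_integral_eq_integral[symmetric]) (auto simp: f_def)
    also have "expectation (f j) = (1 / ?m\<^sup>2) * expectation (\<lambda>\<omega>. (S ((Suc j)\<^sup>2) \<omega>)\<^sup>2)"
      unfolding f_eq by simp
    also have "\<dots> \<le> (1 / ?m\<^sup>2) * (K\<^sup>2 * ?m)" using second[of "(Suc j)\<^sup>2"] by (intro mult_left_mono) auto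
    also have "\<dots> = K\<^sup>2 * inverse (real (Suc j) ^ 2)" 
    proof -
      have "(1 / x\<^sup>2) * (k * x) = k * inverse x" if "0 < x" for x k :: real
        using that by (simp add: field_simps power2_eq_square)
      from this[OF m] show ?thesis by (simp only: of_nat_power)
    qed
    finally show ?thesis by (simp add: ennreal_leI)
  qed
  then have "(\<Sum>j. \<integral>\<^sup>+\<omega>. ennreal \<bar>f j \<omega>\<bar> \<partial>M) \<le> (\<Sum>j. ennreal (K\<^sup>2 * inverse (real (Suc j) ^ 2)))"
    by (intro suminf_le) auto
  also have "\<dots> = ennreal (\<Sum>j. K\<^sup>2 * inverse (real (Suc j) ^ 2))"
  proof (rule suminf_ennreal2)
    have "summable (\<lambda>n. inverse (real n ^ 2))" by (rule inverse_power_summable) simp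
    then have "summable (\<lambda>j. inverse (real (Suc j) ^ 2))" by (subst summable_Suc_iff)
    then show "summable (\<lambda>j. K\<^sup>2 * inverse (real (Suc j) ^ 2))" by (rule summable_mult)
  qed auto
  also have "\<dots> < \<infinity>" by simp
  finally have "AE \<omega> in M. summable (\<lambda>j. \<bar>f j \<omega>\<bar>)" by (intro AE_summable_abs fm)
  then show ?thesis
  proof eventually_elim
    case (elim \<omega>)
    then have "(\<lambda>j. f j \<omega>) \<longlonglongrightarrow> 0" by (rule summable_LIMSEQ_zero[OF summable_rabs_cancel])
    then have "(\<lambda>j. sqrt (f j \<omega>)) \<longlonglongrightarrow> sqrt 0" by (intro tendsto_real_sqrt)
    then have "(\<lambda>j. \<bar>S ((Suc j)\<^sup>2) \<omega> / real ((Suc j)\<^sup>2)\<bar>) \<longlonglongrightarrow> 0" by (simp add: f_def)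
    then have "(\<lambda>j. S ((Suc j)\<^sup>2) \<omega> / real ((Suc j)\<^sup>2)) \<longlonglongrightarrow> 0" by (rule tendsto_rabs_zero_cancel)
    moreover have "\<bar>S (Suc n) \<omega> - S n \<omega>\<bar> \<le> K" for n
    proof (cases "1 \<le> n")
      case True
      have e: "S (Suc n) \<omega> - S n \<omega> = \<phi> n \<omega> * (of_bool (b n \<omega>) - p)"
        using S_Suc[OF True, of \<omega>] by linarith
      show ?thesis unfolding e by (rule inc)
    next
      case False
      then show ?thesis using K0 by (simp add: S_def)
    qed
    ultimately have "(\<lambda>n. S n \<omega> / real n) \<longlonglongrightarrow> 0" by (intro LIMSEQ_div_of_square_subseq)
    then show ?case unfolding S_def .
  qed
qed

end

section \<open>Length of the Euclidean descent\<close>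

text \<open>The number of steps \<open>(a, b) \<mapsto> (b, \<bar>a - b\<bar>)\<close> until an entry vanishes, except that a pair
  \<open>(a, b)\<close> with \<open>a \<le> b\<close> uses two steps at once.\<close>

function height :: "nat \<Rightarrow> nat \<Rightarrow> nat" where
  "height a b = (if a = 0 \<or> b = 0 then 0
    else if a \<le> b then 2 + height (b - a) a else 1 + height b (a - b))"
  by pat_completeness auto
termination by (relation "Wellfounded.measure (\<lambda>(a, b). a + b)") auto

declare height.simps [simp del]

lemma height_0 [simp]: "height 0 b = 0" "height a 0 = 0"
  by (simp_all add: height.simps)

lemma height_le: "0 < a \<Longrightarrow> a \<le> b \<Longrightarrow> height a b = 2 + height (b - a) a"
  and height_gt: "0 < b \<Longrightarrow> b < a \<Longrightarrow> height a b = 1 + height b (a - b)"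
  by (subst height.simps; simp)+

lemma height_up: "height b (a + b) \<le> height a b + 2"
  using height_le[of b "a + b"] by (cases "b = 0") auto

text \<open>For \<open>0 < a < b\<close> the new pair \<open>(b, b - a)\<close> is halfway through a
  double step, so the height drops by one here as well. Only a pair with a zero entry can gain
  height, as in \<open>(0, b)\<close> to \<open>(b, b)\<close>, which has height 2.\<close>

lemma height_down:
  assumes "int c = \<bar>int a - int b\<bar>"
  shows "height b c \<le> max (height a b - 1) 2"
proof -
  have "int c = int (if a \<le> b then b - a else a - b)" using assms by (simp add: of_nat_diff)
  then have "c = (if a \<le> b then b - a else a - b)" by (simp only: of_nat_eq_iff)
  then consider "a = 0" "c = b" | "b = 0" | "0 < a" "a = b" "c = 0" | "0 < a" "a < b" "c = b - a" | "0 < b" "b < a" "c = a - b"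
    by (cases a b rule: linorder_cases; cases "a = 0"; cases "b = 0") auto
  then show ?thesis
  proof cases
    case 1
    then show ?thesis by (cases "b = 0") (auto simp: height_le)
  next
    case 4
    then have "height b c = 1 + height c (b - c)" by (intro height_gt) auto
    then show ?thesis using 4 height_le[of a b] by simp
  next
    case 5
    then show ?thesis using height_gt[of b a] by simp
  qed auto
qed

text \<open>In one round of the recursion the gcd is kept and the larger entry is the sum of the
  next pair, so the sum at most halves.\<close>

lemma sum_le_height: "a + b \<le> 2 ^ height a b * gcd a b"
proof (induction a b rule: height.induct)
  case (1 a b)
  consider "a = 0 \<or> b = 0" | "0 < a" "a \<le> b" | "0 < b" "b < a" by linarith
  then show ?case
  proof cases
    case 1
    then show ?thesis by auto
  next
    case 2
    then have "b - a + a \<le> 2 ^ height (b - a) a * gcd (b - a) a" using 1 by auto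
    then have "b \<le> 2 ^ height (b - a) a * gcd a b" using 2 gcd_diff1_nat[of a b] by (simp add: gcd.commute)
    then show ?thesis using 2 by (simp add: height_le)
  next
    case 3
    then have "b + (a - b) \<le> 2 ^ height b (a - b) * gcd b (a - b)" using 1 by auto
    then have "a \<le> 2 ^ height b (a - b) * gcd a b" using 3 by (metis gcd.commute gcd_diff1_nat le_add_diff_inverse less_imp_le)
    then show ?thesis using 3 by (simp add: height_gt)
  qed
qed

text \<open>Each subtraction of the smaller entry costs at least one step, so the height controls
  the quotient of the entries. The bound is linear, so it vanishes after taking logarithms and
  dividing by \<open>n\<close>.\<close>

lemma le_height_mult: "(0 < b \<longrightarrow> a \<le> (height a b + 1) * b) \<and> (0 < a \<longrightarrow> b \<le> (height a b + 1) * a)"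
proof (induction "a + b" arbitrary: a b rule: less_induct)
  case less
  consider "a = 0 \<or> b = 0" | "0 < a" "a \<le> b" | "0 < b" "b < a" by linarith
  then show ?case
  proof cases
    case 2
    then have "b - a \<le> (height (b - a) a + 1) * a" using less[of "b - a" a] by auto
    then have "b \<le> (height (b - a) a + 1) * a + a" by simp
    then show ?thesis using 2 by (auto simp: height_le)
  next
    case 3
    have "a \<le> (height a b + 1) * b"
    proof (cases "a - b \<le> b")
      case True
      then have "a \<le> (1 + 1) * b" by simp
      also have "\<dots> \<le> (height a b + 1) * b" using 3 by (intro mult_le_mono1) (simp add: height_gt)
      finally show ?thesis .
    next
      case False
      then have h: "height a b = 3 + height (a - b - b) b" using 3 by (simp add: height_gt height_le)
      have "a - b - b \<le> (height (a - b - b) b + 1) * b" using less[of "a - b - b" b] 3 False by auto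
      then show ?thesis unfolding h by (simp add: algebra_simps)
    qed
    then show ?thesis using 3 by (auto simp: height_gt)
  qed auto
qed

section \<open>Growth of the random walks\<close>

lemma ln_max_step_le:
  fixes x y z :: real
  assumes "x \<noteq> 0 \<or> y \<noteq> 0" "\<bar>z\<bar> \<le> \<bar>x\<bar> + \<bar>y\<bar>" "\<bar>x\<bar> \<le> \<bar>y\<bar> + \<bar>z\<bar>"
  shows "\<bar>ln (max \<bar>y\<bar> \<bar>z\<bar>) - ln (max \<bar>x\<bar> \<bar>y\<bar>)\<bar> \<le> ln 2"
proof -
  have gen: "max a b \<le> 2 * max b c \<and> max b c \<le> 2 * max a b \<and> 0 < max a b \<and> 0 < max b c"
    if "0 \<le> a" "0 \<le> b" "0 \<le> c" "c \<le> a + b" "a \<le> b + c" "a \<noteq> 0 \<or> b \<noteq> 0" for a b c :: real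
    using that by (auto simp: max_def)
  define A B where "A = max \<bar>x\<bar> \<bar>y\<bar>" and "B = max \<bar>y\<bar> \<bar>z\<bar>"
  have "A \<le> 2 * B \<and> B \<le> 2 * A \<and> 0 < A \<and> 0 < B"
    unfolding A_def B_def by (rule gen) (use assms in simp_all)
  then have AB: "A \<le> 2 * B" "B \<le> 2 * A" "0 < A" "0 < B" by simp_all
  have "ln A \<le> ln (2 * B)" "ln B \<le> ln (2 * A)" using AB by simp_all
  then have "ln A \<le> ln 2 + ln B" "ln B \<le> ln 2 + ln A" using AB by (simp_all add: ln_mult)
  then show ?thesis unfolding A_def[symmetric] B_def[symmetric] by linarith
qed

definition walk_state :: "(bool \<Rightarrow> real \<Rightarrow> real \<Rightarrow> real) \<Rightarrow> bool list \<Rightarrow> real \<times> real" where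
  "walk_state t = foldl (\<lambda>(x, y) b. (y, t b x y)) (1, 1)"

text \<open>Coin \<open>n\<close> produces the term \<open>n + 2\<close>, so the coins before
  \<open>n\<close> determine the pair at \<open>n\<close>. This makes the increments of the
  potential functions of the past times a centred coin.\<close>

lemma walk_state_eq:
  assumes "X 1 = 1" "X 2 = 1" and rec: "\<And>n. 1 \<le> n \<Longrightarrow> X (n + 2) = t (b n) (X n) (X (n + 1))"
    and "1 \<le> n"
  shows "walk_state t (map b [1..<n]) = (X n, X (n + 1))"
  using \<open>1 \<le> n\<close>
proof (induction n rule: dec_induct)
  case base
  then show ?case using assms by (simp add: walk_state_def numeral_2_eq_2)
next
  case (step n)
  then show ?case using rec[of n] by (simp add: walk_state_def)
qed

text \<open>A potential with constant drift \<open>m\<close> differs from \<open>n m\<close> along the walk by a martingale with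
  bounded increments.\<close>

lemma (in prob_space) AE_growth_rate:
  fixes b :: "nat \<Rightarrow> 'a \<Rightarrow> bool" and h :: "real \<Rightarrow> real \<Rightarrow> real"
  assumes ind: "indep_vars (\<lambda>_. count_space UNIV) b {1..}"
    and p: "\<forall>n\<ge>1. prob {\<omega> \<in> space M. b n \<omega>} = p"
    and P: "P 1 1" "\<And>c x y. P x y \<Longrightarrow> P y (t c x y)" "\<And>x y. P x y \<Longrightarrow> x \<noteq> 0 \<or> y \<noteq> 0"
    and t: "\<And>c x y. P x y \<Longrightarrow> \<bar>t c x y\<bar> \<le> \<bar>x\<bar> + \<bar>y\<bar>" "\<And>c x y. P x y \<Longrightarrow> \<bar>x\<bar> \<le> \<bar>y\<bar> + \<bar>t c x y\<bar>"
    and C: "\<And>x y. P x y \<Longrightarrow> \<bar>h x y - ln (max \<bar>x\<bar> \<bar>y\<bar>)\<bar> \<le> C"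
    and h: "\<And>x y. P x y \<Longrightarrow> p * h y (t True x y) + (1 - p) * h y (t False x y) = h x y + m"
  shows "AE \<omega> in M. \<forall>X. X 1 = 1 \<and> X 2 = 1 \<and> (\<forall>n\<ge>1. X (n + 2) = t (b n \<omega>) (X n) (X (n + 1))) \<longrightarrow>
    (\<lambda>n. ln (max \<bar>X n\<bar> \<bar>X (n + 1)\<bar>) / real n) \<longlonglongrightarrow> m"
proof -
  \<comment> \<open>Writing the coin as 0 or 1, the drift equation says that the new potential is
    \<open>h x y + m + D x y * (coin - p)\<close>.\<close>
  define D where "D x y = (if P x y then h y (t True x y) - h y (t False x y) else 0)" for x y
  define \<Phi> where "\<Phi> xs = (case walk_state t xs of (x, y) \<Rightarrow> D x y)" for xs
  have C0: "0 \<le> C" using C[OF P(1)] by linarith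
  have K: "\<bar>\<Phi> xs\<bar> \<le> 2 * C + 2 * ln 2" for xs
  proof -
    have "\<bar>D x y\<bar> \<le> 2 * C + 2 * ln 2" for x y
    proof (cases "P x y")
      case True
      let ?l = "\<lambda>c. ln (max \<bar>y\<bar> \<bar>t c x y\<bar>)"
      have *: "\<bar>?l c - ln (max \<bar>x\<bar> \<bar>y\<bar>)\<bar> \<le> ln 2" for c
        using P(3)[OF True] t[OF True, of c] by (intro ln_max_step_le) auto
      have **: "\<bar>h y (t c x y) - ?l c\<bar> \<le> C" for c using C[OF P(2)[OF True]] .
      have "\<bar>u - v\<bar> \<le> 2 * C + 2 * d" if "\<bar>u - i\<bar> \<le> C" "\<bar>v - j\<bar> \<le> C" "\<bar>i - k\<bar> \<le> d" "\<bar>j - k\<bar> \<le> d" for u v i j k d :: real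
        using that by linarith
      from this[OF **[of True] **[of False] *[of True] *[of False]] show ?thesis using True by (simp add: D_def)
    next
      case False
      then show ?thesis using C0 by (simp add: D_def)
    qed
    then show ?thesis by (simp add: \<Phi>_def split: prod.split)
  qed
  have "AE \<omega> in M. (\<lambda>n. (\<Sum>k\<in>{1..<n}. \<Phi> (map (\<lambda>i. b i \<omega>) [1..<k]) * (of_bool (b k \<omega>) - p)) / real n) \<longlonglongrightarrow> 0"
    by (rule AE_noise_average_tendsto_0[OF ind p K])
  then show ?thesis
  proof (eventually_elim, intro allI impI, elim conjE)
    fix \<omega> and X :: "nat \<Rightarrow> real"
    define S where "S n = (\<Sum>k\<in>{1..<n}. \<Phi> (map (\<lambda>i. b i \<omega>) [1..<k]) * (of_bool (b k \<omega>) - p))" for n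
    assume "(\<lambda>n. (\<Sum>k\<in>{1..<n}. \<Phi> (map (\<lambda>i. b i \<omega>) [1..<k]) * (of_bool (b k \<omega>) - p)) / real n) \<longlonglongrightarrow> 0"
    then have S: "(\<lambda>n. S n / real n) \<longlonglongrightarrow> 0" unfolding S_def .
    assume X: "X 1 = 1" "X 2 = 1" and "\<forall>n\<ge>1. X (n + 2) = t (b n \<omega>) (X n) (X (n + 1))"
    then have rec: "\<And>n. 1 \<le> n \<Longrightarrow> X (n + 2) = t (b n \<omega>) (X n) (X (n + 1))" by blast
    have PX: "P (X n) (X (n + 1))" if "1 \<le> n" for n
      using that
    proof (induction n rule: dec_induct)
      case base
      then show ?case using X P(1) by (simp add: numeral_2_eq_2)
    next
      case (step n)
      then show ?case using P(2)[OF step.IH, of "b n \<omega>"] rec[of n] by simp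
    qed
    have \<Phi>: "\<Phi> (map (\<lambda>i. b i \<omega>) [1..<n]) = D (X n) (X (n + 1))" if "1 \<le> n" for n
      using walk_state_eq[of X t "\<lambda>i. b i \<omega>" n, OF X rec that] by (simp add: \<Phi>_def)
    have hS: "h (X n) (X (n + 1)) = h 1 1 + (real n - 1) * m + S n" if "1 \<le> n" for n
      using that
    proof (induction n rule: dec_induct)
      case base
      then show ?case using X by (simp add: S_def numeral_2_eq_2)
    next
      case (step n)
      have e: "X (Suc n + 1) = t (b n \<omega>) (X n) (X (n + 1))" using rec[of n] step by simp
      have "S (Suc n) = S n + D (X n) (X (n + 1)) * (of_bool (b n \<omega>) - p)"
        unfolding S_def using \<Phi>[of n] step by (simp add: atLeastLessThanSuc)
      moreover have "h (X (n + 1)) (t (b n \<omega>) (X n) (X (n + 1))) =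
          h (X n) (X (n + 1)) + m + D (X n) (X (n + 1)) * (of_bool (b n \<omega>) - p)"
        using h[OF PX[OF step(1)]] PX[OF step(1)]
        by (cases "b n \<omega>") (simp_all add: D_def algebra_simps)
      ultimately show ?case using step.IH unfolding e by (simp add: algebra_simps)
    qed
    define err where "err n = ln (max \<bar>X n\<bar> \<bar>X (n + 1)\<bar>) - h (X n) (X (n + 1)) + (h 1 1 - m)" for n
    have err: "\<bar>err n\<bar> \<le> C + \<bar>h 1 1 - m\<bar>" if "1 \<le> n" for n
      using C[OF PX[OF that]] unfolding err_def by linarith
    have "(\<lambda>n. err n / real n) \<longlonglongrightarrow> 0"
    proof (rule Lim_null_comparison)
      show "\<forall>\<^sub>F n in sequentially. norm (err n / real n) \<le> (C + \<bar>h 1 1 - m\<bar>) / real n"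
        using err by (intro eventually_sequentiallyI[of 1]) (simp add: divide_right_mono)
      show "(\<lambda>n. (C + \<bar>h 1 1 - m\<bar>) / real n) \<longlonglongrightarrow> 0" by (rule lim_const_over_n)
    qed
    then have "(\<lambda>n. m + S n / real n + err n / real n) \<longlonglongrightarrow> m + 0 + 0"
      by (intro tendsto_add tendsto_const S)
    moreover have "\<forall>\<^sub>F n in sequentially. m + S n / real n + err n / real n = ln (max \<bar>X n\<bar> \<bar>X (n + 1)\<bar>) / real n"
    proof (rule eventually_sequentiallyI[of 1])
      fix n :: nat assume n: "1 \<le> n"
      have "ln (max \<bar>X n\<bar> \<bar>X (n + 1)\<bar>) = real n * m + S n + err n"
        unfolding err_def hS[OF n] by (simp add: algebra_simps)
      then show "m + S n / real n + err n / real n = ln (max \<bar>X n\<bar> \<bar>X (n + 1)\<bar>) / real n"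
        using n by (simp add: add_divide_distrib)
    qed
    ultimately show "(\<lambda>n. ln (max \<bar>X n\<bar> \<bar>X (n + 1)\<bar>) / real n) \<longlonglongrightarrow> m"
      by (simp add: tendsto_cong)
  qed
qed

section \<open>From the larger entry to a single term\<close>

lemma gcd_height_step:
  assumes u: "u (1::nat) = (1::nat)" "u 2 = 1"
    and rec: "\<And>n. 1 \<le> n \<Longrightarrow> u (n + 2) = u n + u (n + 1) \<or> int (u (n + 2)) = \<bar>int (u n) - int (u (n + 1))\<bar>"
    and "1 \<le> n"
  shows "gcd (u n) (u (n + 1)) = 1 \<and> height (u n) (u (n + 1)) \<le> 2 * n"
  using \<open>1 \<le> n\<close>
proof (induction n rule: dec_induct)
  case base
  have "height 1 1 = 2" using height_le[of 1 1] by simp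
  then show ?case using u by (simp add: numeral_2_eq_2)
next
  case (step n)
  from rec[OF step(1)] show ?case
  proof
    assume e: "u (n + 2) = u n + u (n + 1)"
    then have "gcd (u (n + 1)) (u (n + 2)) = gcd (u n) (u (n + 1))"
      by (metis gcd.commute gcd_add1)
    then show ?thesis using step e height_up[of "u (n + 1)" "u n"] by (simp add: numeral_2_eq_2)
  next
    assume e: "int (u (n + 2)) = \<bar>int (u n) - int (u (n + 1))\<bar>"
    have "gcd (int (u (n + 1))) (int (u (n + 2))) = gcd (int (u n)) (int (u (n + 1)))"
      unfolding e by (metis gcd.commute gcd_abs2_int gcd_diff1)
    then have "gcd (u (n + 1)) (u (n + 2)) = gcd (u n) (u (n + 1))" by (simp add: gcd_int_int_eq)
    moreover have "height (u (n + 1)) (u (n + 2)) \<le> 2 * Suc n"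
    proof (rule order_trans[OF height_down[OF e]])
      show "max (height (u n) (u (n + 1)) - 1) 2 \<le> 2 * Suc n" using conjunct2[OF step.IH] by simp
    qed
    ultimately show ?thesis using step.IH by simp
  qed
qed

text \<open>The entries stay coprime, so next to a zero stands a 1 and the logarithm of the maximum
  is 0, which positive growth eventually excludes. For nonzero \<open>u n\<close> the height is at
  most \<open>2 * n\<close>, so \<open>u n\<close> is smaller than the maximum by a factor of at
  most \<open>2 * n + 1\<close>.\<close>

lemma growth_of_max_imp_growth:
  assumes u: "u (1::nat) = (1::nat)" "u 2 = 1"
    and rec: "\<And>n. 1 \<le> n \<Longrightarrow> u (n + 2) = u n + u (n + 1) \<or> int (u (n + 2)) = \<bar>int (u n) - int (u (n + 1))\<bar>"
    and lim: "(\<lambda>n. ln (max (real (u n)) (real (u (n + 1)))) / real n) \<longlonglongrightarrow> m" and m: "0 < m"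
  shows "(\<forall>\<^sub>F n in sequentially. u n \<noteq> 0) \<and> (\<lambda>n. ln (real (u n)) / real n) \<longlonglongrightarrow> m"
proof -
  note st = gcd_height_step[OF u rec]
  let ?L = "\<lambda>n. ln (max (real (u n)) (real (u (n + 1))))"
  have ev: "\<forall>\<^sub>F n in sequentially. 0 < ?L n / real n \<and> 1 \<le> n"
    using order_tendstoD(1)[OF lim m] eventually_ge_at_top[of 1] by (rule eventually_conj)
  have nz: "u n \<noteq> 0" if "0 < ?L n / real n \<and> 1 \<le> n" for n
  proof
    assume 0: "u n = 0"
    then have "u (n + 1) = 1" using st[of n] that by auto
    then show False using 0 that by simp
  qed
  have "\<forall>\<^sub>F n in sequentially. u n \<noteq> 0" using ev by eventually_elim (rule nz)
  moreover have "(\<lambda>n. ln (real (u n)) / real n) \<longlonglongrightarrow> m"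
  proof (rule tendsto_sandwich[OF _ _ _ lim])
    have "(\<lambda>n. ln (real (2 * n + 1)) / real n) \<longlonglongrightarrow> 0"
    proof (rule Lim_null_comparison)
      show "(\<lambda>n. ln 3 / real n + ln (real n) / real n) \<longlonglongrightarrow> 0"
        using tendsto_add[OF lim_const_over_n[of "ln 3"] lim_ln_over_n] by simp
      show "\<forall>\<^sub>F n in sequentially. norm (ln (real (2 * n + 1)) / real n) \<le> ln 3 / real n + ln (real n) / real n"
      proof (rule eventually_sequentiallyI[of 1])
        fix n :: nat assume n: "1 \<le> n"
        have "ln (real (2 * n + 1)) \<le> ln (3 * real n)" using n by (subst ln_le_cancel_iff) auto
        also have "\<dots> = ln 3 + ln (real n)" using n by (simp add: ln_mult)
        finally have "ln (real (2 * n + 1)) / real n \<le> (ln 3 + ln (real n)) / real n" by (rule divide_right_mono) simp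
        then show "norm (ln (real (2 * n + 1)) / real n) \<le> ln 3 / real n + ln (real n) / real n"
          by (simp add: add_divide_distrib)
      qed
    qed
    then have "(\<lambda>n. ?L n / real n - ln (real (2 * n + 1)) / real n) \<longlonglongrightarrow> m - 0" by (intro tendsto_diff lim)
    then show "(\<lambda>n. ?L n / real n - ln (real (2 * n + 1)) / real n) \<longlonglongrightarrow> m" by simp
    have *: "?L n - ln (real (2 * n + 1)) \<le> ln (real (u n))" "ln (real (u n)) \<le> ?L n"
      if n: "0 < ?L n / real n \<and> 1 \<le> n" for n
    proof -
      have un: "0 < u n" using nz[OF n] by simp
      have "u (n + 1) \<le> (height (u n) (u (n + 1)) + 1) * u n" using le_height_mult un by blast
      also have "\<dots> \<le> (2 * n + 1) * u n" using st[of n] n by (intro mult_le_mono1) auto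
      finally have "u (n + 1) \<le> (2 * n + 1) * u n" .
      moreover have "u n \<le> (2 * n + 1) * u n" by simp
      ultimately have "max (u n) (u (n + 1)) \<le> (2 * n + 1) * u n" by simp
      then have "real (max (u n) (u (n + 1))) \<le> real ((2 * n + 1) * u n)" by (simp only: of_nat_le_iff)
      then have le: "max (real (u n)) (real (u (n + 1))) \<le> real (2 * n + 1) * real (u n)" by (simp only: of_nat_max of_nat_mult)
      have "?L n \<le> ln (real (2 * n + 1) * real (u n))" using le un by (subst ln_le_cancel_iff) auto
      also have "\<dots> = ln (real (2 * n + 1)) + ln (real (u n))" using un by (subst ln_mult) auto
      finally show "?L n - ln (real (2 * n + 1)) \<le> ln (real (u n))" by simp
      show "ln (real (u n)) \<le> ?L n" using un by (subst ln_le_cancel_iff) auto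
    qed
    show "\<forall>\<^sub>F n in sequentially. ?L n / real n - ln (real (2 * n + 1)) / real n \<le> ln (real (u n)) / real n"
      using ev by eventually_elim (use * in \<open>auto simp: diff_divide_distrib[symmetric] intro!: divide_right_mono\<close>)
    show "\<forall>\<^sub>F n in sequentially. ln (real (u n)) / real n \<le> ?L n / real n"
      using ev by eventually_elim (use * in \<open>auto intro!: divide_right_mono\<close>)
  qed
  ultimately show ?thesis ..
qed

text \<open>A step up adds at most \<open>2 \<le> 3 * (1 - p)\<close> to the height, and a step down
  that does not end at height at most 2 adds at most \<open>- 1 \<le> - 3 * p\<close>. Both
  comparisons are the condition \<open>p \<le> 1 / 3\<close>, so \<open>3 * S\<close> dominates the
  height since its last reset.\<close>

lemma subexponential_growth:
  assumes u: "u (1::nat) = (1::nat)" "u 2 = 1"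
    and rec: "\<And>n. 1 \<le> n \<Longrightarrow> if b n then u (n + 2) = u n + u (n + 1) else int (u (n + 2)) = \<bar>int (u n) - int (u (n + 1))\<bar>"
    and p: "p \<le> 1 / 3"
    and lim: "(\<lambda>n. (\<Sum>k\<in>{1..<n}. of_bool (b k) - p) / real n) \<longlonglongrightarrow> (0::real)"
  shows "(\<lambda>n. ln (real (u n)) / real n) \<longlonglongrightarrow> 0"
proof -
  have rec': "u (n + 2) = u n + u (n + 1) \<or> int (u (n + 2)) = \<bar>int (u n) - int (u (n + 1))\<bar>" if "1 \<le> n" for n
    using rec[OF that] by (cases "b n") auto
  define S where "S n = (\<Sum>k\<in>{1..<n}. of_bool (b k) - p)" for n
  define T where "T n = real (height (u n) (u (n + 1)))" for n
  have S_Suc: "S (Suc n) = S n + (of_bool (b n) - p)" if "1 \<le> n" for n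
    using that by (simp add: S_def atLeastLessThanSuc)
  \<comment> \<open>\<open>k\<close> is the start or the latest reset to height at most 2; the
    constant 4 leaves some slack.\<close>
  have ex: "\<exists>k\<in>{1..n}. T n \<le> 4 + 3 * (S n - S k)" if "1 \<le> n" for n
    using that
  proof (induction n rule: dec_induct)
    case base
    have "height 1 1 = 2" using height_le[of 1 1] by simp
    then show ?case using u by (simp add: T_def numeral_2_eq_2)
  next
    case (step n)
    then obtain k where k: "1 \<le> k" "k \<le> n" "T n \<le> 4 + 3 * (S n - S k)" by auto
    show ?case
    proof (cases "b n")
      case True
      have "height (u (n + 1)) (u n + u (n + 1)) \<le> height (u n) (u (n + 1)) + 2" by (rule height_up)
      then have "real (height (u (n + 1)) (u n + u (n + 1))) \<le> T n + 2" unfolding T_def by linarith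
      then have "T (Suc n) \<le> T n + 2" using rec[OF step(1)] True by (simp add: T_def)
      also have "\<dots> \<le> 4 + 3 * (S (Suc n) - S k)" using k p S_Suc[OF step(1)] True by simp
      finally show ?thesis using k by auto
    next
      case False
      have "height (u (n + 1)) (u (n + 2)) \<le> max (height (u n) (u (n + 1)) - 1) 2"
        using rec[OF step(1)] False by (intro height_down) simp
      then have "T (Suc n) \<le> T n - 1 \<or> T (Suc n) \<le> 2" unfolding T_def
        by (cases "height (u n) (u (n + 1))") (auto simp: max_def split: if_splits)
      then show ?thesis
      proof
        assume "T (Suc n) \<le> T n - 1"
        also have "\<dots> \<le> 4 + 3 * (S (Suc n) - S k)" using k p S_Suc[OF step(1)] False by simp
        finally show ?thesis using k by auto
      next
        assume "T (Suc n) \<le> 2"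
        then show ?thesis by (intro bexI[of _ "Suc n"]) auto
      qed
    qed
  qed
  have Tlim: "(\<lambda>n. T n / real n) \<longlonglongrightarrow> 0"
  proof (rule LIMSEQ_I)
    fix r :: real assume r: "0 < r"
    have "(\<lambda>n. S n / real n) \<longlonglongrightarrow> 0" using lim unfolding S_def .
    from LIMSEQ_D[OF this, of "r / 12"] r obtain N where "\<And>n. N \<le> n \<Longrightarrow> norm (S n / real n - 0) < r / 12" by auto
    then have N: "\<bar>S n\<bar> \<le> r / 12 * real n" if "N \<le> n" "1 \<le> n" for n
    proof -
      have "\<bar>S n\<bar> / real n < r / 12" using \<open>\<And>n. N \<le> n \<Longrightarrow> norm (S n / real n - 0) < r / 12\<close>[OF that(1)] by simp
      then show ?thesis using that by (simp add: field_simps)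
    qed
    \<comment> \<open>\<open>A\<close> takes care of the times before \<open>N\<close>, since
      \<open>k\<close> may remain small while \<open>n\<close> grows.\<close>
    define A where "A = (\<Sum>k\<le>N. \<bar>S k\<bar>)"
    have A0: "0 \<le> A" by (simp add: A_def sum_nonneg)
    have SA: "\<bar>S n\<bar> \<le> r / 12 * real n + A" if "1 \<le> n" for n
    proof (cases "N \<le> n")
      case True
      then show ?thesis using N[OF True that] A0 by linarith
    next
      case False
      then have "\<bar>S n\<bar> \<le> A" unfolding A_def by (intro member_le_sum) auto
      then show ?thesis using r by (simp add: add_increasing)
    qed
    obtain N1 :: nat where N1: "real N1 > (4 + 6 * A) * 2 / r" using reals_Archimedean2 by blast
    show "\<exists>no. \<forall>n\<ge>no. norm (T n / real n - 0) < r"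
    proof (intro exI[of _ "max 1 N1"] allI impI)
      fix n assume "max 1 N1 \<le> n"
      then have n: "1 \<le> n" "real N1 \<le> real n" by auto
      obtain k where k: "1 \<le> k" "k \<le> n" "T n \<le> 4 + 3 * (S n - S k)" using ex[OF n(1)] by auto
      have "r / 12 * real k \<le> r / 12 * real n" using k r by (intro mult_left_mono) auto
      then have "T n \<le> 4 + 6 * A + r / 2 * real n" using k SA[OF n(1)] SA[OF k(1)] by (simp add: abs_le_iff)
      also have "4 + 6 * A < r / 2 * real n"
      proof -
        have "4 + 6 * A < r / 2 * real N1" using N1 r by (simp add: field_simps)
        also have "\<dots> \<le> r / 2 * real n" using n r by (intro mult_left_mono) auto
        finally show ?thesis .
      qed
      finally have "T n < r * real n" by simp
      then show "norm (T n / real n - 0) < r" using n by (simp add: T_def field_simps)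
    qed
  qed
  have "(\<lambda>n. ln 2 * (T n / real n)) \<longlonglongrightarrow> ln 2 * 0" by (intro tendsto_mult_left Tlim)
  then have lim2: "(\<lambda>n. ln 2 * (T n / real n)) \<longlonglongrightarrow> 0" by simp
  show ?thesis
  proof (rule Lim_null_comparison[OF _ lim2], rule eventually_sequentiallyI[of 1])
    fix n :: nat assume n: "1 \<le> n"
    show "norm (ln (real (u n)) / real n) \<le> ln 2 * (T n / real n)"
    proof (cases "u n = 0")
      \<comment> \<open>A zero term contributes nothing, because \<open>ln 0 = 0\<close>.\<close>
      case True
      then show ?thesis by (simp add: T_def)
    next
      case False
      have "u n \<le> 2 ^ height (u n) (u (n + 1))"
        using sum_le_height[of "u n" "u (n + 1)"] gcd_height_step[OF u rec' n] by simp
      then have "real (u n) \<le> real (2 ^ height (u n) (u (n + 1)))" by (simp only: of_nat_le_iff)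
      then have "ln (real (u n)) \<le> ln (real (2 ^ height (u n) (u (n + 1))))" using False by (subst ln_le_cancel_iff) auto
      also have "\<dots> = T n * ln 2" by (simp add: T_def ln_realpow)
      finally have "ln (real (u n)) / real n \<le> T n * ln 2 / real n" by (intro divide_right_mono) auto
      moreover have "0 \<le> ln (real (u n))" using False by simp
      ultimately show ?thesis by (simp add: mult.commute)
    qed
  qed
qed

section \<open>Transfer to real paths and almost sure growth\<close>

lemma abs_walk_nat:
  fixes X :: "nat \<Rightarrow> real"
  assumes X: "X 1 = 1" "X 2 = 1"
    and rec: "\<And>n. 1 \<le> n \<Longrightarrow> \<bar>X (n + 2)\<bar> = \<bar>X n\<bar> + \<bar>X (n + 1)\<bar> \<or> \<bar>X (n + 2)\<bar> = \<bar>\<bar>X n\<bar> - \<bar>X (n + 1)\<bar>\<bar>"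
  obtains u :: "nat \<Rightarrow> nat" where "\<And>n. 1 \<le> n \<Longrightarrow> \<bar>X n\<bar> = real (u n)" "u 1 = 1" "u 2 = 1"
    "\<And>n. 1 \<le> n \<Longrightarrow> u (n + 2) = u n + u (n + 1) \<or> int (u (n + 2)) = \<bar>int (u n) - int (u (n + 1))\<bar>"
proof -
  have "\<bar>X n\<bar> \<in> \<nat> \<and> \<bar>X (n + 1)\<bar> \<in> \<nat>" if "1 \<le> n" for n
    using that
  proof (induction n rule: dec_induct)
    case base
    then show ?case using X by (simp add: numeral_2_eq_2)
  next
    case (step n)
    then obtain i j where ij: "\<bar>X n\<bar> = real i" "\<bar>X (n + 1)\<bar> = real j" by (auto elim!: Nats_cases)
    have "\<bar>real i - real j\<bar> = real (nat \<bar>int i - int j\<bar>)" by simp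
    then have "\<bar>real i - real j\<bar> \<in> \<nat>" by (metis of_nat_in_Nats)
    moreover have "real i + real j \<in> \<nat>" by (metis of_nat_add of_nat_in_Nats)
    ultimately have "\<bar>X (n + 2)\<bar> \<in> \<nat>" using rec[OF step(1)] unfolding ij by auto
    then show ?case using step.IH by simp
  qed
  then have "\<exists>k. \<bar>X n\<bar> = real k" if "1 \<le> n" for n using that by (auto elim!: Nats_cases)
  then obtain u where u: "\<And>n. 1 \<le> n \<Longrightarrow> \<bar>X n\<bar> = real (u n)" by metis
  show thesis
  proof (rule that[OF u])
    show "u 1 = 1" "u 2 = 1" using u[of 1] u[of 2] X by auto
    fix n :: nat assume n: "1 \<le> n"
    have "real (u (n + 2)) = real (u n) + real (u (n + 1)) \<or> real (u (n + 2)) = \<bar>real (u n) - real (u (n + 1))\<bar>"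
      using rec[OF n] u[of n] u[of "n + 1"] u[of "n + 2"] n by simp
    then have "real (u (n + 2)) = real (u n + u (n + 1)) \<or> real_of_int (int (u (n + 2))) = real_of_int \<bar>int (u n) - int (u (n + 1))\<bar>"
      by simp
    then show "u (n + 2) = u n + u (n + 1) \<or> int (u (n + 2)) = \<bar>int (u n) - int (u (n + 1))\<bar>"
      by (simp only: of_nat_eq_iff of_int_eq_iff)
  qed
qed

lemma walk_growth_of_max:
  fixes X :: "nat \<Rightarrow> real"
  assumes X: "X 1 = 1" "X 2 = 1"
    and rec: "\<And>n. 1 \<le> n \<Longrightarrow> \<bar>X (n + 2)\<bar> = \<bar>X n\<bar> + \<bar>X (n + 1)\<bar> \<or> \<bar>X (n + 2)\<bar> = \<bar>\<bar>X n\<bar> - \<bar>X (n + 1)\<bar>\<bar>"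
    and lim: "(\<lambda>n. ln (max \<bar>X n\<bar> \<bar>X (n + 1)\<bar>) / real n) \<longlonglongrightarrow> m" and m: "0 < m"
  shows "(\<forall>\<^sub>F n in sequentially. X n \<noteq> 0) \<and> (\<lambda>n. ln \<bar>X n\<bar> / real n) \<longlonglongrightarrow> m"
proof -
  obtain u :: "nat \<Rightarrow> nat" where u: "\<And>n. 1 \<le> n \<Longrightarrow> \<bar>X n\<bar> = real (u n)" "u 1 = 1" "u 2 = 1"
    "\<And>n. 1 \<le> n \<Longrightarrow> u (n + 2) = u n + u (n + 1) \<or> int (u (n + 2)) = \<bar>int (u n) - int (u (n + 1))\<bar>"
    using abs_walk_nat[OF X rec] by blast
  have "\<forall>\<^sub>F n in sequentially. ln (max \<bar>X n\<bar> \<bar>X (n + 1)\<bar>) / real n = ln (max (real (u n)) (real (u (n + 1)))) / real n"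
    using u(1) by (intro eventually_sequentiallyI[of 1]) simp
  then have "(\<lambda>n. ln (max (real (u n)) (real (u (n + 1)))) / real n) \<longlonglongrightarrow> m"
    using lim by (simp only: tendsto_cong)
  then have *: "(\<forall>\<^sub>F n in sequentially. u n \<noteq> 0) \<and> (\<lambda>n. ln (real (u n)) / real n) \<longlonglongrightarrow> m"
    using growth_of_max_imp_growth[OF u(2,3,4) _ m] by blast
  have "\<forall>\<^sub>F n in sequentially. ln \<bar>X n\<bar> / real n = ln (real (u n)) / real n"
    using u(1) by (intro eventually_sequentiallyI[of 1]) simp
  then have "(\<lambda>n. ln \<bar>X n\<bar> / real n) \<longlonglongrightarrow> m" using * by (simp only: tendsto_cong)
  moreover have "\<forall>\<^sub>F n in sequentially. X n \<noteq> 0"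
    using conjunct1[OF *] eventually_ge_at_top[of 1] by eventually_elim (use u(1) in fastforce)
  ultimately show ?thesis by blast
qed

text \<open>Paths are quantified inside the almost sure event, so one exceptional set, depending on
  the coins alone, serves for every path that follows the recursion.\<close>

lemma (in prob_space) nonlinear_growth:
  fixes b :: "nat \<Rightarrow> 'a \<Rightarrow> bool"
  assumes ind: "indep_vars (\<lambda>_. count_space UNIV) b {1..}"
    and p: "\<forall>n\<ge>1. prob {\<omega> \<in> space M. b n \<omega>} = p"
    and q: "0 \<le> q" "q < 1" "p * (1 + q + q\<^sup>2) = 1"
  shows "integrable (nu (1 / (1 + q))) ln \<and> (AE \<omega> in M. \<forall>X. X 1 = 1 \<and> X 2 = 1 \<and>
      (\<forall>n\<ge>1. X (n + 2) = (if b n \<omega> then X (n + 1) + X n else \<bar>X (n + 1) - X n\<bar>)) \<longrightarrow>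
      (\<forall>\<^sub>F n in sequentially. X n \<noteq> 0) \<and> (\<lambda>n. ln \<bar>X n\<bar> / real n) \<longlonglongrightarrow> (\<integral>x. ln x \<partial>nu (1 / (1 + q))))"
proof -
  obtain h :: "real \<Rightarrow> real \<Rightarrow> real" and m C where m: "0 < m" "integrable (nu (1 / (1 + q))) ln" "(\<integral>x. ln x \<partial>nu (1 / (1 + q))) = m"
    and C: "\<And>a b. 0 \<le> a \<Longrightarrow> 0 \<le> b \<Longrightarrow> 0 < max a b \<Longrightarrow> \<bar>h a b - ln (max a b)\<bar> \<le> C"
    and h: "\<And>a b. 0 \<le> a \<Longrightarrow> 0 \<le> b \<Longrightarrow> 0 < max a b \<Longrightarrow> p * h b (a + b) + (1 - p) * h b \<bar>a - b\<bar> = h a b + m"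
    by (rule ex_potential_nonlinear[OF q]) (rule that; assumption)
  define t where "t c x y = (if c then y + x else \<bar>y - x\<bar>)" for c and x y :: real
  define P where "P x y \<longleftrightarrow> 0 \<le> x \<and> 0 \<le> y \<and> 0 < max x y" for x y :: real
  have "AE \<omega> in M. \<forall>X. X 1 = 1 \<and> X 2 = 1 \<and> (\<forall>n\<ge>1. X (n + 2) = t (b n \<omega>) (X n) (X (n + 1))) \<longrightarrow>
    (\<lambda>n. ln (max \<bar>X n\<bar> \<bar>X (n + 1)\<bar>) / real n) \<longlonglongrightarrow> m"
  proof (rule AE_growth_rate[OF ind p, where P = P and h = h and C = C])
    show "P 1 1" by (simp add: P_def)
    show "P y (t c x y)" "x \<noteq> 0 \<or> y \<noteq> 0" "\<bar>t c x y\<bar> \<le> \<bar>x\<bar> + \<bar>y\<bar>" "\<bar>x\<bar> \<le> \<bar>y\<bar> + \<bar>t c x y\<bar>"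
      if "P x y" for c x y
      using that by (auto simp: P_def t_def max_def split: if_splits)
    show "\<bar>h x y - ln (max \<bar>x\<bar> \<bar>y\<bar>)\<bar> \<le> C" if "P x y" for x y using C[of x y] that by (simp add: P_def)
    show "p * h y (t True x y) + (1 - p) * h y (t False x y) = h x y + m" if "P x y" for x y
      using h[of x y] that by (simp add: P_def t_def add.commute abs_minus_commute)
  qed
  then have "AE \<omega> in M. \<forall>X. X 1 = 1 \<and> X 2 = 1 \<and>
      (\<forall>n\<ge>1. X (n + 2) = (if b n \<omega> then X (n + 1) + X n else \<bar>X (n + 1) - X n\<bar>)) \<longrightarrow>
      (\<forall>\<^sub>F n in sequentially. X n \<noteq> 0) \<and> (\<lambda>n. ln \<bar>X n\<bar> / real n) \<longlonglongrightarrow> m"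
  proof (eventually_elim, intro allI impI, elim conjE)
    fix \<omega> and X :: "nat \<Rightarrow> real"
    assume l: "\<forall>X. X 1 = 1 \<and> X 2 = 1 \<and> (\<forall>n\<ge>1. X (n + 2) = t (b n \<omega>) (X n) (X (n + 1))) \<longrightarrow>
      (\<lambda>n. ln (max \<bar>X n\<bar> \<bar>X (n + 1)\<bar>) / real n) \<longlonglongrightarrow> m"
      and X: "X 1 = 1" "X 2 = 1"
      and rec: "\<forall>n\<ge>1. X (n + 2) = (if b n \<omega> then X (n + 1) + X n else \<bar>X (n + 1) - X n\<bar>)"
    have lim: "(\<lambda>n. ln (max \<bar>X n\<bar> \<bar>X (n + 1)\<bar>) / real n) \<longlonglongrightarrow> m"
      using l X rec unfolding t_def by blast
    have "0 \<le> X n \<and> 0 \<le> X (n + 1)" if "1 \<le> n" for n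
      using that
    proof (induction n rule: dec_induct)
      case (step n)
      then show ?case using rec[rule_format, OF step(1)] by auto
    qed (use X in \<open>simp add: numeral_2_eq_2\<close>)
    then have "\<bar>X (n + 2)\<bar> = \<bar>X n\<bar> + \<bar>X (n + 1)\<bar> \<or> \<bar>X (n + 2)\<bar> = \<bar>\<bar>X n\<bar> - \<bar>X (n + 1)\<bar>\<bar>" if "1 \<le> n" for n
      using rec[rule_format, OF that] that by (auto simp: abs_minus_commute)
    then show "(\<forall>\<^sub>F n in sequentially. X n \<noteq> 0) \<and> (\<lambda>n. ln \<bar>X n\<bar> / real n) \<longlonglongrightarrow> m"
      by (rule walk_growth_of_max[OF X _ lim m(1)])
  qed
  then show ?thesis using m by simp
qed

lemma (in prob_space) linear_growth:
  fixes b :: "nat \<Rightarrow> 'a \<Rightarrow> bool"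
  assumes ind: "indep_vars (\<lambda>_. count_space UNIV) b {1..}"
    and p: "\<forall>n\<ge>1. prob {\<omega> \<in> space M. b n \<omega>} = p"
    and q: "0 < q" "q < 1" "(1 - p) * (1 - q\<^sup>2) = p * q"
  shows "integrable (nu (1 / (1 + q))) ln \<and> (AE \<omega> in M. \<forall>X. X 1 = 1 \<and> X 2 = 1 \<and>
      (\<forall>n\<ge>1. X (n + 2) = (if b n \<omega> then X (n + 1) + X n else X (n + 1) - X n)) \<longrightarrow>
      (\<forall>\<^sub>F n in sequentially. X n \<noteq> 0) \<and> (\<lambda>n. ln \<bar>X n\<bar> / real n) \<longlonglongrightarrow> (\<integral>x. ln x \<partial>nu (1 / (1 + q))))"
proof -
  obtain h :: "real \<Rightarrow> real \<Rightarrow> real" and m C where m: "0 < m" "integrable (nu (1 / (1 + q))) ln" "(\<integral>x. ln x \<partial>nu (1 / (1 + q))) = m"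
    and C: "\<And>x y. x \<noteq> 0 \<or> y \<noteq> 0 \<Longrightarrow> \<bar>h x y - ln (max \<bar>x\<bar> \<bar>y\<bar>)\<bar> \<le> C"
    and h: "\<And>x y. x \<noteq> 0 \<or> y \<noteq> 0 \<Longrightarrow> p * h y (y + x) + (1 - p) * h y (y - x) = h x y + m"
    by (rule ex_potential_linear[OF q]) (rule that; assumption)
  define t where "t c x y = (if c then y + x else y - x)" for c and x y :: real
  have "AE \<omega> in M. \<forall>X. X 1 = 1 \<and> X 2 = 1 \<and> (\<forall>n\<ge>1. X (n + 2) = t (b n \<omega>) (X n) (X (n + 1))) \<longrightarrow>
    (\<lambda>n. ln (max \<bar>X n\<bar> \<bar>X (n + 1)\<bar>) / real n) \<longlonglongrightarrow> m"
  proof (rule AE_growth_rate[OF ind p, where P = "\<lambda>x y. x \<noteq> 0 \<or> y \<noteq> 0" and h = h and C = C])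
    show "y \<noteq> 0 \<or> t c x y \<noteq> 0" "\<bar>t c x y\<bar> \<le> \<bar>x\<bar> + \<bar>y\<bar>" "\<bar>x\<bar> \<le> \<bar>y\<bar> + \<bar>t c x y\<bar>"
      if "x \<noteq> 0 \<or> y \<noteq> 0" for c and x y :: real
      using that by (auto simp: t_def)
    show "p * h y (t True x y) + (1 - p) * h y (t False x y) = h x y + m" if "x \<noteq> 0 \<or> y \<noteq> 0" for x y
      using h[OF that] by (simp add: t_def)
  qed (use C in auto)
  then have "AE \<omega> in M. \<forall>X. X 1 = 1 \<and> X 2 = 1 \<and>
      (\<forall>n\<ge>1. X (n + 2) = (if b n \<omega> then X (n + 1) + X n else X (n + 1) - X n)) \<longrightarrow>
      (\<forall>\<^sub>F n in sequentially. X n \<noteq> 0) \<and> (\<lambda>n. ln \<bar>X n\<bar> / real n) \<longlonglongrightarrow> m"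
  proof (eventually_elim, intro allI impI, elim conjE)
    fix \<omega> and X :: "nat \<Rightarrow> real"
    assume l: "\<forall>X. X 1 = 1 \<and> X 2 = 1 \<and> (\<forall>n\<ge>1. X (n + 2) = t (b n \<omega>) (X n) (X (n + 1))) \<longrightarrow>
      (\<lambda>n. ln (max \<bar>X n\<bar> \<bar>X (n + 1)\<bar>) / real n) \<longlonglongrightarrow> m"
      and X: "X 1 = 1" "X 2 = 1"
      and rec: "\<forall>n\<ge>1. X (n + 2) = (if b n \<omega> then X (n + 1) + X n else X (n + 1) - X n)"
    have lim: "(\<lambda>n. ln (max \<bar>X n\<bar> \<bar>X (n + 1)\<bar>) / real n) \<longlonglongrightarrow> m"
      using l X rec unfolding t_def by blast
    have abs: "\<bar>y + x\<bar> = \<bar>x\<bar> + \<bar>y\<bar> \<or> \<bar>y + x\<bar> = \<bar>\<bar>x\<bar> - \<bar>y\<bar>\<bar>" "\<bar>y - x\<bar> = \<bar>x\<bar> + \<bar>y\<bar> \<or> \<bar>y - x\<bar> = \<bar>\<bar>x\<bar> - \<bar>y\<bar>\<bar>"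
      for x y :: real by linarith+
    have "\<bar>X (n + 2)\<bar> = \<bar>X n\<bar> + \<bar>X (n + 1)\<bar> \<or> \<bar>X (n + 2)\<bar> = \<bar>\<bar>X n\<bar> - \<bar>X (n + 1)\<bar>\<bar>" if "1 \<le> n" for n
      unfolding rec[rule_format, OF that] using abs by simp
    then show "(\<forall>\<^sub>F n in sequentially. X n \<noteq> 0) \<and> (\<lambda>n. ln \<bar>X n\<bar> / real n) \<longlonglongrightarrow> m"
      by (rule walk_growth_of_max[OF X _ lim m(1)])
  qed
  then show ?thesis using m by simp
qed

lemma (in prob_space) nonlinear_subexponential:
  fixes b :: "nat \<Rightarrow> 'a \<Rightarrow> bool"
  assumes ind: "indep_vars (\<lambda>_. count_space UNIV) b {1..}"
    and p: "\<forall>n\<ge>1. prob {\<omega> \<in> space M. b n \<omega>} = p"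
    and p13: "p \<le> 1 / 3"
  shows "AE \<omega> in M. \<forall>X. X 1 = 1 \<and> X 2 = 1 \<and>
      (\<forall>n\<ge>1. X (n + 2) = (if b n \<omega> then X (n + 1) + X n else \<bar>X (n + 1) - X n\<bar>)) \<longrightarrow>
      (\<lambda>n. ln \<bar>X n\<bar> / real n) \<longlonglongrightarrow> 0"
proof -
  have "AE \<omega> in M. (\<lambda>n. (\<Sum>k\<in>{1..<n}. 1 * (of_bool (b k \<omega>) - p)) / real n) \<longlonglongrightarrow> 0"
    by (rule AE_noise_average_tendsto_0[OF ind p, where \<Phi> = "\<lambda>_. 1" and K = 1]) auto
  then show ?thesis
  proof (eventually_elim, intro allI impI, elim conjE)
    fix \<omega> and X :: "nat \<Rightarrow> real"
    assume l: "(\<lambda>n. (\<Sum>k\<in>{1..<n}. 1 * (of_bool (b k \<omega>) - p)) / real n) \<longlonglongrightarrow> 0"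
      and X: "X 1 = 1" "X 2 = 1"
      and rec: "\<forall>n\<ge>1. X (n + 2) = (if b n \<omega> then X (n + 1) + X n else \<bar>X (n + 1) - X n\<bar>)"
    have pos: "0 \<le> X n \<and> 0 \<le> X (n + 1)" if "1 \<le> n" for n
      using that
    proof (induction n rule: dec_induct)
      case (step n)
      then show ?case using rec[rule_format, OF step(1)] by auto
    qed (use X in \<open>simp add: numeral_2_eq_2\<close>)
    then have "\<bar>X (n + 2)\<bar> = \<bar>X n\<bar> + \<bar>X (n + 1)\<bar> \<or> \<bar>X (n + 2)\<bar> = \<bar>\<bar>X n\<bar> - \<bar>X (n + 1)\<bar>\<bar>" if "1 \<le> n" for n
      using rec[rule_format, OF that] that by (auto simp: abs_minus_commute)
    then obtain u :: "nat \<Rightarrow> nat" where u: "\<And>n. 1 \<le> n \<Longrightarrow> \<bar>X n\<bar> = real (u n)" "u 1 = 1" "u 2 = 1"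
      using abs_walk_nat[of X, OF X] by metis
    have urec: "if b n \<omega> then u (n + 2) = u n + u (n + 1) else int (u (n + 2)) = \<bar>int (u n) - int (u (n + 1))\<bar>"
      if n: "1 \<le> n" for n
    proof -
      have e: "X n = real (u n)" "X (n + 1) = real (u (n + 1))" "X (n + 2) = real (u (n + 2))"
        using u(1)[of n] u(1)[of "n + 1"] u(1)[of "n + 2"] pos[of n] pos[of "n + 1"] n by auto
      show ?thesis
      proof (cases "b n \<omega>")
        case True
        then have "real (u (n + 2)) = real (u n + u (n + 1))" using rec[rule_format, OF n] unfolding e by simp
        then show ?thesis using True by (simp only: of_nat_eq_iff if_True)
      next
        case False
        then have "real_of_int (int (u (n + 2))) = real_of_int \<bar>int (u n) - int (u (n + 1))\<bar>"
          using rec[rule_format, OF n] unfolding e by (simp add: abs_minus_commute)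
        then show ?thesis using False by (simp only: of_int_eq_iff if_False)
      qed
    qed
    have "(\<lambda>n. ln (real (u n)) / real n) \<longlonglongrightarrow> 0"
      by (rule subexponential_growth[OF u(2,3) urec p13]) (use l in simp_all)
    moreover have "\<forall>\<^sub>F n in sequentially. ln \<bar>X n\<bar> / real n = ln (real (u n)) / real n"
      using u(1) by (intro eventually_sequentiallyI[of 1]) simp
    ultimately show "(\<lambda>n. ln \<bar>X n\<bar> / real n) \<longlonglongrightarrow> 0" by (simp only: tendsto_cong)
  qed
qed

section \<open>Solving for \<open>q\<close> and matching \<open>\<alpha>\<close>\<close>

text \<open>The witness is the nonnegative root of \<open>p q^2 + p q + p - 1\<close>, whose
  discriminant is \<open>p (4 - 3 p)\<close>.\<close>

lemma nonlinear_parameter: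
  fixes p :: real
  assumes "1 / 3 \<le> p" "p \<le> 1"
  obtains q where "0 \<le> q" "1 / 3 < p \<Longrightarrow> q < 1" "p = 1 / 3 \<Longrightarrow> q = 1" "p * (1 + q + q\<^sup>2) = 1"
    "2 * p / (p + sqrt (p * (4 - 3 * p))) = 1 / (1 + q)"
proof -
  define w where "w = sqrt (p * (4 - 3 * p))"
  have p: "0 < p" using assms by simp
  have w2: "w\<^sup>2 = p * (4 - 3 * p)" unfolding w_def using assms p by simp
  have pw: "p \<le> w"
  proof -
    have "p * p \<le> p * (4 - 3 * p)" using assms p by (intro mult_left_mono) auto
    then show ?thesis unfolding w_def by (intro real_le_rsqrt) (simp add: power2_eq_square)
  qed
  show thesis
  proof (rule that[of "(w - p) / (2 * p)"])
    show "0 \<le> (w - p) / (2 * p)" using p pw by simp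
    show "(w - p) / (2 * p) < 1" if "1 / 3 < p"
    proof -
      have "p * (4 - 3 * p) < p * (9 * p)" using that p by (intro mult_strict_left_mono) auto
      then have "w < 3 * p" unfolding w_def using p by (intro real_less_lsqrt) (auto simp: power2_eq_square)
      then show ?thesis using p by (simp add: field_simps)
    qed
    show "(w - p) / (2 * p) = 1" if "p = 1 / 3" unfolding w_def that by simp
    have "p * (1 + (w - p) / (2 * p) + ((w - p) / (2 * p))\<^sup>2) = (4 * p\<^sup>2 + 2 * p * (w - p) + (w - p)\<^sup>2) / (4 * p)"
      using p by (simp add: field_simps power2_eq_square)
    also have "4 * p\<^sup>2 + 2 * p * (w - p) + (w - p)\<^sup>2 = 3 * p\<^sup>2 + w\<^sup>2" by (simp add: power2_eq_square algebra_simps)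
    also have "\<dots> = 4 * p" unfolding w2 by (simp add: power2_eq_square algebra_simps)
    finally show "p * (1 + (w - p) / (2 * p) + ((w - p) / (2 * p))\<^sup>2) = 1" using p by simp
    show "2 * p / (p + sqrt (p * (4 - 3 * p))) = 1 / (1 + (w - p) / (2 * p))"
      unfolding w_def[symmetric] using p pw by (simp add: field_simps)
  qed
qed

text \<open>The witness is the positive root of \<open>(1 - p) q^2 + p q - (1 - p)\<close>, with
  discriminant \<open>p^2 + 4 (1 - p)^2\<close>. The quadratic degenerates at
  \<open>p = 1\<close>.\<close>

lemma linear_parameter:
  fixes p :: real
  assumes "0 < p" "p < 1"
  obtains q where "0 < q" "q < 1" "(1 - p) * (1 - q\<^sup>2) = p * q"
    "(3 * p - 2 + sqrt (5 * p\<^sup>2 - 8 * p + 4)) / (2 * p) = 1 / (1 + q)"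
proof -
  define w where "w = sqrt (5 * p\<^sup>2 - 8 * p + 4)"
  define d where "d = 1 - p"
  have d: "0 < d" "p = 1 - d" using assms by (auto simp: d_def)
  have e: "5 * p\<^sup>2 - 8 * p + 4 = p\<^sup>2 + (2 * d)\<^sup>2" by (simp add: d_def power2_eq_square algebra_simps)
  have w2: "w\<^sup>2 = p\<^sup>2 + (2 * d)\<^sup>2" unfolding w_def e by simp
  have w0: "0 \<le> w" unfolding w_def e by simp
  have pw: "p < w" using assms d by (intro power2_less_imp_less[OF _ w0]) (simp add: w2)
  have w1: "w < 2 * d + p"
  proof (rule power2_less_imp_less)
    have "0 < 4 * d * p" using d(1) assms by simp
    then show "w\<^sup>2 < (2 * d + p)\<^sup>2" unfolding w2 by (simp add: power2_eq_square algebra_simps)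
    show "0 \<le> 2 * d + p" using assms d(1) by simp
  qed
  show thesis
  proof (rule that[of "(w - p) / (2 * d)"])
    show "0 < (w - p) / (2 * d)" using pw d(1) by simp
    show "(w - p) / (2 * d) < 1" using w1 d(1) by (simp add: field_simps)
    have "(1 - p) * (1 - ((w - p) / (2 * d))\<^sup>2) - p * ((w - p) / (2 * d))
        = ((2 * d)\<^sup>2 - (w - p)\<^sup>2 - 2 * p * (w - p)) / (4 * d)"
      unfolding d_def[symmetric] using d(1) by (simp add: field_simps power2_eq_square)
    also have "(2 * d)\<^sup>2 - (w - p)\<^sup>2 - 2 * p * (w - p) = (2 * d)\<^sup>2 + p\<^sup>2 - w\<^sup>2"
      by (simp add: power2_eq_square algebra_simps)
    also have "\<dots> = 0" unfolding w2 by simp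
    finally show "(1 - p) * (1 - ((w - p) / (2 * d))\<^sup>2) = p * ((w - p) / (2 * d))" by simp
    \<comment> \<open>Since \<open>2 * d - p = 2 - 3 * p\<close>, the product is a difference of
      squares; it rationalises \<open>1 / (1 + q)\<close>.\<close>
    have "(3 * p - 2 + w) * (2 * d + (w - p)) = w\<^sup>2 - (3 * p - 2)\<^sup>2" by (simp add: d_def power2_eq_square algebra_simps)
    also have "\<dots> = 2 * p * (2 * d)" unfolding w2 by (simp add: d_def power2_eq_square algebra_simps)
    finally have "(3 * p - 2 + w) / (2 * p) = 2 * d / (2 * d + (w - p))"
      using assms d(1) pw by (simp add: frac_eq_eq mult_ac)
    also have "\<dots> = 1 / (1 + (w - p) / (2 * d))" using d(1) pw by (simp add: field_simps)
    finally show "(3 * p - 2 + sqrt (5 * p\<^sup>2 - 8 * p + 4)) / (2 * p) = 1 / (1 + (w - p) / (2 * d))"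
      unfolding w_def .
  qed
qed

text \<open>\<open>\<alpha> = 1 / 2\<close> corresponds to \<open>p = 1 / 3\<close>, where the two
  regimes meet: the factor \<open>2 * \<alpha> - 1\<close> in \<open>mean_eq\<close>
  vanishes.\<close>

lemma nu_half: "integrable (nu (1 / 2)) ln" "(\<integral>x. ln x \<partial>nu (1 / 2)) = 0"
proof -
  obtain \<mu> where "stationary_log \<mu> (1 / 2)" by (rule ex_stationary_log_locale[of "1 / 2"]) auto
  then interpret stationary_log \<mu> "1 / 2" .
  show "integrable (nu (1 / 2)) ln" "(\<integral>x. ln x \<partial>nu (1 / 2)) = 0" using nu_ln mean_eq by simp_all
qed

theorem theorem1p1:
  fixes M :: "'a measure"
    and s F G :: "nat \<Rightarrow> 'a \<Rightarrow> real"
    and p :: real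
  assumes "prob_space M"
    and "0 < p" and "p \<le> 1"
    and "prob_space.indep_vars M (\<lambda>_. borel) s {1..}"
    and "\<And>n. 1 \<le> n \<Longrightarrow> measure M {\<omega> \<in> space M. s n \<omega> = 1} = p"
    and "\<And>n. 1 \<le> n \<Longrightarrow> measure M {\<omega> \<in> space M. s n \<omega> = - 1} = 1 - p"
    and "\<And>\<omega>. \<omega> \<in> space M \<Longrightarrow> F 1 \<omega> = 1"
    and "\<And>\<omega>. \<omega> \<in> space M \<Longrightarrow> F 2 \<omega> = 1"
    and "\<And>n \<omega>. 1 \<le> n \<Longrightarrow> \<omega> \<in> space M \<Longrightarrow>
           F (n + 2) \<omega> = F (n + 1) \<omega> + s n \<omega> * F n \<omega>"
    and "\<And>\<omega>. \<omega> \<in> space M \<Longrightarrow> G 1 \<omega> = 1"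
    and "\<And>\<omega>. \<omega> \<in> space M \<Longrightarrow> G 2 \<omega> = 1"
    and "\<And>n \<omega>. 1 \<le> n \<Longrightarrow> \<omega> \<in> space M \<Longrightarrow>
           G (n + 2) \<omega> = \<bar>G (n + 1) \<omega> + s n \<omega> * G n \<omega>\<bar>"
  shows
    "(let \<alpha> = (3 * p - 2 + sqrt (5 * p^2 - 8 * p + 4)) / (2 * p) in
        integrable (nu \<alpha>) ln \<and>
        (AE \<omega> in M.
           eventually (\<lambda>n. F n \<omega> \<noteq> 0) sequentially \<and>
           (\<lambda>n. 1 / real n * ln \<bar>F n \<omega>\<bar>) \<longlonglongrightarrow> (\<integral>x. ln x \<partial>nu \<alpha>))) \<and>
     (p \<le> 1/3 \<longrightarrow>
        (AE \<omega> in M. (\<lambda>n. 1 / real n * ln (G n \<omega>)) \<longlonglongrightarrow> 0)) \<and>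
     (1/3 \<le> p \<longrightarrow>
        (let \<alpha> = 2 * p / (p + sqrt (p * (4 - 3 * p))) in
           integrable (nu \<alpha>) ln \<and>
           (AE \<omega> in M.
              (1/3 < p \<longrightarrow> eventually (\<lambda>n. G n \<omega> \<noteq> 0) sequentially) \<and>
              (\<lambda>n. 1 / real n * ln (G n \<omega>)) \<longlonglongrightarrow> (\<integral>x. ln x \<partial>nu \<alpha>))))"
proof -
  interpret prob_space M by fact
  note F1 = assms(7) and F2 = assms(8) and Frec = assms(9) and G1 = assms(10) and G2 = assms(11) and Grec = assms(12)
  define b where "b n \<omega> = (s n \<omega> = 1)" for n \<omega>
  have ind: "indep_vars (\<lambda>_. count_space UNIV) b {1..}"
    unfolding b_def by (rule indep_vars_compose2[OF assms(4), where Y = "\<lambda>_ x. x = 1"]) measurable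
  have pb: "\<forall>n\<ge>1. prob {\<omega> \<in> space M. b n \<omega>} = p" using assms(5) by (simp add: b_def)
  \<comment> \<open>The events of sign \<open>1\<close> and sign \<open>- 1\<close> are disjoint and
    their probabilities add up to 1, so almost surely the coin \<open>b\<close> determines the
    sign.\<close>
  have sgn: "AE \<omega> in M. \<forall>n\<ge>1. s n \<omega> = (if b n \<omega> then 1 else - 1)"
  proof -
    have "AE \<omega> in M. 1 \<le> n \<longrightarrow> s n \<omega> = (if b n \<omega> then 1 else - 1)" for n
    proof (cases "1 \<le> n")
      case True
      have [measurable]: "s n \<in> borel_measurable M" using assms(4) True by (auto simp: indep_vars_def)
      have "prob ({\<omega> \<in> space M. s n \<omega> = 1} \<union> {\<omega> \<in> space M. s n \<omega> = - 1}) = p + (1 - p)"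
        using assms(5,6)[OF True] by (subst finite_measure_Union) auto
      then have "prob {\<omega> \<in> space M. s n \<omega> = 1 \<or> s n \<omega> = - 1} = 1"
        by (simp add: Collect_disj_eq[symmetric] conj_disj_distribL[symmetric] Un_def)
      then have "AE \<omega> in M. s n \<omega> = 1 \<or> s n \<omega> = - 1" by (subst prob_Collect_eq_1[symmetric]) auto
      then show ?thesis by eventually_elim (auto simp: b_def)
    qed simp
    then show ?thesis by (simp add: AE_all_countable)
  qed
  have Gpath: "AE \<omega> in M. (\<lambda>n. G n \<omega>) 1 = 1 \<and> (\<lambda>n. G n \<omega>) 2 = 1 \<and>
      (\<forall>n\<ge>1. G (n + 2) \<omega> = (if b n \<omega> then G (n + 1) \<omega> + G n \<omega> else \<bar>G (n + 1) \<omega> - G n \<omega>\<bar>)) \<and> (\<forall>n\<ge>1. \<bar>G n \<omega>\<bar> = G n \<omega>)"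
    using sgn AE_space
  proof eventually_elim
    case (elim \<omega>)
    \<comment> \<open>Nonnegativity removes the absolute value for a plus sign, and later inside the
      logarithm.\<close>
    have pos: "0 \<le> G n \<omega>" if "1 \<le> n" for n
    proof -
      have "n = 1 \<or> n = 2 \<or> (1 \<le> n - 2 \<and> n = (n - 2) + 2)" using that by linarith
      then consider "n = 1" | "n = 2" | m where "1 \<le> m" "n = m + 2" by blast
      then show ?thesis using G1 G2 Grec elim by cases auto
    qed
    have "G (n + 2) \<omega> = (if b n \<omega> then G (n + 1) \<omega> + G n \<omega> else \<bar>G (n + 1) \<omega> - G n \<omega>\<bar>)" if "1 \<le> n" for n
      using Grec[OF that] elim that pos[of n] pos[of "n + 1"] by simp
    then show ?case using G1 G2 elim pos by auto
  qed
  have Fpath: "AE \<omega> in M. (\<lambda>n. F n \<omega>) 1 = 1 \<and> (\<lambda>n. F n \<omega>) 2 = 1 \<and>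
      (\<forall>n\<ge>1. F (n + 2) \<omega> = (if b n \<omega> then F (n + 1) \<omega> + F n \<omega> else F (n + 1) \<omega> - F n \<omega>))"
    using sgn AE_space
  proof eventually_elim
    case (elim \<omega>)
    have "F (n + 2) \<omega> = (if b n \<omega> then F (n + 1) \<omega> + F n \<omega> else F (n + 1) \<omega> - F n \<omega>)" if "1 \<le> n" for n
      using Frec[OF that] elim that by simp
    then show ?case using F1 F2 elim by auto
  qed
  have nonlin: "integrable (nu (1 / (1 + q))) ln \<and>
      (AE \<omega> in M. (\<forall>\<^sub>F n in sequentially. G n \<omega> \<noteq> 0) \<and> (\<lambda>n. ln \<bar>G n \<omega>\<bar> / real n) \<longlonglongrightarrow> (\<integral>x. ln x \<partial>nu (1 / (1 + q))))"
    if q: "0 \<le> q" "q < 1" "p * (1 + q + q\<^sup>2) = 1" for q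
  proof -
    note N = nonlinear_growth[OF ind pb q]
    have "AE \<omega> in M. (\<forall>\<^sub>F n in sequentially. G n \<omega> \<noteq> 0) \<and> (\<lambda>n. ln \<bar>G n \<omega>\<bar> / real n) \<longlonglongrightarrow> (\<integral>x. ln x \<partial>nu (1 / (1 + q)))"
      using conjunct2[OF N] Gpath
    proof eventually_elim
      case (elim \<omega>)
      from elim(1)[rule_format, of "\<lambda>n. G n \<omega>"] elim(2) show ?case by blast
    qed
    then show ?thesis using N by blast
  qed
  have Gabs: "(\<lambda>n. ln (G n \<omega>) / real n) \<longlonglongrightarrow> l" if "(\<lambda>n. ln \<bar>G n \<omega>\<bar> / real n) \<longlonglongrightarrow> l" "\<forall>n\<ge>1. \<bar>G n \<omega>\<bar> = G n \<omega>" for \<omega> l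
  proof -
    have "\<forall>\<^sub>F n in sequentially. ln \<bar>G n \<omega>\<bar> / real n = ln (G n \<omega>) / real n"
      using that(2) by (intro eventually_sequentiallyI[of 1]) simp
    then show ?thesis using that(1) by (simp only: tendsto_cong)
  qed
  have sub: "AE \<omega> in M. (\<lambda>n. ln (G n \<omega>) / real n) \<longlonglongrightarrow> 0" if "p \<le> 1 / 3"
    using nonlinear_subexponential[OF ind pb that] Gpath
  proof eventually_elim
    case (elim \<omega>)
    from elim(1)[rule_format, of "\<lambda>n. G n \<omega>"] elim(2) show ?case using Gabs by blast
  qed
  have lin: "integrable (nu \<alpha>) ln \<and> (AE \<omega> in M. (\<forall>\<^sub>F n in sequentially. F n \<omega> \<noteq> 0) \<and> (\<lambda>n. ln \<bar>F n \<omega>\<bar> / real n) \<longlonglongrightarrow> (\<integral>x. ln x \<partial>nu \<alpha>))"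
    if \<alpha>: "\<alpha> = (3 * p - 2 + sqrt (5 * p\<^sup>2 - 8 * p + 4)) / (2 * p)" for \<alpha>
  proof (cases "p = 1")
    case False
    with assms(2,3) obtain q where q: "0 < q" "q < 1" "(1 - p) * (1 - q\<^sup>2) = p * q"
      and \<alpha>q: "(3 * p - 2 + sqrt (5 * p\<^sup>2 - 8 * p + 4)) / (2 * p) = 1 / (1 + q)"
      by (elim linear_parameter[of p, rotated 2]) auto
    note N = linear_growth[OF ind pb q]
    have "AE \<omega> in M. (\<forall>\<^sub>F n in sequentially. F n \<omega> \<noteq> 0) \<and> (\<lambda>n. ln \<bar>F n \<omega>\<bar> / real n) \<longlonglongrightarrow> (\<integral>x. ln x \<partial>nu (1 / (1 + q)))"
      using conjunct2[OF N] Fpath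
    proof eventually_elim
      case (elim \<omega>)
      from elim(1)[rule_format, of "\<lambda>n. F n \<omega>"] elim(2) show ?case by blast
    qed
    then show ?thesis using N unfolding \<alpha> \<alpha>q by blast
  next
    case True
    \<comment> \<open>At \<open>p = 1\<close> all signs are almost surely plus, so both sequences
      coincide and the nonlinear result with \<open>q = 0\<close>, \<open>\<alpha> = 1\<close>
      applies.\<close>
    have \<alpha>1: "\<alpha> = 1 / (1 + 0)" unfolding \<alpha> True by simp
    have "AE \<omega> in M. b n \<omega>" if "1 \<le> n" for n
    proof -
      have [measurable]: "Measurable.pred M (b n)" using ind that by (auto simp: indep_vars_def)
      have "{\<omega> \<in> space M. b n \<omega>} \<in> events" by measurable
      then show ?thesis using prob_Collect_eq_1[of "b n"] pb that True by simp
    qed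
    then have "AE \<omega> in M. \<forall>n. 1 \<le> n \<longrightarrow> b n \<omega>" by (subst AE_all_countable) auto
    then have eq: "AE \<omega> in M. \<forall>n\<ge>1. F n \<omega> = G n \<omega>"
      using Fpath Gpath
    proof eventually_elim
      case (elim \<omega>)
      have "F n \<omega> = G n \<omega> \<and> F (n + 1) \<omega> = G (n + 1) \<omega>" if "1 \<le> n" for n
        using that
      proof (induction n rule: dec_induct)
        case base
        then show ?case using elim by (simp add: numeral_2_eq_2)
      next
        case (step n)
        then show ?case using elim by simp
      qed
      then show ?case by blast
    qed
    have N: "integrable (nu \<alpha>) ln" "AE \<omega> in M. (\<forall>\<^sub>F n in sequentially. G n \<omega> \<noteq> 0) \<and> (\<lambda>n. ln \<bar>G n \<omega>\<bar> / real n) \<longlonglongrightarrow> (\<integral>x. ln x \<partial>nu \<alpha>)"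
      using nonlin[of 0] True unfolding \<alpha>1 by auto
    from N(2) eq have "AE \<omega> in M. (\<forall>\<^sub>F n in sequentially. F n \<omega> \<noteq> 0) \<and> (\<lambda>n. ln \<bar>F n \<omega>\<bar> / real n) \<longlonglongrightarrow> (\<integral>x. ln x \<partial>nu \<alpha>)"
    proof eventually_elim
      case (elim \<omega>)
      have "\<forall>\<^sub>F n in sequentially. F n \<omega> = G n \<omega>"
        using elim(2) by (intro eventually_sequentiallyI[of 1]) simp
      then have "\<forall>\<^sub>F n in sequentially. F n \<omega> \<noteq> 0" "\<forall>\<^sub>F n in sequentially. ln \<bar>G n \<omega>\<bar> / real n = ln \<bar>F n \<omega>\<bar> / real n"
        using elim(1) by (auto elim: eventually_elim2)
      then show ?case using elim(1) by (simp only: tendsto_cong)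
    qed
    then show ?thesis using N(1) by blast
  qed
  have non: "integrable (nu \<alpha>) ln \<and> (AE \<omega> in M. (1 / 3 < p \<longrightarrow> (\<forall>\<^sub>F n in sequentially. G n \<omega> \<noteq> 0)) \<and> (\<lambda>n. ln (G n \<omega>) / real n) \<longlonglongrightarrow> (\<integral>x. ln x \<partial>nu \<alpha>))"
    if p13: "1 / 3 \<le> p" and \<alpha>: "\<alpha> = 2 * p / (p + sqrt (p * (4 - 3 * p)))" for \<alpha>
  proof -
    obtain q where q: "0 \<le> q" "1 / 3 < p \<Longrightarrow> q < 1" "p = 1 / 3 \<Longrightarrow> q = 1" "p * (1 + q + q\<^sup>2) = 1"
      and \<alpha>q: "2 * p / (p + sqrt (p * (4 - 3 * p))) = 1 / (1 + q)"
      using nonlinear_parameter[OF p13 assms(3)] by blast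
    show ?thesis
    proof (cases "p = 1 / 3")
      case True
      have \<alpha>2: "\<alpha> = 1 / 2" unfolding \<alpha> \<alpha>q q(3)[OF True] by simp
      from sub True have "AE \<omega> in M. (\<lambda>n. ln (G n \<omega>) / real n) \<longlonglongrightarrow> 0" by simp
      then show ?thesis unfolding \<alpha>2 nu_half(2) using nu_half(1) True by simp
    next
      case False
      then have p': "1 / 3 < p" using p13 by simp
      note N = nonlin[OF q(1) q(2)[OF p'] q(4)]
      from conjunct2[OF N] Gpath have "AE \<omega> in M. (1 / 3 < p \<longrightarrow> (\<forall>\<^sub>F n in sequentially. G n \<omega> \<noteq> 0)) \<and> (\<lambda>n. ln (G n \<omega>) / real n) \<longlonglongrightarrow> (\<integral>x. ln x \<partial>nu (1 / (1 + q)))"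
        by eventually_elim (use Gabs in blast)
      then show ?thesis using N unfolding \<alpha> \<alpha>q by blast
    qed
  qed
  show ?thesis
    using lin[OF refl] sub non[OF _ refl] by (simp add: Let_def)
qed

end
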